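(* For any integer $d\ge1$ the following holds. (i) The upper bound $K^{\mathscr S}_{\ell,2\ell,2\ell,d}$ is such that $$K^{\mathscr S}_{\ell,2\ell,2\ell,d}=\frac{1+O(1/\ell)}{(16\pi\ell)^{d/4}}\qquad(\ell\to+\infty).$$ (ii) Let $\Delta_{22}:=\{(\xi,\eta)\in(0,\frac12)\times(0,\frac12):\ \xi+\eta<1\}$. The function $$D_{22}:\Delta_{22}\to(0,+\infty),\qquad D_{22}(\xi,\eta):=\frac{(1-\xi-\eta)(\xi+\eta)}{\xi\eta(1-2\xi)(1-2\eta)}$$ attains its minimum at $\xi=\eta=1/4$, and $D_{22}(1/4,1/4)=16$; the corresponding lower bound satisfies $$\mathscr K^F_{\ell,2\ell,2\ell,d}\Big(\frac1{4\ell},\frac1{4\ell}\Big)=\frac{1+O(1/\ell)}{(16\pi\ell)^{d/4}}\qquad(\ell\to+\infty).$$ (iii) As a consequence, $$K_{\ell,2\ell,2\ell,d}=\frac{1+O(1/\ell)}{(16\pi\ell)^{d/4}}\qquad(\ell\to+\infty).$$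
   Context: Here $\ell$ is a real variable. The Fourier transform $\mathcal F$ is normalized so that $\mathcal F f(k)=(2\pi)^{-d/2}\int_{\mathbb R^d}e^{-ik\cdot x}f(x)\,dx$. For real $\ell\ge0$, $H^\ell(\mathbb R^d,\mathbb C)=\{f\in S'(\mathbb R^d,\mathbb C): (1+|k|^2)^{\ell/2}\mathcal F f\in L^2\}$, $\|f\|_\ell=\|(1+|k|^2)^{\ell/2}\mathcal F f\|_{L^2}$. For real $0\le\ell\le m\le n$ with $m+n-\ell>d/2$, the sharp constant is $$K_{\ell mnd}:=\min\{K\in[0,+\infty):\ \|fg\|_\ell\le K\|f\|_m\|g\|_n\ \text{ for all } f\in H^m(\mathbb R^d,\mathbb C),\ g\in H^n(\mathbb R^d,\mathbb C)\}.$$ The upper bound $K^{\mathscr S}_{\ell mnd}$ for $K_{\ell mnd}$ is $K^{\mathscr S}_{\ell mnd}:=\sqrt{\sup_{u\in[0,+\infty)}\mathscr S_{\ell mnd}(u)}$, where $$\mathscr S_{\ell mnd}(u):=\frac{\Gamma(m+n-d/2)}{(4\pi)^{d/2}\Gamma(m+n)}(1+4u)^\ell\,{}_3F_2\Big(m+n-\tfrac d2,m,n;\tfrac{m+n}2,\tfrac{m+n+1}2;-u\Big),$$ ${}_3F_2$ being the generalized hypergeometric function, real-analytically continued from $(-1,1)$ to $(-\infty,1)$ in its argument. For $\sigma,\tau>0$, the lower bound $\mathscr K^F_{\ell mnd}(\sigma,\tau)$ for $K_{\ell mnd}$ is $$\mathscr K^F_{\ell mnd}(\sigma,\tau):=\frac{\|f_{\sigma+\tau,d}\|_\ell}{\|f_{\sigma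 d}\|_m\|f_{\tau d}\|_n},\qquad f_{\sigma d}(x):=e^{-\sigma|x|^2/2}\ \ (x\in\mathbb R^d).$$ *)

theory Defs
  imports
    "HOL-Analysis.Analysis"
    "HOL-Library.Landau_Symbols"
begin

section \<open>Schwartz functions and tempered distributions\<close>

text \<open>
  All spaces are over a Euclidean space \<^typ>\<open>'a::euclidean_space\<close>; the dimension \<open>d\<close> is
  \<open>DIM('a)\<close>. Functions are complex valued and integrals are taken with respect to \<^const>\<open>lborel\<close>.
\<close>

primrec iter_partial :: "'a list \<Rightarrow> ('a::euclidean_space \<Rightarrow> complex) \<Rightarrow> 'a \<Rightarrow> complex" where
  "iter_partial [] f = f"
| "iter_partial (b # bs) f = (\<lambda>x. frechet_derivative (iter_partial bs f) (at x) b)"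

text \<open>
  A function is smooth if all its iterated partial derivatives along coordinate directions exist
  and are again (totally) differentiable.
\<close>

definition schwartz :: "('a::euclidean_space \<Rightarrow> complex) set" where
  "schwartz = {\<phi>. \<forall>bs. set bs \<subseteq> Basis \<longrightarrow>
     (\<forall>x. iter_partial bs \<phi> differentiable (at x)) \<and>
     (\<forall>N::nat. bounded (range (\<lambda>x. norm x ^ N *\<^sub>R iter_partial bs \<phi> x)))}"

definition schwartz_null_seq :: "(nat \<Rightarrow> 'a::euclidean_space \<Rightarrow> complex) \<Rightarrow> bool" where
  "schwartz_null_seq \<phi> \<longleftrightarrow> (\<forall>j. \<phi> j \<in> schwartz) \<and>
     (\<forall>bs N. set bs \<subseteq> Basis \<longrightarrow>
        uniform_limit UNIV (\<lambda>j x. norm x ^ N *\<^sub>R iter_partial bs (\<phi> j) x) (\<lambda>x. 0) sequentially)"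

text \<open>
  A tempered distribution is a functional on the Schwartz space; its values outside
  \<^const>\<open>schwartz\<close> carry no meaning. As the Schwartz space is metrizable, continuity of a linear
  functional is sequential continuity at zero.
\<close>

type_synonym 'a functional = "('a \<Rightarrow> complex) \<Rightarrow> complex"

definition tempered :: "'a::euclidean_space functional \<Rightarrow> bool" where
  "tempered T \<longleftrightarrow>
     (\<forall>\<phi>\<in>schwartz. \<forall>\<psi>\<in>schwartz. T (\<lambda>x. \<phi> x + \<psi> x) = T \<phi> + T \<psi>) \<and>
     (\<forall>\<phi>\<in>schwartz. \<forall>c. T (\<lambda>x. c * \<phi> x) = c * T \<phi>) \<and>
     (\<forall>\<phi>. schwartz_null_seq \<phi> \<longrightarrow> (\<lambda>j. T (\<phi> j)) \<longlonglongrightarrow> 0)"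

definition represents :: "('a::euclidean_space \<Rightarrow> complex) \<Rightarrow> 'a functional \<Rightarrow> bool" where
  "represents f T \<longleftrightarrow> f \<in> borel_measurable lborel \<and>
     (\<forall>\<phi>\<in>schwartz. integrable lborel (\<lambda>x. f x * \<phi> x) \<and> T \<phi> = (LINT x|lborel. f x * \<phi> x))"

definition fourier :: "('a::euclidean_space \<Rightarrow> complex) \<Rightarrow> 'a \<Rightarrow> complex" where
  "fourier f k = complex_of_real ((2 * pi) powr (- real DIM('a) / 2)) *
     (LINT x|lborel. exp (- \<i> * complex_of_real (k \<bullet> x)) * f x)"

definition fourier_distr :: "'a::euclidean_space functional \<Rightarrow> 'a functional" where
  "fourier_distr T = (\<lambda>\<phi>. T (fourier \<phi>))"

definition mult_distr ::
    "('a::euclidean_space \<Rightarrow> real) \<Rightarrow> 'a functional \<Rightarrow> 'a functional" where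
  "mult_distr w T = (\<lambda>\<phi>. T (\<lambda>k. complex_of_real (w k) * \<phi> k))"


section \<open>Sobolev spaces and the sharp constant\<close>

definition square_int :: "('a::euclidean_space \<Rightarrow> complex) \<Rightarrow> bool" where
  "square_int h \<longleftrightarrow> h \<in> borel_measurable lborel \<and> integrable lborel (\<lambda>x. (cmod (h x))\<^sup>2)"

definition norm_L2 :: "('a::euclidean_space \<Rightarrow> complex) \<Rightarrow> real" where
  "norm_L2 h = sqrt (LINT x|lborel. (cmod (h x))\<^sup>2)"

definition bessel_weight :: "real \<Rightarrow> 'a::euclidean_space \<Rightarrow> real" where
  "bessel_weight l k = (1 + (norm k)\<^sup>2) powr (l / 2)"

definition sobolev_distr :: "real \<Rightarrow> 'a::euclidean_space functional set" where
  "sobolev_distr l = {T. tempered T \<and>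
     (\<exists>h. square_int h \<and> represents h (mult_distr (bessel_weight l) (fourier_distr T)))}"

text \<open>The representing \<open>h\<close> is unique almost everywhere, so the description determines the norm.\<close>

definition sobolev_distr_norm :: "real \<Rightarrow> 'a::euclidean_space functional \<Rightarrow> real" where
  "sobolev_distr_norm l T = (THE r. \<exists>h. square_int h \<and>
     represents h (mult_distr (bessel_weight l) (fourier_distr T)) \<and> r = norm_L2 h)"

text \<open>
  For \<open>l \<ge> 0\<close> every distribution in the Sobolev space is a (square integrable) function, which
  gives meaning to the pointwise product of two elements. We therefore pass to functions,
  identified with the distributions they represent.
\<close>

definition distr_of :: "('a::euclidean_space \<Rightarrow> complex) \<Rightarrow> 'a functional" where
  "distr_of f = (\<lambda>\<phi>. LINT x|lborel. f x * \<phi> x)"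

definition sobolev :: "real \<Rightarrow> ('a::euclidean_space \<Rightarrow> complex) set" where
  "sobolev l = {f. represents f (distr_of f) \<and> distr_of f \<in> sobolev_distr l}"

definition sobolev_norm :: "real \<Rightarrow> ('a::euclidean_space \<Rightarrow> complex) \<Rightarrow> real" where
  "sobolev_norm l f = sobolev_distr_norm l (distr_of f)"

text \<open>
  The inequality between norms includes that its left-hand side is finite, i.e. that the product
  lies in the Sobolev space of order \<open>l\<close>.
\<close>

definition sharp_const :: "'a::euclidean_space itself \<Rightarrow> real \<Rightarrow> real \<Rightarrow> real \<Rightarrow> real" where
  "sharp_const (d :: 'a itself) l m n = (LEAST K. 0 \<le> K \<and>
     (\<forall>(f :: 'a \<Rightarrow> complex) \<in> sobolev m. \<forall>g \<in> sobolev n.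
        (\<lambda>x. f x * g x) \<in> sobolev l \<and>
        sobolev_norm l (\<lambda>x. f x * g x) \<le> K * sobolev_norm m f * sobolev_norm n g))"


section \<open>The hypergeometric upper bound\<close>

definition real_analytic_on :: "(real \<Rightarrow> real) \<Rightarrow> real set \<Rightarrow> bool" where
  "real_analytic_on g S \<longleftrightarrow> (\<forall>x\<in>S. \<exists>F. (\<lambda>h. g (x + h)) has_fps_expansion F)"

text \<open>
  The value at \<open>w < 1\<close> of the real-analytic continuation of the hypergeometric series, which is
  unique by the identity theorem.
\<close>

definition hyp3F2 :: "real \<Rightarrow> real \<Rightarrow> real \<Rightarrow> real \<Rightarrow> real \<Rightarrow> real \<Rightarrow> real" where
  "hyp3F2 a1 a2 a3 b1 b2 w = (THE v. \<exists>g. real_analytic_on g {..<1} \<and>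
     (\<forall>x\<in>{-1<..<1}. g x = eval_fps (fps_hypergeo [a1, a2, a3] [b1, b2] 1) x) \<and> g w = v)"

definition S_fun :: "real \<Rightarrow> real \<Rightarrow> real \<Rightarrow> nat \<Rightarrow> real \<Rightarrow> real" where
  "S_fun l m n d u =
     Gamma (m + n - real d / 2) / ((4 * pi) powr (real d / 2) * Gamma (m + n))
     * (1 + 4 * u) powr l
     * hyp3F2 (m + n - real d / 2) m n ((m + n) / 2) ((m + n + 1) / 2) (- u)"

definition K_upper :: "real \<Rightarrow> real \<Rightarrow> real \<Rightarrow> nat \<Rightarrow> real" where
  "K_upper l m n d = sqrt (SUP u\<in>{0..}. S_fun l m n d u)"


section \<open>The Gaussian lower bound\<close>

definition gaussian :: "real \<Rightarrow> 'a::euclidean_space \<Rightarrow> complex" where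
  "gaussian \<sigma> x = complex_of_real (exp (- \<sigma> * (norm x)\<^sup>2 / 2))"

definition K_gauss ::
    "'a::euclidean_space itself \<Rightarrow> real \<Rightarrow> real \<Rightarrow> real \<Rightarrow> real \<Rightarrow> real \<Rightarrow> real" where
  "K_gauss (d :: 'a itself) l m n \<sigma> \<tau> =
     sobolev_norm l (gaussian (\<sigma> + \<tau>) :: 'a \<Rightarrow> complex) /
     (sobolev_norm m (gaussian \<sigma> :: 'a \<Rightarrow> complex) * sobolev_norm n (gaussian \<tau> :: 'a \<Rightarrow> complex))"

definition Delta22 :: "(real \<times> real) set" where
  "Delta22 = {(\<xi>, \<eta>). (\<xi>, \<eta>) \<in> {0<..<1/2} \<times> {0<..<1/2} \<and> \<xi> + \<eta> < 1}"

definition D22 :: "real \<Rightarrow> real \<Rightarrow> real" where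
  "D22 \<xi> \<eta> = (1 - \<xi> - \<eta>) * (\<xi> + \<eta>) / (\<xi> * \<eta> * (1 - 2 * \<xi>) * (1 - 2 * \<eta>))"


section \<open>The asymptotic form shared by all bounds\<close>

definition asymp_form :: "nat \<Rightarrow> (real \<Rightarrow> real) \<Rightarrow> bool" where
  "asymp_form d K \<longleftrightarrow> (\<exists>\<epsilon> \<in> O[at_top](\<lambda>l. 1 / l).
     \<forall>\<^sub>F l in at_top. K l = (1 + \<epsilon> l) / (16 * pi * l) powr (real d / 4))"

end

theory Submission
  imports Defs "HOL-Probability.Probability" "HOL-Real_Asymp.Real_Asymp"
begin

text \<open>
  All three quantities equal \<open>(16 \<pi> l) powr (- d / 4)\<close> up to a factor of the form
  \<open>1 + O(1 / l)\<close>. Such factors are closed under products, powers and squeezing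
  (\<open>near_one\<close>), so that each of the three claims becomes a pair of bounds of this form.
  Ratios of Gamma functions enter through \<open>near_one_Gamma_ratio\<close>.

  The hypergeometric bound. The continued hypergeometric function is the mean of
  \<open>(1 + u t) powr (- a)\<close> for \<open>t = 4 s (1 - s)\<close> and a Beta distributed
  \<open>s\<close> (\<open>hyp3F2_eq_integral\<close>). At \<open>u = 0\<close> the mean is one, which
  bounds the supremum from below. From above the supremum over \<open>u\<close> is taken inside the
  mean by the weighted inequality of the means (\<open>weighted_am_gm_powr\<close>); what remains
  concentrates at \<open>s = 1 / 2\<close> and is dominated by
  \<open>(1 + v\<^sup>2) powr (- M)\<close> with \<open>v = 2 s - 1\<close> and \<open>M\<close> close
  to \<open>2 l\<close>, whose integral is a multiple of a ratio of Gamma functions.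

  The Gaussian bound. The Sobolev norms of Gaussians are integrals of
  \<open>(1 + |q|\<^sup>2 / (2 L)) powr L\<close> against \<open>exp (- |q|\<^sup>2)\<close>. The
  first factor lies between \<open>exp y\<close> and \<open>exp (y - y\<^sup>2 / L)\<close> with
  \<open>y = |q|\<^sup>2 / 2\<close>, which gives the rate (\<open>near_one_gaussian_moment\<close>).

  The sharp constant. It is at least the Gaussian quotient, as the product of two Gaussians is a
  Gaussian. For an upper bound, let \<open>F\<close> and \<open>G\<close> be the Fourier transforms of
  \<open>f\<close> and \<open>g\<close>. The transform of \<open>f g\<close> is a multiple of the
  convolution of \<open>F\<close> and \<open>G\<close>, and by the Cauchy-Schwarz inequality the
  square of the constant is at most \<open>(2 \<pi>) powr (- d)\<close> times the supremum over
  \<open>p\<close> of the integral over \<open>q\<close> of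

    \<open>(1 + |p|\<^sup>2) powr l / ((1 + |p - q|\<^sup>2) (1 + |q|\<^sup>2)) powr (2 l)\<close>.

  The parallelogram law yields \<open>(1 + |p|\<^sup>2) (1 + |p - 2 q|\<^sup>2) \<le> ((1 + |p -
  q|\<^sup>2) (1 + |q|\<^sup>2))\<^sup>2\<close> (\<open>weight_product_inequality\<close>), so that
  the integrand is at most \<open>(1 + |p - 2 q|\<^sup>2) powr (- l)\<close>. Its integral does not
  depend on \<open>p\<close> and is a multiple of a ratio of Gamma functions with the required
  asymptotics (\<open>sobolev_product\<close>).

  The passage between distributions and functions rests on Gaussians throughout. They are Schwartz
  functions with an explicit Fourier transform, convolution with the heat kernel tends to the
  identity, and a function that integrates to zero against all translated Gaussians vanishes almost
  everywhere. This yields the uniqueness of representing functions and the two instances of Fourier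
  inversion that connect \<open>f\<close> with \<open>F\<close> and the product with the convolution.
\<close>

section \<open>Relative errors of order 1/x\<close>

definition near_one :: "(real \<Rightarrow> real) \<Rightarrow> bool" where
  "near_one f \<longleftrightarrow> (\<lambda>x. f x - 1) \<in> O[at_top](\<lambda>x. 1 / x)"

lemma near_one_iff:
  "near_one f \<longleftrightarrow> (\<exists>C. \<forall>\<^sub>F x in at_top. \<bar>f x - 1\<bar> \<le> C / x)"
proof
  assume "near_one f"
  then obtain C where "\<forall>\<^sub>F x in at_top. norm (f x - 1) \<le> C * norm (1 / x)"
    unfolding near_one_def by (elim landau_o.bigE)
  then have "\<forall>\<^sub>F x in at_top. \<bar>f x - 1\<bar> \<le> C / x"
    using eventually_gt_at_top[of 0] by eventually_elim simp
  then show "\<exists>C. \<forall>\<^sub>F x in at_top. \<bar>f x - 1\<bar> \<le> C / x" ..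
next
  assume "\<exists>C. \<forall>\<^sub>F x in at_top. \<bar>f x - 1\<bar> \<le> C / x"
  then obtain C where "\<forall>\<^sub>F x in at_top. \<bar>f x - 1\<bar> \<le> C / x" ..
  then have "\<forall>\<^sub>F x in at_top. norm (f x - 1) \<le> C * norm (1 / x)"
    using eventually_gt_at_top[of 0] by eventually_elim simp
  then show "near_one f" unfolding near_one_def by (rule bigoI)
qed

lemma near_one_cong:
  assumes "\<forall>\<^sub>F x in at_top. f x = g x" "near_one g"
  shows "near_one f"
proof -
  have "\<forall>\<^sub>F x in at_top. f x - 1 = g x - 1"
    using assms(1) by eventually_elim simp
  from landau_o.big.in_cong[OF this] show ?thesis
    using assms(2) by (simp add: near_one_def)
qed

lemma near_one_tendsto:
  assumes "near_one f" shows "(f \<longlongrightarrow> 1) at_top"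
proof -
  obtain C where C: "\<forall>\<^sub>F x in at_top. \<bar>f x - 1\<bar> \<le> C / x"
    using assms near_one_iff by blast
  have "((\<lambda>x. C / x) \<longlongrightarrow> 0) at_top" by real_asymp
  then have "((\<lambda>x. f x - 1) \<longlongrightarrow> 0) at_top"
    by (rule Lim_null_comparison[rotated]) (use C in simp)
  then show ?thesis using Lim_null by blast
qed

lemma near_one_eventually_pos:
  assumes "near_one f" shows "\<forall>\<^sub>F x in at_top. f x > 0"
  using order_tendstoD(1)[OF near_one_tendsto[OF assms], of 0] by simp

lemma near_one_mult:
  assumes "near_one f" "near_one g" shows "near_one (\<lambda>x. f x * g x)"
proof -
  have "f \<in> O[at_top](\<lambda>_. 1)"
    using near_one_tendsto[OF assms(1)] by (intro bigoI_tendsto[where c = 1]) auto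
  then have "(\<lambda>x. f x * (g x - 1)) \<in> O[at_top](\<lambda>x. 1 * (1 / x))"
    using assms(2) by (intro landau_o.big.mult) (auto simp: near_one_def)
  then have "(\<lambda>x. f x * (g x - 1)) \<in> O[at_top](\<lambda>x. 1 / x)" by simp
  then have "(\<lambda>x. f x * (g x - 1) + (f x - 1)) \<in> O[at_top](\<lambda>x. 1 / x)"
    by (rule sum_in_bigo) (use assms(1) in \<open>simp add: near_one_def\<close>)
  moreover have "f x * (g x - 1) + (f x - 1) = f x * g x - 1" for x
    by (simp add: algebra_simps)
  ultimately show ?thesis unfolding near_one_def by simp
qed

text \<open>
  Any function that is differentiable at one and fixes one distorts the relative error by at most a
  bounded factor. Powers and inverses are special cases.
\<close>
lemma near_one_comp:
  assumes "near_one f" "(\<phi> has_real_derivative D) (at 1)" "\<phi> 1 = 1"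
  shows "near_one (\<lambda>x. \<phi> (f x))"
proof -
  have "((\<lambda>y. (\<phi> y - \<phi> 1) / (y - 1)) \<longlongrightarrow> D) (at 1)"
    using assms(2) by (simp add: has_field_derivative_iff)
  then have "((\<lambda>y. norm ((\<phi> y - 1) / (y - 1))) \<longlongrightarrow> norm D) (at 1)"
    using assms(3) by (intro tendsto_norm) simp
  then have "\<forall>\<^sub>F y in at 1. norm ((\<phi> y - 1) / (y - 1)) < norm D + 1"
    by (rule order_tendstoD) simp
  then have "\<forall>\<^sub>F y in at 1. \<bar>\<phi> y - 1\<bar> \<le> (\<bar>D\<bar> + 1) * \<bar>y - 1\<bar>"
    by (rule eventually_mono) (auto simp: assms(3) field_simps divide_less_eq split: if_splits)
  then have ev: "\<forall>\<^sub>F y in nhds 1. \<bar>\<phi> y - 1\<bar> \<le> (\<bar>D\<bar> + 1) * \<bar>y - 1\<bar>"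
    unfolding eventually_nhds_conv_at by (simp add: assms(3))
  obtain C where C: "\<forall>\<^sub>F x in at_top. \<bar>f x - 1\<bar> \<le> C / x"
    using assms near_one_iff by blast
  have "\<forall>\<^sub>F x in at_top. \<bar>\<phi> (f x) - 1\<bar> \<le> (\<bar>D\<bar> + 1) * \<bar>f x - 1\<bar>"
    by (rule eventually_compose_filterlim[OF ev near_one_tendsto[OF assms(1)]])
  then have "\<forall>\<^sub>F x in at_top. \<bar>\<phi> (f x) - 1\<bar> \<le> ((\<bar>D\<bar> + 1) * C) / x"
    using C
  proof eventually_elim
    case (elim x)
    have "(\<bar>D\<bar> + 1) * \<bar>f x - 1\<bar> \<le> (\<bar>D\<bar> + 1) * (C / x)"
      using elim by (intro mult_left_mono) auto
    then show ?case using elim by simp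
  qed
  then show ?thesis using near_one_iff by blast
qed

lemma near_one_powr:
  assumes "near_one f" shows "near_one (\<lambda>x. f x powr p)"
proof (rule near_one_comp[OF assms])
  show "((\<lambda>y. y powr p) has_real_derivative p) (at 1)"
    by (auto intro!: derivative_eq_intros)
qed simp

lemma near_one_inverse:
  assumes "near_one f" shows "near_one (\<lambda>x. inverse (f x))"
  by (rule near_one_comp[OF assms, of _ "-1"]) (auto intro!: derivative_eq_intros)

lemma near_one_divide:
  assumes "near_one f" "near_one g" shows "near_one (\<lambda>x. f x / g x)"
  using near_one_mult[OF assms(1) near_one_inverse[OF assms(2)]] by (simp add: divide_inverse)

lemma near_one_squeeze:
  assumes "near_one f" "near_one h"
    and "\<forall>\<^sub>F x in at_top. f x \<le> g x" "\<forall>\<^sub>F x in at_top. g x \<le> h x"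
  shows "near_one g"
proof -
  obtain C D where C: "\<forall>\<^sub>F x in at_top. \<bar>f x - 1\<bar> \<le> C / x"
    and D: "\<forall>\<^sub>F x in at_top. \<bar>h x - 1\<bar> \<le> D / x"
    using assms(1,2) unfolding near_one_iff by blast
  have "\<forall>\<^sub>F x in at_top. \<bar>g x - 1\<bar> \<le> max C D / x"
    using C D assms(3,4) eventually_gt_at_top[of 0]
  proof eventually_elim
    case (elim x)
    have "C / x \<le> max C D / x" "D / x \<le> max C D / x"
      using elim by (auto intro!: divide_right_mono)
    then show ?case using elim by linarith
  qed
  then show ?thesis using near_one_iff by blast
qed

lemma near_one_affine:
  assumes "near_one f" "c > 0"
  shows "near_one (\<lambda>x. f (c * x + b))"
proof -
  have lim: "filterlim (\<lambda>x. c * x + b) at_top at_top"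
    using assms(2) by real_asymp
  have "(\<lambda>x. f (c * x + b) - 1) \<in> O[at_top](\<lambda>x. 1 / (c * x + b))"
    using landau_o.big.compose[OF assms(1)[unfolded near_one_def] lim] .
  also have "(\<lambda>x. 1 / (c * x + b)) \<in> O[at_top](\<lambda>x. 1 / x)"
    using assms(2) by real_asymp
  finally show ?thesis by (simp add: near_one_def)
qed

lemma near_one_ratio: "near_one (\<lambda>x. (x + a) / (x + b))"
proof -
  have "(\<lambda>x::real. (x + a) / (x + b) - 1) \<in> O[at_top](\<lambda>x. 1 / x)"
    by real_asymp
  then show ?thesis by (simp add: near_one_def)
qed

lemma asymp_form_iff_near_one:
  "asymp_form d K \<longleftrightarrow> near_one (\<lambda>l. K l * (16 * pi * l) powr (real d / 4))"
proof
  assume "asymp_form d K"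
  then obtain \<epsilon> where e: "\<epsilon> \<in> O[at_top](\<lambda>l. 1 / l)"
      and K: "\<forall>\<^sub>F l in at_top. K l = (1 + \<epsilon> l) / (16 * pi * l) powr (real d / 4)"
    unfolding asymp_form_def by blast
  have "near_one (\<lambda>l. 1 + \<epsilon> l)" using e by (simp add: near_one_def)
  moreover have "\<forall>\<^sub>F l in at_top. K l * (16 * pi * l) powr (real d / 4) = 1 + \<epsilon> l"
    using K eventually_gt_at_top[of 0] by eventually_elim simp
  ultimately show "near_one (\<lambda>l. K l * (16 * pi * l) powr (real d / 4))"
    by (rule near_one_cong[rotated])
next
  assume *: "near_one (\<lambda>l. K l * (16 * pi * l) powr (real d / 4))"
  define \<epsilon> where "\<epsilon> l = K l * (16 * pi * l) powr (real d / 4) - 1" for l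
  have "\<forall>\<^sub>F l in at_top. K l = (1 + \<epsilon> l) / (16 * pi * l) powr (real d / 4)"
    using eventually_gt_at_top[of 0] by eventually_elim (simp add: \<epsilon>_def)
  moreover have "\<epsilon> \<in> O[at_top](\<lambda>l. 1 / l)"
    using * by (simp add: near_one_def \<epsilon>_def[abs_def])
  ultimately show "asymp_form d K" unfolding asymp_form_def by blast
qed

section \<open>Ratios of Gamma functions\<close>

text \<open>
  Both bounds express the convexity of \<open>ln \<circ> Gamma\<close>: the first on the interval from
  \<open>x\<close> to \<open>x + 1\<close>, the second on the interval from \<open>x + a\<close> to
  \<open>x + a + 1\<close>, which contains \<open>x + 1\<close>.
\<close>
lemma Gamma_shift_bounds:
  fixes x a :: real
  assumes "x > 0" "0 \<le> a" "a \<le> 1"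
  shows "Gamma (x + a) \<le> Gamma x * x powr a"
    and "x * Gamma x * (x + a) powr (a - 1) \<le> Gamma (x + a)"
proof -
  have *: "Gamma (y + b) \<le> Gamma y * y powr b" if "y > 0" "0 \<le> b" "b \<le> 1" for y b :: real
  proof -
    have "(ln \<circ> Gamma) ((1 - b) *\<^sub>R y + b *\<^sub>R (y + 1))
        \<le> (1 - b) * (ln \<circ> Gamma) y + b * (ln \<circ> Gamma) (y + 1)"
      using convex_onD[OF log_convex_Gamma_real, of b y "y + 1"] that by simp
    also have "(1 - b) *\<^sub>R y + b *\<^sub>R (y + 1) = y + b" by (simp add: algebra_simps)
    finally have "ln (Gamma (y + b)) \<le> (1 - b) * ln (Gamma y) + b * ln (y * Gamma y)"
      using that by (simp add: Gamma_plus1 nonpos_Ints_def)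
    also have "\<dots> = ln (Gamma y * y powr b)"
      using that Gamma_real_pos[of y] by (simp add: ln_mult ln_powr algebra_simps)
    finally show ?thesis
      using that Gamma_real_pos[of y] Gamma_real_pos[of "y + b"] by simp
  qed
  show "Gamma (x + a) \<le> Gamma x * x powr a"
    using * assms by blast
  have "Gamma (x + 1) \<le> Gamma (x + a) * (x + a) powr (1 - a)"
    using *[of "x + a" "1 - a"] assms by (simp add: algebra_simps)
  then have "x * Gamma x * (x + a) powr (a - 1) \<le> (Gamma (x + a) * (x + a) powr (1 - a)) * (x + a) powr (a - 1)"
    using assms by (intro mult_right_mono) (auto simp: Gamma_plus1 nonpos_Ints_def)
  also have "\<dots> = Gamma (x + a)"
    using assms by (simp add: mult.assoc flip: powr_add)
  finally show "x * Gamma x * (x + a) powr (a - 1) \<le> Gamma (x + a)" .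
qed

text \<open>
  Convexity settles shifts in the unit interval. The functional equation adds the factor
  \<open>(x + a) / x\<close>, itself of the form \<open>1 + O(1 / x)\<close>, when \<open>a\<close>
  grows by one, so that all shifts differing by an integer are equivalent.
\<close>
lemma near_one_Gamma_shift: "near_one (\<lambda>x. Gamma (x + a) / (Gamma x * x powr a))"
proof -
  define P where "P a \<longleftrightarrow> near_one (\<lambda>x. Gamma (x + a) / (Gamma x * x powr a))" for a :: real
  have base: "P a" if "0 \<le> a" "a \<le> 1" for a
    unfolding P_def
  proof (rule near_one_squeeze)
    show "near_one (\<lambda>x. ((x + a) / (x + 0)) powr (a - 1))"
      by (rule near_one_powr[OF near_one_ratio])
    show "near_one (\<lambda>x. 1)" by (simp add: near_one_def)
    show "\<forall>\<^sub>F x in at_top. ((x + a) / (x + 0)) powr (a - 1) \<le> Gamma (x + a) / (Gamma x * x powr a)"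
      using eventually_gt_at_top[of 0]
    proof eventually_elim
      case (elim x)
      have "x powr a = x * x powr (a - 1)"
        using elim by (simp add: powr_diff)
      then show ?case
        using Gamma_shift_bounds(2)[OF elim that] elim that Gamma_real_pos[OF elim]
        by (simp add: powr_divide field_simps)
    qed
    show "\<forall>\<^sub>F x in at_top. Gamma (x + a) / (Gamma x * x powr a) \<le> 1"
      using eventually_gt_at_top[of 0]
    proof eventually_elim
      case (elim x)
      then show ?case
        using Gamma_shift_bounds(1)[OF elim that] Gamma_real_pos[OF elim] by simp
    qed
  qed
  have step: "Gamma (x + (a + 1)) / (Gamma x * x powr (a + 1)) =
      Gamma (x + a) / (Gamma x * x powr a) * ((x + a) / (x + 0))" if "x > 0" "x > - a" for x a :: real
  proof -
    have "Gamma (x + (a + 1)) = (x + a) * Gamma (x + a)"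
      using that Gamma_plus1[of "x + a"] by (auto simp: add_ac nonpos_Ints_def)
    then show ?thesis using that by (simp add: powr_add mult_ac)
  qed
  have up: "P (a + 1)" if "P a" for a
    unfolding P_def
  proof (rule near_one_cong[OF _ near_one_mult[OF that[unfolded P_def] near_one_ratio]])
    show "\<forall>\<^sub>F x in at_top. Gamma (x + (a + 1)) / (Gamma x * x powr (a + 1)) =
      Gamma (x + a) / (Gamma x * x powr a) * ((x + a) / (x + 0))"
      using eventually_gt_at_top[of 0] eventually_gt_at_top[of "- a"]
      by eventually_elim (rule step)
  qed
  have down: "P a" if "P (a + 1)" for a
    unfolding P_def
  proof (rule near_one_cong[OF _ near_one_divide[OF that[unfolded P_def] near_one_ratio]])
    show "\<forall>\<^sub>F x in at_top. Gamma (x + a) / (Gamma x * x powr a) =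
      Gamma (x + (a + 1)) / (Gamma x * x powr (a + 1)) / ((x + a) / (x + 0))"
      using eventually_gt_at_top[of 0] eventually_gt_at_top[of "- a"]
      by eventually_elim (subst step; simp)
  qed
  have "P (frac a + of_int k)" for k :: int
  proof (induction k rule: int_induct[where k = 0])
    case base
    show ?case using \<open>\<And>a. 0 \<le> a \<Longrightarrow> a \<le> 1 \<Longrightarrow> P a\<close>[of "frac a"] frac_lt_1[of a] by simp
  next
    case (step1 i)
    then show ?case using up[of "frac a + of_int i"] by (simp add: add_ac)
  next
    case (step2 i)
    then show ?case using down[of "frac a + of_int (i - 1)"] by (simp add: add_ac)
  qed
  from this[of "\<lfloor>a\<rfloor>"] show ?thesis by (simp add: P_def frac_def)
qed

lemma near_one_Gamma_ratio:
  "near_one (\<lambda>x. Gamma (x + a) / Gamma (x + b) * x powr (b - a))"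
proof (rule near_one_cong[OF _ near_one_divide[OF near_one_Gamma_shift near_one_Gamma_shift]])
  show "\<forall>\<^sub>F x in at_top. Gamma (x + a) / Gamma (x + b) * x powr (b - a) =
    Gamma (x + a) / (Gamma x * x powr a) / (Gamma (x + b) / (Gamma x * x powr b))"
    using eventually_gt_at_top[of 0]
  proof eventually_elim
    case (elim x)
    have "Gamma x \<noteq> 0" using elim Gamma_real_pos[of x] by (metis less_irrefl)
    then show ?case using elim by (simp add: powr_diff)
  qed
qed


section \<open>The hypergeometric function as an Euler integral\<close>

lemma has_fps_expansion_sumsI:
  fixes g :: "real \<Rightarrow> real"
  assumes "\<delta> > 0" and sums: "\<And>h. \<bar>h\<bar> < \<delta> \<Longrightarrow> (\<lambda>j. c j * h ^ j) sums g h"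
  shows "g has_fps_expansion Abs_fps c"
  unfolding has_fps_expansion_def
proof
  have "summable (\<lambda>j. c j * (\<delta> / 2) ^ j)"
    using sums[of "\<delta> / 2"] \<open>\<delta> > 0\<close> by (simp add: sums_iff)
  from conv_radius_geI[OF this] have "ereal (\<delta> / 2) \<le> fps_conv_radius (Abs_fps c)"
    using \<open>\<delta> > 0\<close> by (simp add: fps_conv_radius_def)
  then show "0 < fps_conv_radius (Abs_fps c)"
    using \<open>\<delta> > 0\<close> by (metis ereal_less(2) half_gt_zero less_le_trans)
  have "\<forall>\<^sub>F h in nhds 0. h \<in> ball 0 \<delta>"
    using \<open>\<delta> > 0\<close> by (intro eventually_nhds_in_open) auto
  then show "\<forall>\<^sub>F h in nhds 0. eval_fps (Abs_fps c) h = g h"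
    by eventually_elim (use sums in \<open>simp add: eval_fps_def sums_iff dist_real_def\<close>)
qed

text \<open>
  After division by the lowest power of the variable that occurs in the expansion, the function is
  continuous at zero with a nonzero value.
\<close>
lemma has_fps_expansion_isolated_zero:
  fixes f :: "real \<Rightarrow> real"
  assumes "f has_fps_expansion F" "F \<noteq> 0"
  shows "\<forall>\<^sub>F h in at 0. f h \<noteq> 0"
proof -
  define n where "n = subdegree F"
  define g where "g x = (if x = 0 then fps_nth F n else f x / x ^ n)" for x
  have "g has_fps_expansion fps_shift n F"
    unfolding g_def by (rule has_fps_expansion_shift) (use assms in \<open>auto simp: n_def\<close>)
  from has_fps_expansion_imp_continuous[OF this, where A = UNIV] have "g \<midarrow>0\<rightarrow> g 0"
    by (simp add: isCont_def)
  moreover have "g 0 \<noteq> 0" using assms by (simp add: g_def n_def)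
  ultimately have "\<forall>\<^sub>F h in at 0. g h \<noteq> 0"
    by (rule tendsto_imp_eventually_ne)
  then show ?thesis
    using eventually_neq_at_within[of 0] by eventually_elim (auto simp: g_def)
qed

text \<open>
  Near each point of \<open>S\<close> the difference either vanishes identically or has no other zero.
  The two alternatives split the connected set \<open>S\<close> into disjoint open subsets, and the
  first occurs on \<open>T\<close>.
\<close>
lemma real_analytic_identity:
  fixes f g :: "real \<Rightarrow> real"
  assumes f: "real_analytic_on f S" and g: "real_analytic_on g S"
    and S: "open S" "connected S" and T: "open T" "T \<subseteq> S" "T \<noteq> {}"
    and eq: "\<And>x. x \<in> T \<Longrightarrow> f x = g x" and "w \<in> S"
  shows "f w = g w"
proof -
  define d where "d x = f x - g x" for x
  define Z where "Z = {x \<in> S. \<forall>\<^sub>F y in nhds x. d y = 0}"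
  define W where "W = {x \<in> S. \<forall>\<^sub>F y in at x. d y \<noteq> 0}"
  have shift: "(\<forall>\<^sub>F h in nhds 0. P (x + h)) \<longleftrightarrow> (\<forall>\<^sub>F y in nhds x. P y)"
    "(\<forall>\<^sub>F h in at 0. P (x + h)) \<longleftrightarrow> (\<forall>\<^sub>F y in at x. P y)" for P and x :: real
    using arg_cong[OF filtermap_nhds_shift[of "- x" 0], of "eventually P"]
      arg_cong[OF filtermap_at_shift[of "- x" 0], of "eventually P"]
    by (simp_all add: eventually_filtermap add.commute)
  have ZW: "Z \<union> W = S"
  proof -
    have "x \<in> Z \<or> x \<in> W" if xS: "x \<in> S" for x
    proof -
      obtain F where F: "(\<lambda>h. f (x + h)) has_fps_expansion F"
        using bspec[OF f[unfolded real_analytic_on_def] xS] ..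
      obtain G where G: "(\<lambda>h. g (x + h)) has_fps_expansion G"
        using bspec[OF g[unfolded real_analytic_on_def] xS] ..
      from has_fps_expansion_diff[OF F G]
      have *: "(\<lambda>h. d (x + h)) has_fps_expansion F - G" by (simp add: d_def)
      show ?thesis
      proof (cases "F - G = 0")
        case True
        with * have "\<forall>\<^sub>F h in nhds 0. d (x + h) = 0"
          by (auto simp: has_fps_expansion_def elim: eventually_mono)
        then show ?thesis using that shift(1)[of "\<lambda>y. d y = 0" x] by (simp add: Z_def)
      next
        case False
        from has_fps_expansion_isolated_zero[OF * this] show ?thesis
          using that shift(2)[of "\<lambda>y. d y \<noteq> 0" x] by (simp add: W_def)
      qed
    qed
    then show ?thesis by (auto simp: Z_def W_def)
  qed
  have "open Z"
  proof -
    have "Z = S \<inter> interior {y. d y = 0}"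
      by (auto simp: Z_def interior_def eventually_nhds)
    then show ?thesis using S by (simp add: open_Int)
  qed
  moreover have "open W"
  proof (subst open_subopen, safe)
    fix x assume "x \<in> W"
    then have "\<forall>\<^sub>F y in at x. d y \<noteq> 0" "x \<in> S" by (auto simp: W_def)
    then obtain U where U: "open U" "x \<in> U" "\<And>y. y \<in> U \<Longrightarrow> y \<noteq> x \<Longrightarrow> d y \<noteq> 0"
      unfolding eventually_at_topological by blast
    have "U \<inter> S \<subseteq> W"
    proof
      fix y assume y: "y \<in> U \<inter> S"
      show "y \<in> W"
      proof (cases "y = x")
        case False
        have "\<forall>\<^sub>F z in nhds y. z \<in> U - {x}"
          using y False U by (intro eventually_nhds_in_open open_Diff) auto
        then have "\<forall>\<^sub>F z in nhds y. d z \<noteq> 0"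
          by eventually_elim (use U in auto)
        then show ?thesis using y by (auto simp: W_def eventually_at_filter elim: eventually_mono)
      qed (use \<open>x \<in> W\<close> in simp)
    qed
    then show "\<exists>T. open T \<and> x \<in> T \<and> T \<subseteq> W"
      using U \<open>x \<in> S\<close> S by (intro exI[of _ "U \<inter> S"]) auto
  qed
  moreover have "Z \<inter> W = {}"
  proof -
    have False if "\<forall>\<^sub>F y in nhds x. d y = 0" "\<forall>\<^sub>F y in at x. d y \<noteq> 0" for x
    proof -
      have "\<forall>\<^sub>F y in at x. d y = 0"
        using that(1) by (simp add: eventually_at_filter eventually_mono)
      with that(2) have "\<forall>\<^sub>F y in at x. False" by eventually_elim auto
      then show False by simp
    qed
    then show ?thesis by (auto simp: Z_def W_def)
  qed
  moreover have "T \<subseteq> Z"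
    using T eq by (auto simp: Z_def d_def eventually_nhds intro!: exI[of _ T])
  ultimately have "S \<subseteq> Z"
    using connectedD[OF S(2), of Z W] ZW T by blast
  then have "\<forall>\<^sub>F y in nhds w. d y = 0" using \<open>w \<in> S\<close> by (auto simp: Z_def)
  then have "d w = 0" by (rule eventually_nhds_x_imp_x)
  then show ?thesis by (simp add: d_def)
qed

text \<open>
  The definite description of \<open>hyp3F2\<close> is evaluated by exhibiting one continuation; the
  identity theorem makes it the only one.
\<close>
lemma hyp3F2_eqI:
  assumes "real_analytic_on g {..<1}"
    and "\<And>x. x \<in> {-1<..<1} \<Longrightarrow> g x = eval_fps (fps_hypergeo [a1, a2, a3] [b1, b2] 1) x"
    and "w < 1"
  shows "hyp3F2 a1 a2 a3 b1 b2 w = g w"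
  unfolding hyp3F2_def
proof (rule the_equality)
  show "\<exists>g'. real_analytic_on g' {..<1} \<and>
    (\<forall>x\<in>{-1<..<1}. g' x = eval_fps (fps_hypergeo [a1, a2, a3] [b1, b2] 1) x) \<and> g' w = g w"
    using assms by blast
next
  fix v assume "\<exists>g'. real_analytic_on g' {..<1} \<and>
    (\<forall>x\<in>{-1<..<1}. g' x = eval_fps (fps_hypergeo [a1, a2, a3] [b1, b2] 1) x) \<and> g' w = v"
  then obtain g' where g': "real_analytic_on g' {..<1}" "g' w = v"
    "\<And>x. x \<in> {-1<..<1} \<Longrightarrow> g' x = eval_fps (fps_hypergeo [a1, a2, a3] [b1, b2] 1) x" by blast
  have "g' w = g w"
    by (rule real_analytic_identity[OF g'(1) assms(1), of "{-1<..<1}"])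
       (use assms g' in auto)
  with g' show "v = g w" by simp
qed

text \<open>
  The closed interval may be used for all positive parameters: \<open>0 powr x\<close> is zero, so
  that the weight vanishes at both end points.
\<close>
definition beta_weight :: "real \<Rightarrow> real \<Rightarrow> real \<Rightarrow> real" where
  "beta_weight m n s = indicator {0..1} s * (s powr (m - 1) * (1 - s) powr (n - 1))"

lemma beta_weight_nonneg: "0 \<le> beta_weight m n s"
  by (simp add: beta_weight_def indicator_def)

lemma beta_weight_measurable [measurable]: "beta_weight m n \<in> borel_measurable borel"
  unfolding beta_weight_def by measurable

lemma
  assumes "m > 0" "n > 0"
  shows integrable_beta_weight: "integrable lborel (beta_weight m n)"
    and integral_beta_weight: "(LINT s|lborel. beta_weight m n s) = Beta m n"
proof -
  have *: "set_integrable lborel {0..1} (\<lambda>t. t powr (m - 1) * (1 - t) powr (n - 1))"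
    using assms by (rule integrable_Beta)
  then show "integrable lborel (beta_weight m n)"
    by (simp add: set_integrable_def beta_weight_def[abs_def])
  have "(LINT s|lborel. beta_weight m n s) = (LINT s:{0..1}|lborel. s powr (m - 1) * (1 - s) powr (n - 1))"
    by (simp add: set_lebesgue_integral_def beta_weight_def)
  also have "\<dots> = Beta m n"
    using set_borel_integral_eq_integral(2)[OF *] has_integral_Beta_real[OF assms]
    by (simp add: has_integral_iff)
  finally show "(LINT s|lborel. beta_weight m n s) = Beta m n" .
qed

lemma integrable_beta_weight_mult:
  assumes "m > 0" "n > 0" and [measurable]: "f \<in> borel_measurable borel"
    and "\<And>s. s \<in> {0..1} \<Longrightarrow> \<bar>f s\<bar> \<le> C"
  shows "integrable lborel (\<lambda>s. beta_weight m n s * f s)"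
proof (rule Bochner_Integration.integrable_bound)
  show "integrable lborel (\<lambda>s. C * beta_weight m n s)"
    using assms by (intro integrable_mult_right integrable_beta_weight)
  show "AE s in lborel. norm (beta_weight m n s * f s) \<le> norm (C * beta_weight m n s)"
  proof (rule AE_I2)
    fix s
    have "beta_weight m n s * \<bar>f s\<bar> \<le> beta_weight m n s * C" if "s \<in> {0..1}"
      using that assms by (intro mult_left_mono beta_weight_nonneg)
    moreover have "0 \<le> C" if "s \<in> {0..1}" using assms(4)[OF that] by linarith
    moreover have "beta_weight m n s = 0" if "s \<notin> {0..1}" using that by (simp add: beta_weight_def)
    ultimately show "norm (beta_weight m n s * f s) \<le> norm (C * beta_weight m n s)"
      using beta_weight_nonneg[of m n s] by (cases "s \<in> {0..1}") (auto simp: abs_mult mult.commute)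
  qed
qed simp

text \<open>
  The Euler integral is not normalised; its value at \<open>w = 0\<close> is \<open>Beta m n\<close>.
\<close>
definition hyp_integral :: "real \<Rightarrow> real \<Rightarrow> real \<Rightarrow> real \<Rightarrow> real" where
  "hyp_integral a m n w =
     (LINT s|lborel. beta_weight m n s * (1 - w * (4 * s * (1 - s))) powr (- a))"

lemma four_s_one_minus_s:
  fixes s :: real
  assumes "s \<in> {0..1}"
  shows "0 \<le> 4 * s * (1 - s)" "4 * s * (1 - s) \<le> 1"
  using assms zero_le_power2[of "2 * s - 1"]
  by (auto simp: power2_eq_square algebra_simps intro!: mult_nonneg_nonneg mult_left_le)

text \<open>
  The binomial series of \<open>(1 - w t - h t) powr (- a)\<close> in powers of \<open>h\<close> is
  integrated term by term. The expansion around an arbitrary point \<open>w\<close> shows that the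
  integral is real analytic, and the case \<open>w = 0\<close> identifies it with the hypergeometric
  series.
\<close>
lemma hyp_integral_sums:
  fixes a :: real
  assumes "m > 0" "n > 0" "w < 1" "\<bar>h\<bar> < min 1 (1 - w)"
  shows "(\<lambda>j. ((- a) gchoose j) * (- 1) ^ j *
      (LINT s|lborel. beta_weight m n s * ((1 - w * (4 * s * (1 - s))) powr (- a - j) * (4 * s * (1 - s)) ^ j))
      * h ^ j) sums hyp_integral a m n (w + h)"
proof -
  \<comment> \<open>\<open>\<delta>\<close> is the minimum of \<open>1 - w t\<close> over
    \<open>t \<in> {0..1}\<close>; thus \<open>|h t| < 1 - w t\<close> uniformly in
    \<open>t\<close>\<close>
  define \<delta> where "\<delta> = min 1 (1 - w)"
  define t where "t s = 4 * s * (1 - s)" for s :: real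
  define C where "C = \<delta> powr (- a) + (1 + \<bar>w\<bar>) powr (- a)"
  have \<delta>: "0 < \<delta>" "\<bar>h\<bar> < \<delta>" using assms by (auto simp: \<delta>_def)
  have t: "0 \<le> t s" "t s \<le> 1" if "s \<in> {0..1}" for s
    using four_s_one_minus_s[OF that] by (auto simp: t_def)
  have [measurable]: "t \<in> borel_measurable borel" unfolding t_def by measurable
  have x: "\<delta> \<le> 1 - w * t s" "1 - w * t s \<le> 1 + \<bar>w\<bar>" if "s \<in> {0..1}" for s
  proof -
    have "w * t s \<le> max 0 w"
      using t[OF that] by (cases "w \<ge> 0") (auto simp: mult_left_le mult_nonpos_nonneg)
    then show "\<delta> \<le> 1 - w * t s" by (auto simp: \<delta>_def)
    have "\<bar>w * t s\<bar> \<le> \<bar>w\<bar> * 1"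
      unfolding abs_mult using t[OF that] by (intro mult_left_mono) auto
    then show "1 - w * t s \<le> 1 + \<bar>w\<bar>" by linarith
  qed
  have xa: "(1 - w * t s) powr (- a) \<le> C" if "s \<in> {0..1}" for s
  proof (cases "a \<ge> 0")
    case True
    have "(1 - w * t s) powr (- a) \<le> \<delta> powr (- a)"
      using x[OF that] \<delta> True by (intro powr_mono2') auto
    then show ?thesis by (simp add: C_def add_increasing2)
  next
    case False
    have "(1 - w * t s) powr (- a) \<le> (1 + \<bar>w\<bar>) powr (- a)"
      using x[OF that] \<delta> False by (intro powr_mono2) auto
    then show ?thesis by (simp add: C_def add_increasing)
  qed
  define f where "f j s = beta_weight m n s *
      (((- a) gchoose j) * (1 - w * t s) powr (- a - j) * (- h * t s) ^ j)" for j :: nat and s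
  define b where "b j = \<bar>(- a) gchoose j\<bar> * (\<bar>h\<bar> / \<delta>) ^ j" for j
  have bound: "\<bar>((- a) gchoose j) * (1 - w * t s) powr (- a - j) * (- h * t s) ^ j\<bar> \<le> C * b j"
    if "s \<in> {0..1}" for j s
  proof -
    have pos: "0 < 1 - w * t s" using x[OF that] \<delta> by simp
    have "(1 - w * t s) powr (- a - j) * \<bar>- h * t s\<bar> ^ j
        = (1 - w * t s) powr (- a) * (\<bar>h * t s\<bar> / (1 - w * t s)) ^ j"
      using pos by (simp add: powr_diff powr_realpow power_divide)
    also have "\<dots> \<le> C * (\<bar>h\<bar> / \<delta>) ^ j"
    proof (intro mult_mono power_mono frac_le)
      show "\<bar>h * t s\<bar> \<le> \<bar>h\<bar>" using t[OF that] by (simp add: abs_mult mult_left_le)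
    qed (use pos x[OF that] \<delta> xa[OF that] in \<open>auto simp: C_def intro!: divide_nonneg_pos add_nonneg_nonneg\<close>)
    finally have "\<bar>(- a) gchoose j\<bar> * ((1 - w * t s) powr (- a - j) * \<bar>- h * t s\<bar> ^ j)
        \<le> \<bar>(- a) gchoose j\<bar> * (C * (\<bar>h\<bar> / \<delta>) ^ j)"
      by (intro mult_left_mono) auto
    then show ?thesis by (simp add: abs_mult power_abs b_def mult_ac)
  qed
  have summ_b: "summable b"
  proof -
    \<comment> \<open>a radius strictly between \<open>|h| / \<delta>\<close> and \<open>1\<close>; the binomial
      series converges there, hence absolutely at \<open>|h| / \<delta>\<close>\<close>
    define r where "r = (\<bar>h\<bar> / \<delta> + 1) / 2"
    have r: "\<bar>h\<bar> / \<delta> < r" "r < 1" "0 < r" using \<delta> by (auto simp: r_def field_simps)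
    have "summable (\<lambda>j. ((- a) gchoose j) * r ^ j)"
      using gen_binomial_real[of r "- a"] r by (simp add: sums_iff)
    from powser_insidea[OF this, of "\<bar>h\<bar> / \<delta>"] show ?thesis
      using r \<delta> by (simp add: b_def[abs_def] abs_mult power_abs)
  qed
  have sb: "summable (\<lambda>j. C * b j * K)" for K
    by (rule summable_mult2[OF summable_mult[OF summ_b]])
  have f_int: "integrable lborel (f j)" for j
    unfolding f_def using assms bound by (intro integrable_beta_weight_mult) auto
  have f_bound: "norm (f j s) \<le> C * b j * beta_weight m n s" for j s
  proof (cases "s \<in> {0..1}")
    case True
    have "norm (f j s) \<le> beta_weight m n s * (C * b j)"
      unfolding f_def norm_mult[of "beta_weight m n s"] using bound[OF True, of j] beta_weight_nonneg[of m n s]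
      by (simp add: mult_left_mono)
    then show ?thesis by (simp add: mult_ac)
  qed (simp add: f_def beta_weight_def)
  have "(\<lambda>j. integral\<^sup>L lborel (f j)) sums (LINT s|lborel. (\<Sum>j. f j s))"
  proof (rule sums_integral)
    show "AE s in lborel. summable (\<lambda>j. norm (f j s))"
    proof (rule AE_I2)
      fix s show "summable (\<lambda>j. norm (f j s))"
        by (rule summable_comparison_test'[OF sb, of 0]) (use f_bound in auto)
    qed
    have "(LINT s|lborel. norm (f j s)) \<le> C * b j * Beta m n" for j
    proof -
      have "(LINT s|lborel. norm (f j s)) \<le> (LINT s|lborel. C * b j * beta_weight m n s)"
        using f_bound f_int assms by (intro integral_mono integrable_norm integrable_mult_right integrable_beta_weight)
      then show ?thesis using integral_beta_weight[OF assms(1,2)] by simp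
    qed
    then show "summable (\<lambda>j. LINT s|lborel. norm (f j s))"
      by - (rule summable_comparison_test'[OF sb, of 0], auto)
  qed (rule f_int)
  moreover have "(\<Sum>j. f j s) = beta_weight m n s * (1 - (w + h) * (4 * s * (1 - s))) powr (- a)" for s
  proof (cases "s \<in> {0..1}")
    case True
    have "\<bar>- h * t s\<bar> < 1 - w * t s"
      using \<delta> x[OF True] t[OF True] mult_left_le[of "t s" "\<bar>h\<bar>"] by (simp add: abs_mult)
    from gen_binomial_real''[OF this, of "- a"]
    have "(\<lambda>j. f j s) sums (beta_weight m n s * (1 - w * t s + - h * t s) powr (- a))"
      unfolding f_def by (rule sums_mult)
    moreover have eq: "1 - w * t s + - h * t s = 1 - (w + h) * (4 * s * (1 - s))"
      by (simp add: t_def algebra_simps)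
    ultimately show ?thesis unfolding eq by (simp add: sums_iff)
  qed (simp add: f_def beta_weight_def)
  moreover have "integral\<^sup>L lborel (f j) = ((- a) gchoose j) * (- 1) ^ j *
      (LINT s|lborel. beta_weight m n s * ((1 - w * (4 * s * (1 - s))) powr (- a - j) * (4 * s * (1 - s)) ^ j))
      * h ^ j" for j
  proof -
    have "f j s = (((- a) gchoose j) * (- 1) ^ j * h ^ j) *
        (beta_weight m n s * ((1 - w * (4 * s * (1 - s))) powr (- a - j) * (4 * s * (1 - s)) ^ j))" for s
      unfolding f_def t_def[symmetric] by (simp add: power_mult_distrib power_minus[of "h * t s"] mult_ac)
    then have "f j = (\<lambda>s. (((- a) gchoose j) * (- 1) ^ j * h ^ j) *
        (beta_weight m n s * ((1 - w * (4 * s * (1 - s))) powr (- a - j) * (4 * s * (1 - s)) ^ j)))"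
      by (rule ext)
    then show ?thesis by (simp only: integral_mult_right_zero) (simp only: mult_ac)
  qed
  ultimately show ?thesis by (simp add: hyp_integral_def)
qed

lemma integral_beta_weight_power:
  assumes "m > 0" "n > 0"
  shows "(LINT s|lborel. beta_weight m n s * (4 * s * (1 - s)) ^ j) = 4 ^ j * Beta (m + j) (n + j)"
proof -
  have "beta_weight m n s * (4 * s * (1 - s)) ^ j = 4 ^ j * beta_weight (m + j) (n + j) s" for s
  proof (cases "s \<in> {0<..<1}")
    case True
    have "s powr (m + j - 1) = s powr (m - 1) * s ^ j" "(1 - s) powr (n + j - 1) = (1 - s) powr (n - 1) * (1 - s) ^ j"
      using True by (simp_all add: powr_add[symmetric] powr_realpow[symmetric] algebra_simps)
    then show ?thesis by (simp add: beta_weight_def power_mult_distrib)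
  next
    case False
    then show ?thesis by (cases "s = 0 \<or> s = 1") (auto simp: beta_weight_def)
  qed
  then show ?thesis using assms by (simp add: integral_beta_weight)
qed

text \<open>
  The parameters \<open>(m + n) / 2\<close> and \<open>(m + n + 1) / 2\<close> of the series are those
  for which the duplication formula turns the product of their Pochhammer symbols into
  \<open>pochhammer (m + n) (2 * j) / 4 ^ j\<close>, the symbol in the moments of the Beta density.
\<close>
lemma hypergeo_coeff_Beta:
  fixes a m n :: real
  assumes "m > 0" "n > 0"
  shows "fps_nth (fps_hypergeo [a, m, n] [(m + n) / 2, (m + n + 1) / 2] 1) j * Beta m n =
    ((- a) gchoose j) * (- 1) ^ j * (4 ^ j * Beta (m + j) (n + j))"
proof -
  have np: "x \<notin> \<int>\<^sub>\<le>\<^sub>0" if "x > 0" for x :: real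
    using that by (auto simp: nonpos_Ints_def)
  have "pochhammer (2 * ((m + n) / 2)) (2 * j) =
      of_nat (2 ^ (2 * j)) * pochhammer ((m + n) / 2) j * pochhammer ((m + n) / 2 + 1 / 2) j"
    by (rule pochhammer_double)
  then have dbl: "pochhammer (m + n) (2 * j) = 4 ^ j * (pochhammer ((m + n) / 2) j * pochhammer ((m + n + 1) / 2) j)"
    by (simp add: power_mult add_divide_distrib)
  have G: "Gamma (x + real k) = pochhammer x k * Gamma x" if "x > 0" for x k
    using pochhammer_Gamma[OF np[OF that], of k] Gamma_real_pos[OF that] by simp
  have "Beta (m + j) (n + j) = Gamma (m + j) * Gamma (n + j) / Gamma (m + n + real (2 * j))"
    by (simp add: Beta_def rGamma_inverse_Gamma field_simps)
  also have "\<dots> = pochhammer m j * pochhammer n j / pochhammer (m + n) (2 * j) * Beta m n"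
    using assms by (subst (1 2 3) G) (auto simp: Beta_def rGamma_inverse_Gamma field_simps)
  finally have B: "Beta (m + j) (n + j) = pochhammer m j * pochhammer n j / pochhammer (m + n) (2 * j) * Beta m n" .
  have "((- a) gchoose j) * (- 1) ^ j = pochhammer a j / fact j"
    by (simp add: gbinomial_pochhammer field_simps flip: power_mult_distrib)
  from this show ?thesis
    unfolding B dbl \<open>((- a) gchoose j) * (- 1) ^ j = pochhammer a j / fact j\<close> by (simp add: mult_ac)
qed

theorem hyp3F2_eq_integral:
  assumes "m > 0" "n > 0" "w < 1"
  shows "hyp3F2 a m n ((m + n) / 2) ((m + n + 1) / 2) w = hyp_integral a m n w / Beta m n"
proof (rule hyp3F2_eqI[OF _ _ assms(3)])
  have B: "Beta m n > 0" using assms by (simp add: Beta_def rGamma_inverse_Gamma)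
  show "real_analytic_on (\<lambda>w. hyp_integral a m n w / Beta m n) {..<1}"
    unfolding real_analytic_on_def
  proof
    fix x :: real assume "x \<in> {..<1}"
    then have x: "x < 1" by simp
    have "(\<lambda>h. hyp_integral a m n (x + h)) has_fps_expansion Abs_fps (\<lambda>j. ((- a) gchoose j) * (- 1) ^ j *
      (LINT s|lborel. beta_weight m n s * ((1 - x * (4 * s * (1 - s))) powr (- a - real j) * (4 * s * (1 - s)) ^ j)))"
    proof (rule has_fps_expansion_sumsI)
      show "0 < min 1 (1 - x)" using x by simp
    qed (rule hyp_integral_sums[OF assms(1,2) x])
    from has_fps_expansion_cmult_left[OF this, of "1 / Beta m n"]
    show "\<exists>F. (\<lambda>h. hyp_integral a m n (x + h) / Beta m n) has_fps_expansion F" by auto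
  qed
  fix x :: real assume x: "x \<in> {-1<..<1}"
  define F where "F = fps_hypergeo [a, m, n] [(m + n) / 2, (m + n + 1) / 2] 1"
  have "(\<lambda>j. ((- a) gchoose j) * (- 1) ^ j * (4 ^ j * Beta (m + j) (n + j)) * x ^ j) sums hyp_integral a m n x"
    using hyp_integral_sums[of m n 0 x a] assms x by (auto simp: integral_beta_weight_power)
  then have "(\<lambda>j. fps_nth F j * Beta m n * x ^ j) sums hyp_integral a m n x"
    unfolding F_def hypergeo_coeff_Beta[OF assms(1,2)] .
  from sums_divide[OF this, of "Beta m n"]
  have "(\<lambda>j. fps_nth F j * x ^ j) sums (hyp_integral a m n x / Beta m n)"
    using B by (simp add: mult_ac)
  then show "hyp_integral a m n x / Beta m n = eval_fps (fps_hypergeo [a, m, n] [(m + n) / 2, (m + n + 1) / 2] 1) x"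
    by (simp add: eval_fps_def F_def sums_iff)
qed

section \<open>Gaussian integrals and Bessel weights\<close>

lemma gaussian_integral_1d:
  fixes c k :: real
  assumes "c > 0"
  shows "has_bochner_integral lborel
    (\<lambda>x. exp (- \<i> * complex_of_real (k * x)) * complex_of_real (exp (- c * x\<^sup>2 / 2)))
    (complex_of_real (sqrt (2 * pi / c) * exp (- k\<^sup>2 / (2 * c))))"
proof -
  define f where "f x = exp (- \<i> * complex_of_real (k * x)) * complex_of_real (exp (- c * x\<^sup>2 / 2))" for x :: real
  define r where "r = 1 / sqrt c"
  have r: "r > 0" "c * r\<^sup>2 = 1" using assms by (auto simp: r_def power_divide)
  have [measurable]: "f \<in> borel_measurable borel" unfolding f_def by measurable
  have fr: "f (r * y) = sqrt (2 * pi) *\<^sub>R (std_normal_density y *\<^sub>R iexp (- (k * r) * y))" for y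
  proof -
    have "c * (r * y)\<^sup>2 = y\<^sup>2" using r by (simp add: power_mult_distrib mult.assoc[symmetric])
    then show ?thesis
      by (simp add: f_def std_normal_density_def scaleR_conv_of_real mult_ac del: mult_minus_right)
  qed
  have ch: "integrable lborel (\<lambda>y. std_normal_density y *\<^sub>R iexp (- (k * r) * y))"
  proof (rule Bochner_Integration.integrable_bound[of _ std_normal_density])
    show "AE y in lborel. norm (std_normal_density y *\<^sub>R iexp (- (k * r) * y)) \<le> norm (std_normal_density y)"
      by simp
  qed auto
  have "integrable lborel (\<lambda>y. f (0 + r * y))"
    unfolding add_0 fr using ch by (rule integrable_scaleR_right)
  then have int: "integrable lborel f"
    using lborel_integrable_real_affine_iff[of r f 0] r by simp
  have "(LINT y|lborel. std_normal_density y *\<^sub>R iexp (- (k * r) * y)) = char std_normal_distribution (- (k * r))"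
    unfolding char_def by (subst integral_density) auto
  also have "\<dots> = complex_of_real (exp (- k\<^sup>2 / (2 * c)))"
    using assms by (simp add: char_std_normal_distribution r_def power_mult_distrib power_divide)
  finally have I: "(LINT y|lborel. std_normal_density y *\<^sub>R iexp (- (k * r) * y)) = complex_of_real (exp (- k\<^sup>2 / (2 * c)))" .
  have "integral\<^sup>L lborel f = \<bar>r\<bar> *\<^sub>R (LINT y|lborel. f (0 + r * y))"
    using r by (intro lborel_integral_real_affine) simp
  also have "\<dots> = complex_of_real (r * sqrt (2 * pi) * exp (- k\<^sup>2 / (2 * c)))"
    unfolding add_0 fr integral_scaleR_right I using r by (simp add: scaleR_conv_of_real)
  also have "r * sqrt (2 * pi) = sqrt (2 * pi / c)"
    by (simp add: r_def real_sqrt_divide)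
  finally show ?thesis
    using int by (simp add: has_bochner_integral_iff f_def[abs_def])
qed

lemma has_bochner_integral_lborel_prod:
  fixes f :: "'a::euclidean_space \<Rightarrow> real \<Rightarrow> complex"
  assumes "\<And>b. b \<in> Basis \<Longrightarrow> has_bochner_integral lborel (f b) (I b)"
  shows "has_bochner_integral lborel (\<lambda>x. \<Prod>b\<in>Basis. f b (x \<bullet> b)) (\<Prod>b\<in>Basis. I b)"
proof -
  interpret product_sigma_finite "\<lambda>_::'a. lborel :: real measure" ..
  have int: "integrable lborel (f b)" and I: "integral\<^sup>L lborel (f b) = I b" if "b \<in> Basis" for b
    using assms[OF that] by (auto simp: has_bochner_integral_iff)
  have [measurable]: "f b \<in> borel_measurable borel" if "b \<in> Basis" for b
    using borel_measurable_integrable[OF int[OF that]] by simp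
  have "has_bochner_integral (\<Pi>\<^sub>M b\<in>Basis. lborel) (\<lambda>x. \<Prod>b\<in>Basis. f b (x b)) (\<Prod>b\<in>Basis. I b)"
    unfolding has_bochner_integral_iff
    using product_integrable_prod[of Basis f] product_integral_prod[of Basis f] int I by simp
  then have *: "has_bochner_integral (\<Pi>\<^sub>M b\<in>Basis. lborel)
      (\<lambda>x. \<Prod>b\<in>Basis. f b ((\<Sum>c\<in>Basis. x c *\<^sub>R c) \<bullet> b)) (\<Prod>b\<in>Basis. I b)"
    by (simp add: inner_sum_left inner_Basis if_distrib cong: if_cong)
  show ?thesis
  proof (subst lborel_eq, rule has_bochner_integral_distr)
    show "has_bochner_integral (\<Pi>\<^sub>M b\<in>Basis. lborel)
      (\<lambda>x. \<Prod>b\<in>Basis. f b ((\<Sum>c\<in>Basis. x c *\<^sub>R c) \<bullet> b)) (\<Prod>b\<in>Basis. I b)"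
      by (rule *)
  qed measurable
qed

text \<open>
  The integrand is a product of one-dimensional Gaussians along the coordinate directions.
\<close>
lemma gaussian_fourier_integral:
  fixes k :: "'a::euclidean_space"
  assumes "c > 0"
  shows "has_bochner_integral lborel
    (\<lambda>x. exp (- \<i> * complex_of_real (k \<bullet> x)) * complex_of_real (exp (- c * (norm x)\<^sup>2 / 2)))
    (complex_of_real ((2 * pi / c) powr (real DIM('a) / 2) * exp (- (norm k)\<^sup>2 / (2 * c))))"
proof -
  define f where "f b x = exp (- \<i> * complex_of_real ((k \<bullet> b) * x)) * complex_of_real (exp (- c * x\<^sup>2 / 2))"
    for b :: 'a and x :: real
  define I where "I b = complex_of_real (sqrt (2 * pi / c) * exp (- (k \<bullet> b)\<^sup>2 / (2 * c)))" for b :: 'a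
  have nrm: "(norm x)\<^sup>2 = (\<Sum>b\<in>Basis. (x \<bullet> b)\<^sup>2)" for x :: 'a
    unfolding power2_norm_eq_inner by (subst euclidean_inner) (simp add: power2_eq_square)
  have "has_bochner_integral lborel (\<lambda>x. \<Prod>b\<in>Basis. f b (x \<bullet> b)) (\<Prod>b\<in>Basis. I b)"
    by (rule has_bochner_integral_lborel_prod)
       (unfold f_def I_def, rule gaussian_integral_1d[OF assms])
  moreover have "(\<Prod>b\<in>Basis. f b (x \<bullet> b)) =
      exp (- \<i> * complex_of_real (k \<bullet> x)) * complex_of_real (exp (- c * (norm x)\<^sup>2 / 2))" for x :: 'a
  proof -
    have "(\<Prod>b\<in>Basis. f b (x \<bullet> b)) = (\<Prod>b\<in>Basis. exp (- \<i> * complex_of_real ((k \<bullet> b) * (x \<bullet> b)))) *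
        complex_of_real (\<Prod>b\<in>Basis. exp (- c * (x \<bullet> b)\<^sup>2 / 2))"
      by (simp add: f_def prod.distrib)
    also have "(\<Prod>b\<in>Basis. exp (- \<i> * complex_of_real ((k \<bullet> b) * (x \<bullet> b)))) = exp (- \<i> * complex_of_real (k \<bullet> x))"
      by (subst exp_sum[symmetric], simp)
         (simp only: sum_distrib_left[symmetric] of_real_sum[symmetric], subst euclidean_inner, rule refl)
    also have "(\<Prod>b\<in>Basis. exp (- c * (x \<bullet> b)\<^sup>2 / 2)) = exp (- c * (norm x)\<^sup>2 / 2)"
      by (subst exp_sum[symmetric], simp) (simp add: nrm sum_distrib_left sum_divide_distrib sum_negf)
    finally show ?thesis .
  qed
  moreover have "(\<Prod>b\<in>Basis. I b) = complex_of_real ((2 * pi / c) powr (real DIM('a) / 2) * exp (- (norm k)\<^sup>2 / (2 * c)))"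
  proof -
    have "(\<Prod>b\<in>(Basis::'a set). sqrt (2 * pi / c)) = (2 * pi / c) powr (real DIM('a) / 2)"
      using assms by (simp add: powr_half_sqrt_powr powr_realpow real_sqrt_power)
    moreover have "(\<Prod>b\<in>Basis. exp (- (k \<bullet> b)\<^sup>2 / (2 * c))) = exp (- (norm k)\<^sup>2 / (2 * c))"
      by (subst exp_sum[symmetric], simp) (simp add: nrm sum_divide_distrib sum_negf)
    ultimately show ?thesis
      unfolding I_def by (simp only: of_real_prod[symmetric] prod.distrib)
  qed
  ultimately show ?thesis by (simp only:)
qed

lemma gaussian_integral:
  assumes "c > 0"
  shows "has_bochner_integral lborel (\<lambda>x::'a::euclidean_space. exp (- c * (norm x)\<^sup>2 / 2))
    ((2 * pi / c) powr (real DIM('a) / 2))"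
proof -
  note * = has_bochner_integral_bounded_linear[OF bounded_linear_Re
      gaussian_fourier_integral[OF assms, of "0::'a"]]
  show ?thesis
    using *[unfolded inner_zero_left of_real_0 mult_zero_right exp_zero mult_1 norm_zero Re_complex_of_real
        zero_power2 minus_zero div_0 exp_zero mult_1_right] .
qed

text \<open>
  The Gamma integral represents \<open>Gamma M * (1 + r) powr (- M)\<close> as a superposition of
  exponentials \<open>exp (- t r)\<close>. With \<open>r = |x|\<^sup>2\<close> and the integrations
  exchanged, the integral over \<open>x\<close> is Gaussian and the remaining one is the Gamma
  integral with parameter \<open>M - d / 2\<close>.
\<close>
lemma nn_integral_bessel_weight:
  fixes M :: real
  assumes M: "M > real DIM('a::euclidean_space) / 2"
  shows "(\<integral>\<^sup>+x. ennreal ((1 + (norm (x::'a))\<^sup>2) powr (- M)) \<partial>lborel) =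
    ennreal (pi powr (real DIM('a) / 2) * Gamma (M - real DIM('a) / 2) / Gamma M)"
proof -
  define D where "D = real DIM('a) / 2"
  have D: "D > 0" "M > D" "M > 0" using M by (auto simp: D_def)
  define \<gamma> where "\<gamma> t = indicator {0..} t * t powr (M - 1) / exp t" for t :: real
  have [measurable]: "\<gamma> \<in> borel_measurable borel" unfolding \<gamma>_def by measurable
  have scaled: "ennreal (Gamma M * (1 + r) powr (- M)) =
      (\<integral>\<^sup>+t. ennreal (\<gamma> t * exp (- t * r)) \<partial>lborel)" if "r \<ge> 0" for r
  proof -
    have r: "1 + r > 0" using that by simp
    have pt: "\<gamma> (0 + (1 + r) * t) = (1 + r) powr (M - 1) * (\<gamma> t * exp (- t * r))" for t
    proof (cases "t \<ge> 0")
      case True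
      have "exp ((1 + r) * t) = exp t * exp (t * r)" by (simp add: exp_add[symmetric] algebra_simps)
      moreover have "((1 + r) * t) powr (M - 1) = (1 + r) powr (M - 1) * t powr (M - 1)"
        using r True by (simp add: powr_mult)
      ultimately show ?thesis using True r by (simp add: \<gamma>_def exp_minus divide_inverse)
    next
      case False
      then have "(1 + r) * t < 0" using r by (simp add: mult_pos_neg)
      then show ?thesis using False by (simp add: \<gamma>_def)
    qed
    have "ennreal (Gamma M) = (\<integral>\<^sup>+t. ennreal (\<gamma> t) \<partial>lborel)"
      using Gamma_conv_nn_integral_real[of M] D by (simp add: \<gamma>_def)
    also have "\<dots> = ennreal \<bar>1 + r\<bar> * (\<integral>\<^sup>+t. ennreal (\<gamma> (0 + (1 + r) * t)) \<partial>lborel)"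
      using r by (intro nn_integral_real_affine) auto
    also have "\<dots> = ennreal ((1 + r) powr M) * (\<integral>\<^sup>+t. ennreal (\<gamma> t * exp (- t * r)) \<partial>lborel)"
    proof -
      have "ennreal \<bar>1 + r\<bar> * ennreal ((1 + r) powr (M - 1)) = ennreal ((1 + r) powr M)"
        using r by (simp add: powr_diff flip: ennreal_mult')
      moreover have "(\<integral>\<^sup>+t. ennreal ((1 + r) powr (M - 1) * (\<gamma> t * exp (- t * r))) \<partial>lborel) =
          ennreal ((1 + r) powr (M - 1)) * (\<integral>\<^sup>+t. ennreal (\<gamma> t * exp (- t * r)) \<partial>lborel)"
        by (simp add: ennreal_mult' nn_integral_cmult)
      ultimately show ?thesis unfolding pt by (simp only: mult.assoc[symmetric])
    qed
    finally have "ennreal (Gamma M) = ennreal ((1 + r) powr M) * (\<integral>\<^sup>+t. ennreal (\<gamma> t * exp (- t * r)) \<partial>lborel)" .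
    then have "ennreal ((1 + r) powr (- M)) * ennreal (Gamma M) =
      (ennreal ((1 + r) powr (- M)) * ennreal ((1 + r) powr M)) * (\<integral>\<^sup>+t. ennreal (\<gamma> t * exp (- t * r)) \<partial>lborel)"
      by (simp add: mult.assoc)
    also have "ennreal ((1 + r) powr (- M)) * ennreal ((1 + r) powr M) = 1"
      using r by (simp add: powr_minus flip: ennreal_mult')
    finally show ?thesis
      using D r by (simp add: mult.commute flip: ennreal_mult')
  qed
  have "ennreal (Gamma M) * (\<integral>\<^sup>+x. ennreal ((1 + (norm (x::'a))\<^sup>2) powr (- M)) \<partial>lborel)
      = (\<integral>\<^sup>+x. ennreal (Gamma M * (1 + (norm (x::'a))\<^sup>2) powr (- M)) \<partial>lborel)"
    using D by (simp add: ennreal_mult' nn_integral_cmult)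
  also have "\<dots> = (\<integral>\<^sup>+x. (\<integral>\<^sup>+t. ennreal (\<gamma> t * exp (- t * (norm (x::'a))\<^sup>2)) \<partial>lborel) \<partial>lborel)"
    by (intro nn_integral_cong scaled) simp
  also have "\<dots> = (\<integral>\<^sup>+t. (\<integral>\<^sup>+x. ennreal (\<gamma> t * exp (- t * (norm (x::'a))\<^sup>2)) \<partial>lborel) \<partial>lborel)"
    by (rule lborel_pair.Fubini') measurable
  also have "\<dots> = (\<integral>\<^sup>+t. ennreal (pi powr D * (indicator {0..} t * t powr (M - D - 1) / exp t)) \<partial>lborel)"
  proof (intro nn_integral_cong)
    fix t :: real
    show "(\<integral>\<^sup>+x. ennreal (\<gamma> t * exp (- t * (norm (x::'a))\<^sup>2)) \<partial>lborel) =
        ennreal (pi powr D * (indicator {0..} t * t powr (M - D - 1) / exp t))"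
    proof (cases "t > 0")
      case True
      have "has_bochner_integral lborel (\<lambda>x::'a. exp (- t * (norm (x::'a))\<^sup>2)) ((pi / t) powr D)"
        using gaussian_integral[of "2 * t", where 'a = 'a] True by (simp add: D_def)
      then have *: "(\<integral>\<^sup>+x. ennreal (exp (- t * (norm (x::'a))\<^sup>2)) \<partial>lborel) = ennreal ((pi / t) powr D)"
        by (subst nn_integral_eq_integral) (auto simp: has_bochner_integral_iff)
      have "(\<integral>\<^sup>+x. ennreal (\<gamma> t * exp (- t * (norm (x::'a))\<^sup>2)) \<partial>lborel) = ennreal (\<gamma> t * (pi / t) powr D)"
      proof -
        have g: "0 \<le> \<gamma> t" by (simp add: \<gamma>_def)
        show ?thesis
          unfolding ennreal_mult'[OF g]
          by (subst nn_integral_cmult) (simp_all only: *, measurable)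
      qed
      also have "\<gamma> t * (pi / t) powr D = pi powr D * (indicator {0..} t * t powr (M - D - 1) / exp t)"
        using True by (simp add: \<gamma>_def powr_divide powr_diff mult_ac)
      finally show ?thesis .
    next
      case False
      then have "indicator {0..} t * t powr x = 0" for x by (cases "t = 0") auto
      then show ?thesis by (auto simp: \<gamma>_def)
    qed
  qed
  also have "\<dots> = ennreal (pi powr D) * ennreal (Gamma (M - D))"
  proof -
    have "(\<integral>\<^sup>+t. ennreal (pi powr D) * ennreal (indicator {0..} t * t powr (M - D - 1) / exp t) \<partial>lborel)
        = ennreal (pi powr D) * (\<integral>\<^sup>+t. ennreal (indicator {0..} t * t powr (M - D - 1) / exp t) \<partial>lborel)"
      by (rule nn_integral_cmult) measurable
    then show ?thesis
      using Gamma_conv_nn_integral_real[of "M - D"] D by (simp add: ennreal_mult'[symmetric])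
  qed
  finally have *: "ennreal (Gamma M) * (\<integral>\<^sup>+x. ennreal ((1 + (norm (x::'a))\<^sup>2) powr (- M)) \<partial>lborel) =
      ennreal (pi powr D * Gamma (M - D))"
    by (simp add: ennreal_mult')
  have "(\<integral>\<^sup>+x. ennreal ((1 + (norm (x::'a))\<^sup>2) powr (- M)) \<partial>lborel) =
      ennreal (1 / Gamma M) * (ennreal (Gamma M) * (\<integral>\<^sup>+x. ennreal ((1 + (norm (x::'a))\<^sup>2) powr (- M)) \<partial>lborel))"
    using Gamma_real_pos[OF D(3)] by (simp add: mult.assoc[symmetric] flip: ennreal_mult')
  also have "\<dots> = ennreal (pi powr D * Gamma (M - D) / Gamma M)"
    unfolding * using D Gamma_real_pos[OF D(3)] by (simp flip: ennreal_mult')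
  finally show ?thesis by (simp add: D_def)
qed

lemma integral_bessel_weight:
  fixes M :: real
  assumes M: "M > real DIM('a::euclidean_space) / 2"
  shows "has_bochner_integral lborel (\<lambda>x::'a. (1 + (norm x)\<^sup>2) powr (- M))
    (pi powr (real DIM('a) / 2) * Gamma (M - real DIM('a) / 2) / Gamma M)"
proof (rule has_bochner_integral_nn_integral)
  have "real DIM('a) / 2 \<ge> 0" by simp
  then have "M > 0" using M by linarith
  then show "0 \<le> pi powr (real DIM('a) / 2) * Gamma (M - real DIM('a) / 2) / Gamma M"
    using M by simp
qed (use nn_integral_bessel_weight[OF M] in auto)

section \<open>The hypergeometric upper bound\<close>

text \<open>
  The right-hand side does not contain \<open>u\<close>. For fixed \<open>t\<close> this is the best
  such bound when \<open>a\<close> is less than \<open>4 l\<close>, and for \<open>a = 4 * l\<close>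
  its last factor is \<open>1 + O(l y\<^sup>2)\<close> with \<open>y = 1 - t\<close>. The absence of a
  term of order \<open>l y\<close> matters, since the Beta density concentrates at \<open>y\<close> of
  order \<open>1 / l\<close>.
\<close>
lemma weighted_am_gm_powr:
  fixes a l t u :: real
  assumes "0 < l" "l < a" "0 < t" "t \<le> 1" "0 \<le> u"
  shows "(1 + 4 * u) powr l * (1 + u * t) powr (- a) \<le>
    (4 * l / a) powr l * (4 * (a - l) / (3 * a)) powr (a - l) *
    (t powr (- l) * (1 + (1 - t) / 3) powr (- (a - l)))"
proof -
  \<comment> \<open>the weights \<open>p\<close> and \<open>1 - p\<close> are proportional to the exponents of
    \<open>X\<close> and \<open>Y\<close>; the scalings are such that
    \<open>p X + (1 - p) Y = 1 + u t\<close>\<close>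
  define p where "p = l / a"
  define X where "X = t * (1 + 4 * u) / (4 * p)"
  define Y where "Y = (1 - t / 4) / (1 - p)"
  have p: "0 < p" "p < 1" using assms by (auto simp: p_def)
  have XY: "0 < X" "0 < Y" using assms p by (auto simp: X_def Y_def)
  have pa: "p * a = l" "(1 - p) * a = a - l" using assms by (auto simp: p_def field_simps)
  have "X powr p * Y powr (1 - p) \<le> p * X + (1 - p) * Y"
  proof -
    have "p * ln X + (1 - p) * ln Y \<le> ln (p * X + (1 - p) * Y)"
      using concave_onD[OF ln_concave, of "1 - p" X Y] p XY by simp
    moreover have "0 < p * X + (1 - p) * Y" using p XY by (intro add_pos_pos mult_pos_pos) auto
    ultimately have "exp (p * ln X + (1 - p) * ln Y) \<le> p * X + (1 - p) * Y"
      by (simp add: ln_ge_iff)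
    then show ?thesis using XY by (simp add: powr_def exp_add)
  qed
  also have "p * X + (1 - p) * Y = 1 + u * t"
    using p by (simp add: X_def Y_def field_simps)
  finally have "(X powr p * Y powr (1 - p)) powr a \<le> (1 + u * t) powr a"
    using assms by (intro powr_mono2) auto
  then have le: "X powr l * Y powr (a - l) \<le> (1 + u * t) powr a"
    using XY pa by (simp add: powr_mult powr_powr)
  have X: "X powr l = (1 + 4 * u) powr l / ((4 * l / a) powr l * t powr (- l))"
  proof -
    have "X = (1 + 4 * u) / ((4 * l / a) / t)" using assms by (simp add: X_def p_def field_simps)
    moreover have "0 \<le> 1 + 4 * u" "0 \<le> (4 * l / a) / t" "0 \<le> 4 * l / a" using assms by auto
    ultimately have "X powr l = (1 + 4 * u) powr l / ((4 * l / a) powr l / t powr l)"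
      using assms by (simp only: powr_divide less_imp_le)
    then show ?thesis by (simp only: powr_minus) (simp add: divide_simps)
  qed
  have Y: "Y powr (a - l) = 1 / ((4 * (a - l) / (3 * a)) powr (a - l) * (1 + (1 - t) / 3) powr (- (a - l)))"
  proof -
    have "Y = (1 + (1 - t) / 3) / (4 * (a - l) / (3 * a))" using assms by (simp add: Y_def p_def field_simps)
    moreover have "0 \<le> 1 + (1 - t) / 3" "0 \<le> 4 * (a - l) / (3 * a)" using assms by (auto simp: field_simps)
    ultimately have "Y powr (a - l) = (1 + (1 - t) / 3) powr (a - l) / (4 * (a - l) / (3 * a)) powr (a - l)"
      by (simp only: powr_divide)
    then show ?thesis by (simp only: powr_minus) (simp add: divide_simps)
  qed
  define A where "A = (4 * l / a) powr l * t powr (- l)"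
  define B where "B = (4 * (a - l) / (3 * a)) powr (a - l) * (1 + (1 - t) / 3) powr (- (a - l))"
  have "0 < 1 + (1 - t) / 3" using assms by (simp add: field_simps)
  then have AB: "0 < A" "0 < B" using assms by (auto simp: A_def B_def)
  have "0 < 1 + u * t" using assms by (intro add_pos_nonneg) auto
  then have "(1 + 4 * u) powr l * (1 + u * t) powr (- a) \<le> A * B"
    using le AB unfolding X Y A_def[symmetric] B_def[symmetric] by (simp add: powr_minus field_simps)
  then show ?thesis by (simp add: A_def B_def mult_ac)
qed

text \<open>
  Here \<open>t = 1 - y\<close> with \<open>y = (2 s - 1)\<^sup>2\<close>. The powers of
  \<open>t\<close> and \<open>1 + y / 3\<close> that remain after the preceding bound are replaced by
  powers of \<open>1 + y\<close>, by means of \<open>t \<le> 1 / (1 + y)\<close> and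
  \<open>1 + y \<le> (1 + y / 3) ^ 3\<close>. Both hold with equality to first order in
  \<open>y\<close>, so that the leading term of the integral is preserved.
\<close>
lemma hyp_integral_scaled_bound:
  fixes l \<delta> u :: real
  assumes l: "1 \<le> l" "\<delta> < 3 * l" "0 \<le> \<delta>" and M: "2 * l - 1 - \<delta> / 3 > 1 / 2" and "0 \<le> u"
  defines "a \<equiv> 4 * l - \<delta>" and "M \<equiv> 2 * l - 1 - \<delta> / 3"
  shows "(1 + 4 * u) powr l * hyp_integral a (2 * l) (2 * l) (- u) \<le>
    (4 * l / a) powr l * (4 * (a - l) / (3 * a)) powr (a - l) *
    (4 powr (1 - 2 * l) * (sqrt pi / 2 * Gamma (M - 1 / 2) / Gamma M))"
proof -
  define \<kappa> where "\<kappa> = (4 * l / a) powr l * (4 * (a - l) / (3 * a)) powr (a - l)"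
  have a: "0 < l" "l < a" using l by (auto simp: a_def)
  have \<kappa>: "0 \<le> \<kappa>" by (simp add: \<kappa>_def)
  define t where "t s = 4 * s * (1 - s)" for s :: real
  define G where "G s = (1 + (2 * s - 1)\<^sup>2) powr (- M)" for s :: real
  have G_int: "has_bochner_integral lborel G (sqrt pi / 2 * Gamma (M - 1 / 2) / Gamma M)"
  proof -
    have J: "has_bochner_integral lborel (\<lambda>v::real. (1 + v\<^sup>2) powr (- M)) (sqrt pi * Gamma (M - 1 / 2) / Gamma M)"
      using integral_bessel_weight[of M, where 'a = real] M by (simp add: M_def powr_half_sqrt)
    have "G s = (\<lambda>v. (1 + v\<^sup>2) powr (- M)) (-1 + 2 * s)" for s by (simp add: G_def)
    then have "G = (\<lambda>s. (1 + (-1 + 2 * s)\<^sup>2) powr (- M))" by auto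
    moreover have "has_bochner_integral lborel (\<lambda>s. (1 + (-1 + 2 * s)\<^sup>2) powr (- M))
        ((sqrt pi * Gamma (M - 1 / 2) / Gamma M) /\<^sub>R \<bar>2\<bar>)"
      by (rule iffD1[OF lborel_has_bochner_integral_real_affine_iff J]) simp
    ultimately show ?thesis by simp
  qed
  have "(1 + 4 * u) powr l * (beta_weight (2 * l) (2 * l) s * (1 - - u * (4 * s * (1 - s))) powr (- a))
      \<le> \<kappa> * 4 powr (1 - 2 * l) * G s" for s
  proof (cases "s \<in> {0<..<1}")
    case False
    then have "beta_weight (2 * l) (2 * l) s = 0" by (cases "s = 0 \<or> s = 1") (auto simp: beta_weight_def)
    then show ?thesis using \<kappa> by (simp add: G_def)
  next
    case True
    define y where "y = (2 * s - 1)\<^sup>2"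
    have ty: "t s = 1 - y" by (simp add: t_def y_def power2_eq_square algebra_simps)
    have t: "0 < t s" "t s \<le> 1" using True four_s_one_minus_s[of s] by (auto simp: t_def)
    then have y: "0 \<le> y" "y < 1" by (auto simp: ty)
    have w: "beta_weight (2 * l) (2 * l) s = 4 powr (1 - 2 * l) * t s powr (2 * l - 1)"
      using True by (simp add: beta_weight_def t_def powr_mult powr_diff)
    have le: "(1 + 4 * u) powr l * (1 + u * t s) powr (- a) \<le> \<kappa> * (t s powr (- l) * (1 + y / 3) powr (- (a - l)))"
      using weighted_am_gm_powr[OF a t \<open>0 \<le> u\<close>] by (simp add: \<kappa>_def ty)
    have "(1 + 4 * u) powr l * (beta_weight (2 * l) (2 * l) s * (1 - - u * (4 * s * (1 - s))) powr (- a))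
      = 4 powr (1 - 2 * l) * t s powr (2 * l - 1) * ((1 + 4 * u) powr l * (1 + u * t s) powr (- a))"
      unfolding w t_def[symmetric] by simp
    also have "\<dots> \<le> 4 powr (1 - 2 * l) * t s powr (2 * l - 1) * (\<kappa> * (t s powr (- l) * (1 + y / 3) powr (- (a - l))))"
      using le by (rule mult_left_mono) simp
    also have "\<dots> = \<kappa> * 4 powr (1 - 2 * l) * (t s powr (l - 1) * (1 + y / 3) powr (- (a - l)))"
      using t by (simp add: powr_add[symmetric] mult_ac)
    also have "\<dots> \<le> \<kappa> * 4 powr (1 - 2 * l) * ((1 + y) powr (- (l - 1)) * (1 + y) powr (- (l - \<delta> / 3)))"
    proof (intro mult_left_mono mult_mono)
      have "t s * (1 + y) \<le> 1" by (simp add: ty algebra_simps)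
      then have "t s \<le> inverse (1 + y)" using y by (simp add: field_simps)
      then have "t s powr (l - 1) \<le> inverse (1 + y) powr (l - 1)"
        using l t by (intro powr_mono2) auto
      then show "t s powr (l - 1) \<le> (1 + y) powr (- (l - 1))"
        using y by (simp add: inverse_powr powr_minus[of "1 + y" "l - 1"] del: minus_diff_eq)
      have "1 + y \<le> (1 + y / 3) ^ 3" 
      proof -
        have "(1 + y / 3) ^ 3 = 1 + y + (y\<^sup>2 / 3 + y ^ 3 / 27)"
          by (simp add: power3_eq_cube power2_eq_square field_simps)
        then show ?thesis using y by simp
      qed
      also have "\<dots> = (1 + y / 3) powr 3" using y by simp
      finally have "((1 + y / 3) powr 3) powr (- (l - \<delta> / 3)) \<le> (1 + y) powr (- (l - \<delta> / 3))"
        using y l by (intro powr_mono2') auto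
      then show "(1 + y / 3) powr (- (a - l)) \<le> (1 + y) powr (- (l - \<delta> / 3))"
        by (simp add: powr_powr a_def algebra_simps)
    qed (use \<kappa> in auto)
    also have "(1 + y) powr (- (l - 1)) * (1 + y) powr (- (l - \<delta> / 3)) = G s"
      by (simp add: powr_add[symmetric] G_def y_def M_def algebra_simps)
    finally show ?thesis .
  qed
  moreover have "integrable lborel (\<lambda>s. beta_weight (2 * l) (2 * l) s * (1 - - u * (4 * s * (1 - s))) powr (- a))"
  proof (rule integrable_beta_weight_mult)
    fix s :: real assume "s \<in> {0..1}"
    from four_s_one_minus_s[OF this] \<open>0 \<le> u\<close> have "1 \<le> 1 - - u * (4 * s * (1 - s))" by simp
    then show "\<bar>(1 - - u * (4 * s * (1 - s))) powr (- a)\<bar> \<le> 1"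
      using a powr_mono2'[of "- a" 1 "1 - - u * (4 * s * (1 - s))"] by simp
  qed (use a in auto)
  ultimately have "(LINT s|lborel. (1 + 4 * u) powr l * (beta_weight (2 * l) (2 * l) s * (1 - - u * (4 * s * (1 - s))) powr (- a)))
      \<le> (LINT s|lborel. \<kappa> * 4 powr (1 - 2 * l) * G s)"
    using G_int by (intro integral_mono integrable_mult_right) (auto simp: has_bochner_integral_iff)
  also have "\<dots> = \<kappa> * 4 powr (1 - 2 * l) * (sqrt pi / 2 * Gamma (M - 1 / 2) / Gamma M)"
    using G_int by (simp add: has_bochner_integral_iff)
  finally show ?thesis
    unfolding hyp_integral_def \<kappa>_def by (simp add: mult.assoc)
qed

text \<open>
  The left-hand side is the exponential of \<open>a\<close> times the relative entropy of the weights
  \<open>(l / a, 1 - l / a)\<close> with respect to \<open>(1 / 4, 3 / 4)\<close>, which is quadratic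
  in their difference. For \<open>a = 4 * l - \<delta>\<close> the bound is
  \<open>1 + O(1 / l)\<close>.
\<close>
lemma relative_entropy_factor_bound:
  fixes a l :: real
  assumes "0 < l" "l < a"
  shows "(4 * l / a) powr l * (4 * (a - l) / (3 * a)) powr (a - l) \<le> exp ((4 * l - a)\<^sup>2 / (3 * a))"
proof -
  have *: "x powr p \<le> exp (p * (x - 1))" if "0 < x" "0 \<le> p" for x p :: real
    using that ln_le_minus_one[of x] by (simp add: powr_def mult_left_mono)
  have "(4 * l / a) powr l * (4 * (a - l) / (3 * a)) powr (a - l)
      \<le> exp (l * (4 * l / a - 1)) * exp ((a - l) * (4 * (a - l) / (3 * a) - 1))"
    using assms by (intro mult_mono *) auto
  also have "\<dots> = exp (l * (4 * l / a - 1) + (a - l) * (4 * (a - l) / (3 * a) - 1))"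
    by (simp add: exp_add)
  also have "l * (4 * l / a - 1) + (a - l) * (4 * (a - l) / (3 * a) - 1) = (4 * l - a)\<^sup>2 / (3 * a)"
    using assms by (simp add: field_simps power2_eq_square)
  finally show ?thesis .
qed

lemma Gamma_duplication_real:
  assumes "x > (0::real)"
  shows "Gamma x * Gamma (x + 1 / 2) = 2 powr (1 - 2 * x) * sqrt pi * Gamma (2 * x)"
proof -
  have np: "complex_of_real y \<notin> \<int>\<^sub>\<le>\<^sub>0" if "y > 0" for y
    using that by (auto simp: of_real_in_nonpos_Ints_iff dest: nonpos_Ints_nonpos)
  have "complex_of_real x + 1 / 2 = complex_of_real (x + 1 / 2)" by simp
  then have "Gamma (complex_of_real x) * Gamma (complex_of_real (x + 1 / 2)) =
      exp ((1 - 2 * complex_of_real x) * of_real (ln 2)) * of_real (sqrt pi) * Gamma (2 * complex_of_real x)"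
    using Gamma_legendre_duplication[of "complex_of_real x"] np[of x] np[of "x + 1 / 2"] assms by simp
  also have "exp ((1 - 2 * complex_of_real x) * of_real (ln 2)) = complex_of_real (2 powr (1 - 2 * x))"
    by (simp add: powr_def flip: exp_of_real)
  also have "2 * complex_of_real x = complex_of_real (2 * x)" by simp
  finally have "complex_of_real (Gamma x * Gamma (x + 1 / 2)) =
      complex_of_real (2 powr (1 - 2 * x) * sqrt pi * Gamma (2 * x))"
    by (metis Gamma_complex_of_real of_real_mult)
  then show ?thesis by (simp only: of_real_eq_iff)
qed


text \<open>
  The powers of four and the factors \<open>sqrt \<pi>\<close> cancel by Legendre's duplication
  formula. Besides the relative entropy factor there remains a product of two ratios of Gamma
  functions, of orders \<open>(2 l) powr (1 / 2)\<close> and \<open>(2 l) powr (- 1 / 2)\<close>.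
\<close>
lemma eventually_S_fun_bounds:
  fixes d :: nat
  defines "\<delta> \<equiv> real d / 2"
  shows "\<exists>U. near_one U \<and> (\<forall>\<^sub>F l in at_top. 0 \<le> U l \<and> (\<forall>u\<ge>0.
    S_fun l (2 * l) (2 * l) d u \<le> Gamma (4 * l - \<delta>) / ((4 * pi) powr \<delta> * Gamma (4 * l)) * U l))"
proof (intro exI conjI)
  define M where "M l = 2 * l - 1 - \<delta> / 3" for l :: real
  define a where "a l = 4 * l - \<delta>" for l :: real
  define U where "U l = exp (\<delta>\<^sup>2 / (3 * a l)) *
    (Gamma (2 * l + 1 / 2) / Gamma (2 * l) * (Gamma (M l - 1 / 2) / Gamma (M l)))" for l
  have "near_one (\<lambda>l. exp (\<delta>\<^sup>2 / (3 * a l)))"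
  proof -
    have "(\<lambda>l. exp (\<delta>\<^sup>2 / (3 * (4 * l - \<delta>))) - 1) \<in> O[at_top](\<lambda>l. 1 / l)"
      by real_asymp
    then show ?thesis by (simp add: near_one_def a_def)
  qed
  moreover have "near_one (\<lambda>l. Gamma (2 * l + 1 / 2) / Gamma (2 * l) * (Gamma (M l - 1 / 2) / Gamma (M l)))"
  proof -
    have "near_one (\<lambda>x. Gamma (x + 1 / 2) / Gamma (x + 0) * x powr (0 - 1 / 2) *
        (Gamma (x + (- 1 - \<delta> / 3 - 1 / 2)) / Gamma (x + (- 1 - \<delta> / 3)) * x powr ((- 1 - \<delta> / 3) - (- 1 - \<delta> / 3 - 1 / 2))))"
      by (intro near_one_mult near_one_Gamma_ratio)
    from near_one_affine[OF this, of 2 0]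
    show ?thesis
    proof (rule near_one_cong[rotated])
      show "\<forall>\<^sub>F l in at_top. Gamma (2 * l + 1 / 2) / Gamma (2 * l) * (Gamma (M l - 1 / 2) / Gamma (M l)) =
        Gamma (2 * l + 0 + 1 / 2) / Gamma (2 * l + 0 + 0) * (2 * l + 0) powr (0 - 1 / 2) *
        (Gamma (2 * l + 0 + (- 1 - \<delta> / 3 - 1 / 2)) / Gamma (2 * l + 0 + (- 1 - \<delta> / 3)) *
         (2 * l + 0) powr ((- 1 - \<delta> / 3) - (- 1 - \<delta> / 3 - 1 / 2)))"
        using eventually_gt_at_top[of 0]
      proof eventually_elim
        case (elim l)
        have "(2 * l) powr (- (1 / 2)) * (2 * l) powr (1 / 2) = 1"
          using elim by (simp flip: powr_add)
        then show ?case by (simp add: M_def algebra_simps)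
      qed
    qed simp
  qed
  ultimately show "near_one U"
    unfolding U_def by (rule near_one_mult)
  show "\<forall>\<^sub>F l in at_top. 0 \<le> U l \<and> (\<forall>u\<ge>0.
    S_fun l (2 * l) (2 * l) d u \<le> Gamma (4 * l - \<delta>) / ((4 * pi) powr \<delta> * Gamma (4 * l)) * U l)"
    using near_one_eventually_pos[OF \<open>near_one U\<close>] eventually_ge_at_top[of "1 + \<delta>"]
  proof eventually_elim
    case (elim l)
    have \<delta>: "0 \<le> \<delta>" by (simp add: \<delta>_def)
    have l: "1 \<le> l" "\<delta> < 3 * l" "1 / 2 < 2 * l - 1 - \<delta> / 3" "0 < l" "l < 4 * l - \<delta>" "0 < 4 * l - \<delta>"
      using elim \<delta> by auto
    have B: "0 < Beta (2 * l) (2 * l)" using l by (simp add: Beta_def rGamma_inverse_Gamma)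
    define P where "P = Gamma (4 * l - \<delta>) / ((4 * pi) powr \<delta> * Gamma (4 * l))"
    have P: "0 \<le> P" using l by (simp add: P_def)
    define q where "q = Gamma (M l - 1 / 2) / Gamma (M l)"
    have q: "0 \<le> q" using l by (simp add: q_def M_def)
    have norm: "4 powr (1 - 2 * l) * (sqrt pi / 2 * Gamma (M l - 1 / 2) / Gamma (M l)) / Beta (2 * l) (2 * l) =
        Gamma (2 * l + 1 / 2) / Gamma (2 * l) * q"
    proof -
      have G: "Gamma (2 * l) > 0" "Gamma (4 * l) > 0" using l by auto
      have dup: "Gamma (2 * l) * Gamma (2 * l + 1 / 2) = 2 powr (1 - 4 * l) * sqrt pi * Gamma (4 * l)"
        using Gamma_duplication_real[of "2 * l"] l by simp
      have "4 powr (1 - 2 * l) = (2 powr 2) powr (1 - 2 * l)" by simp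
      also have "\<dots> = 2 powr (2 - 4 * l)" by (simp only: powr_powr) (simp add: algebra_simps)
      also have "\<dots> = 2 powr (1 - 4 * l) * 2"
        using powr_add[of 2 "1 - 4 * l" 1] by (simp add: algebra_simps)
      finally have four: "4 powr (1 - 2 * l) = 2 powr (1 - 4 * l) * 2" .
      have "4 powr (1 - 2 * l) * (sqrt pi / 2 * Gamma (M l - 1 / 2) / Gamma (M l)) / Beta (2 * l) (2 * l) =
          (2 powr (1 - 4 * l) * sqrt pi * Gamma (4 * l)) * q / (Gamma (2 * l) * Gamma (2 * l))"
        unfolding four using G by (simp add: q_def Beta_def rGamma_inverse_Gamma field_simps)
      also have "\<dots> = Gamma (2 * l + 1 / 2) / Gamma (2 * l) * q"
        unfolding dup[symmetric] using G by simp
      finally show ?thesis .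
    qed
    have "S_fun l (2 * l) (2 * l) d u \<le> P * U l" if u: "0 \<le> u" for u
    proof -
      define \<kappa> where "\<kappa> = (4 * l / (4 * l - \<delta>)) powr l * (4 * ((4 * l - \<delta>) - l) / (3 * (4 * l - \<delta>))) powr ((4 * l - \<delta>) - l)"
      have \<kappa>: "\<kappa> \<le> exp (\<delta>\<^sup>2 / (3 * a l))"
        using relative_entropy_factor_bound[of l "4 * l - \<delta>"] l by (simp add: \<kappa>_def a_def)
      have "hyp3F2 (4 * l - \<delta>) (2 * l) (2 * l) ((2 * l + 2 * l) / 2) ((2 * l + 2 * l + 1) / 2) (- u) =
          hyp_integral (4 * l - \<delta>) (2 * l) (2 * l) (- u) / Beta (2 * l) (2 * l)"
        using l u by (intro hyp3F2_eq_integral) auto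
      then have "S_fun l (2 * l) (2 * l) d u =
          P * ((1 + 4 * u) powr l * hyp_integral (4 * l - \<delta>) (2 * l) (2 * l) (- u) / Beta (2 * l) (2 * l))"
        unfolding S_fun_def P_def \<delta>_def[symmetric] by simp
      also have "\<dots> \<le> P * (\<kappa> * (4 powr (1 - 2 * l) * (sqrt pi / 2 * Gamma (M l - 1 / 2) / Gamma (M l))) / Beta (2 * l) (2 * l))"
        using hyp_integral_scaled_bound[OF l(1,2) \<delta> l(3) u] P B
        unfolding \<kappa>_def M_def by (intro mult_left_mono divide_right_mono) auto
      also have "\<dots> = P * (\<kappa> * (Gamma (2 * l + 1 / 2) / Gamma (2 * l) * q))"
        unfolding norm[symmetric] by simp
      also have "\<dots> \<le> P * U l"
        unfolding U_def q_def[symmetric] using l P q \<kappa>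
        by (intro mult_left_mono mult_right_mono) auto
      finally show ?thesis .
    qed
    then show ?case using elim by (simp add: P_def)
  qed
qed

text \<open>
  The prefactor \<open>P\<close> carries the leading order. It is the value at \<open>u = 0\<close>,
  hence a lower bound of the supremum, and the preceding lemma bounds the supremum by \<open>P\<close>
  times a factor \<open>1 + O(1 / l)\<close>.
\<close>
lemma asymp_form_K_upper: "asymp_form d (\<lambda>l. K_upper l (2 * l) (2 * l) d)"
proof -
  define \<delta> where "\<delta> = real d / 2"
  define P where "P l = Gamma (4 * l - \<delta>) / ((4 * pi) powr \<delta> * Gamma (4 * l))" for l
  obtain U where U: "near_one U" "\<forall>\<^sub>F l in at_top. 0 \<le> U l \<and> (\<forall>u\<ge>0.
    S_fun l (2 * l) (2 * l) d u \<le> P l * U l)"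
    using eventually_S_fun_bounds[of d] unfolding P_def \<delta>_def by blast
  have P1: "near_one (\<lambda>l. P l * (16 * pi * l) powr \<delta>)"
  proof -
    have "near_one (\<lambda>x. Gamma (x + - \<delta>) / Gamma (x + 0) * x powr (0 - - \<delta>))"
      by (rule near_one_Gamma_ratio)
    from near_one_affine[OF this, of 4 0] show ?thesis
    proof (rule near_one_cong[rotated])
      show "\<forall>\<^sub>F l in at_top. P l * (16 * pi * l) powr \<delta> =
        Gamma (4 * l + 0 + - \<delta>) / Gamma (4 * l + 0 + 0) * (4 * l + 0) powr (0 - - \<delta>)"
        using eventually_gt_at_top[of 0]
      proof eventually_elim
        case (elim l)
        have "(16 * pi * l) powr \<delta> = ((4 * pi) * (4 * l)) powr \<delta>" by (simp add: mult_ac)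
        also have "\<dots> = (4 * pi) powr \<delta> * (4 * l) powr \<delta>"
          by (rule powr_mult)
        finally show ?case by (simp add: P_def)
      qed
    qed simp
  qed
  have ev: "\<forall>\<^sub>F l in at_top. 0 < P l \<and> P l \<le> (SUP u\<in>{0..}. S_fun l (2 * l) (2 * l) d u) \<and>
      (SUP u\<in>{0..}. S_fun l (2 * l) (2 * l) d u) \<le> P l * U l"
    using U(2) eventually_gt_at_top[of 0] eventually_gt_at_top[of "\<delta>"]
  proof eventually_elim
    case (elim l)
    have \<delta>: "0 \<le> \<delta>" by (simp add: \<delta>_def)
    have bdd: "bdd_above ((\<lambda>u. S_fun l (2 * l) (2 * l) d u) ` {0..})"
      using elim by (intro bdd_aboveI2[of _ _ "P l * U l"]) auto
    have B: "0 < Beta (2 * l) (2 * l)" using elim by (simp add: Beta_def rGamma_inverse_Gamma)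
    have "hyp3F2 (4 * l - \<delta>) (2 * l) (2 * l) ((2 * l + 2 * l) / 2) ((2 * l + 2 * l + 1) / 2) 0 =
        hyp_integral (4 * l - \<delta>) (2 * l) (2 * l) 0 / Beta (2 * l) (2 * l)"
      using elim by (intro hyp3F2_eq_integral) auto
    also have "hyp_integral (4 * l - \<delta>) (2 * l) (2 * l) 0 = Beta (2 * l) (2 * l)"
      using elim by (simp add: hyp_integral_def integral_beta_weight)
    finally have "S_fun l (2 * l) (2 * l) d 0 = P l"
      using B unfolding S_fun_def P_def \<delta>_def[symmetric] by simp
    moreover have "S_fun l (2 * l) (2 * l) d 0 \<le> (SUP u\<in>{0..}. S_fun l (2 * l) (2 * l) d u)"
      using bdd by (intro cSUP_upper) auto
    moreover have "(SUP u\<in>{0..}. S_fun l (2 * l) (2 * l) d u) \<le> P l * U l"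
      using elim by (intro cSUP_least) auto
    moreover have "0 < P l" using elim \<delta> by (simp add: P_def)
    ultimately show ?case by simp
  qed
  have "near_one (\<lambda>l. (SUP u\<in>{0..}. S_fun l (2 * l) (2 * l) d u) * (16 * pi * l) powr \<delta>)"
  proof (rule near_one_squeeze[OF P1 near_one_mult[OF P1 U(1)]])
    show "\<forall>\<^sub>F l in at_top. P l * (16 * pi * l) powr \<delta> \<le>
      (SUP u\<in>{0..}. S_fun l (2 * l) (2 * l) d u) * (16 * pi * l) powr \<delta>"
      using ev by (rule eventually_mono) (auto intro: mult_right_mono)
    show "\<forall>\<^sub>F l in at_top. (SUP u\<in>{0..}. S_fun l (2 * l) (2 * l) d u) * (16 * pi * l) powr \<delta> \<le>
      P l * (16 * pi * l) powr \<delta> * U l"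
      using ev
    proof eventually_elim
      case (elim l)
      then have "(SUP u\<in>{0..}. S_fun l (2 * l) (2 * l) d u) * (16 * pi * l) powr \<delta>
          \<le> (P l * U l) * (16 * pi * l) powr \<delta>" by (intro mult_right_mono) auto
      then show ?case by (simp add: mult_ac)
    qed
  qed
  from near_one_powr[OF this, of "1 / 2"] show ?thesis
    unfolding asymp_form_iff_near_one
  proof (rule near_one_cong[rotated])
    show "\<forall>\<^sub>F l in at_top. K_upper l (2 * l) (2 * l) d * (16 * pi * l) powr (real d / 4) =
      ((SUP u\<in>{0..}. S_fun l (2 * l) (2 * l) d u) * (16 * pi * l) powr \<delta>) powr (1 / 2)"
      using ev eventually_gt_at_top[of 0]
    proof eventually_elim
      case (elim l)
      then have "0 \<le> (SUP u\<in>{0..}. S_fun l (2 * l) (2 * l) d u)" by linarith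
      then show ?case
        by (simp add: K_upper_def powr_mult powr_powr powr_half_sqrt[symmetric] \<delta>_def)
    qed
  qed
qed

section \<open>The heat kernel and uniqueness\<close>

lemma has_bochner_integral_lborel_affine:
  fixes f :: "'a::euclidean_space \<Rightarrow> 'b::{banach, second_countable_topology}"
  assumes "c \<noteq> 0" "has_bochner_integral lborel f I"
  shows "has_bochner_integral lborel (\<lambda>z. \<bar>c\<bar> ^ DIM('a) *\<^sub>R f (t + c *\<^sub>R z)) I"
proof -
  have [measurable]: "f \<in> borel_measurable borel"
    using borel_measurable_has_bochner_integral[OF assms(2)] by simp
  define D where "D = density (distr lborel borel (\<lambda>x::'a. t + c *\<^sub>R x)) (\<lambda>_. ennreal (\<bar>c\<bar> ^ DIM('a)))"
  have D: "lborel = D"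
    using lborel_affine[OF assms(1), of t] by (simp add: D_def)
  have "integrable D f" "integral\<^sup>L D f = I"
    using assms(2) unfolding D by (auto simp: has_bochner_integral_iff)
  then show ?thesis
    by (simp add: D_def has_bochner_integral_iff integrable_density integral_density
        integrable_distr_eq integral_distr)
qed

lemma has_bochner_integral_lborel_reflect:
  fixes f :: "'a::euclidean_space \<Rightarrow> 'b::{banach, second_countable_topology}"
  assumes "has_bochner_integral lborel f I"
  shows "has_bochner_integral lborel (\<lambda>y. f (x - y)) I"
  using has_bochner_integral_lborel_affine[OF _ assms, of "- 1" x] by simp

lemma nn_integral_lborel_affine:
  fixes f :: "'a::euclidean_space \<Rightarrow> ennreal"
  assumes "c \<noteq> 0" and [measurable]: "f \<in> borel_measurable borel"
  shows "(\<integral>\<^sup>+x. f x \<partial>lborel) = ennreal (\<bar>c\<bar> ^ DIM('a)) * (\<integral>\<^sup>+x. f (t + c *\<^sub>R x) \<partial>lborel)"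
proof -
  define D where "D = density (distr lborel borel (\<lambda>x::'a. t + c *\<^sub>R x)) (\<lambda>_. ennreal (\<bar>c\<bar> ^ DIM('a)))"
  have D: "lborel = D"
    using lborel_affine[OF assms(1), of t] by (simp add: D_def)
  have "(\<integral>\<^sup>+x. f x \<partial>D) = ennreal (\<bar>c\<bar> ^ DIM('a)) * (\<integral>\<^sup>+x. f (t + c *\<^sub>R x) \<partial>lborel)"
    by (simp add: D_def nn_integral_density nn_integral_distr nn_integral_cmult)
  then show ?thesis using D by simp
qed

lemma Fubini_bounded_kernel:
  fixes f :: "'a::euclidean_space \<Rightarrow> complex" and g :: "'b::euclidean_space \<Rightarrow> complex"
  assumes f: "integrable lborel f" and g: "integrable lborel g"
    and K[measurable]: "case_prod K \<in> borel_measurable (borel \<Otimes>\<^sub>M borel)"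
    and bound: "\<And>x y. cmod (K x y) \<le> C"
  shows "(LINT x|lborel. f x * (LINT y|lborel. g y * K x y)) =
    (LINT y|lborel. g y * (LINT x|lborel. f x * K x y))"
    and "integrable lborel (\<lambda>x. f x * (LINT y|lborel. g y * K x y))"
proof -
  have [measurable]: "f \<in> borel_measurable borel" "g \<in> borel_measurable borel"
    using f g by (auto dest: borel_measurable_integrable)
  have [measurable]: "case_prod K \<in> borel_measurable (lborel \<Otimes>\<^sub>M lborel)"
    using K by (simp cong: measurable_cong_sets)
  have gK: "integrable lborel (\<lambda>y. g y * K x y)" for x
  proof (rule Bochner_Integration.integrable_bound[of _ "\<lambda>y. C * cmod (g y)"])
    show "integrable lborel (\<lambda>y. C * cmod (g y))"
      using g by simp
    have "0 \<le> C" using bound[of x undefined] norm_ge_zero order_trans by blast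
    then show "AE y in lborel. norm (g y * K x y) \<le> norm (C * cmod (g y))"
      using bound by (auto simp: norm_mult mult.commute[of C] intro!: mult_left_mono)
  qed measurable
  have int: "integrable (lborel \<Otimes>\<^sub>M lborel) (\<lambda>(x, y). f x * (g y * K x y))"
  proof (rule lborel_pair.Fubini_integrable)
    show "(\<lambda>(x, y). f x * (g y * K x y)) \<in> borel_measurable (lborel \<Otimes>\<^sub>M lborel)"
      by measurable
    have le: "(LINT y|lborel. cmod (g y * K x y)) \<le> C * (LINT y|lborel. cmod (g y))" for x
    proof -
      have "(LINT y|lborel. cmod (g y * K x y)) \<le> (LINT y|lborel. C * cmod (g y))"
      proof (rule integral_mono)
        show "integrable lborel (\<lambda>y. cmod (g y * K x y))" by (rule integrable_norm[OF gK])
        show "integrable lborel (\<lambda>y. C * cmod (g y))" using g by simp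
        show "cmod (g y * K x y) \<le> C * cmod (g y)" for y
          using bound by (simp add: norm_mult mult.commute[of C] mult_left_mono)
      qed
      then show ?thesis by simp
    qed
    show "integrable lborel (\<lambda>x. LINT y|lborel. norm (case (x, y) of (x, y) \<Rightarrow> f x * (g y * K x y)))"
    proof (rule Bochner_Integration.integrable_bound[of _ "\<lambda>x. (C * (LINT y|lborel. cmod (g y))) * cmod (f x)"])
      show "integrable lborel (\<lambda>x. (C * (LINT y|lborel. cmod (g y))) * cmod (f x))" using f by simp
      show "AE x in lborel. norm (LINT y|lborel. norm (case (x, y) of (x, y) \<Rightarrow> f x * (g y * K x y)))
          \<le> norm ((C * (LINT y|lborel. cmod (g y))) * cmod (f x))"
      proof (rule AE_I2)
        fix x
        have "norm (LINT y|lborel. norm (case (x, y) of (x, y) \<Rightarrow> f x * (g y * K x y)))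
            = cmod (f x) * (LINT y|lborel. cmod (g y * K x y))"
          by (simp add: norm_mult[of "f x"])
        also have "\<dots> \<le> cmod (f x) * (C * (LINT y|lborel. cmod (g y)))"
          by (intro mult_left_mono le) simp
        also have "\<dots> \<le> norm ((C * (LINT y|lborel. cmod (g y))) * cmod (f x))"
          by (simp add: mult.commute)
        finally show "norm (LINT y|lborel. norm (case (x, y) of (x, y) \<Rightarrow> f x * (g y * K x y)))
          \<le> norm ((C * (LINT y|lborel. cmod (g y))) * cmod (f x))" .
      qed
    qed measurable
    show "AE x in lborel. integrable lborel (\<lambda>y. case (x, y) of (x, y) \<Rightarrow> f x * (g y * K x y))"
      using gK by simp
  qed
  have "(LINT x|lborel. f x * (LINT y|lborel. g y * K x y)) =
      (LINT x|lborel. (LINT y|lborel. f x * (g y * K x y)))"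
    by simp
  also have "\<dots> = (LINT y|lborel. (LINT x|lborel. f x * (g y * K x y)))"
    by (rule lborel_pair.Fubini_integral[symmetric]) (use int in simp)
  also have "\<dots> = (LINT y|lborel. (LINT x|lborel. g y * (f x * K x y)))"
    by (simp only: mult.left_commute)
  finally show "(LINT x|lborel. f x * (LINT y|lborel. g y * K x y)) =
    (LINT y|lborel. g y * (LINT x|lborel. f x * K x y))" by simp
  show "integrable lborel (\<lambda>x. f x * (LINT y|lborel. g y * K x y))"
    using lborel_pair.integrable_fst[OF int] by simp
qed

text \<open>
  The centred normal density with variance \<open>1 / n\<close> in each coordinate; it concentrates at
  the origin as \<open>n\<close> grows.
\<close>
definition heat_kernel :: "real \<Rightarrow> 'a::euclidean_space \<Rightarrow> real" where
  "heat_kernel n z = (n / (2 * pi)) powr (real DIM('a) / 2) * exp (- n * (norm z)\<^sup>2 / 2)"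

lemma heat_kernel_nonneg: "0 \<le> heat_kernel n z"
  by (simp add: heat_kernel_def)

lemma heat_kernel_measurable [measurable]: "heat_kernel n \<in> borel_measurable borel"
  unfolding heat_kernel_def[abs_def] by measurable

lemma heat_kernel_bound:
  fixes z :: "'a::euclidean_space"
  shows "n \<ge> 0 \<Longrightarrow> heat_kernel n z \<le> (n / (2 * pi)) powr (real DIM('a) / 2)"
  by (auto simp: heat_kernel_def intro!: mult_left_le)

lemma integral_heat_kernel:
  assumes "n > 0"
  shows "has_bochner_integral lborel (heat_kernel n :: 'a::euclidean_space \<Rightarrow> real) 1"
proof -
  have "has_bochner_integral lborel (\<lambda>z::'a. (n / (2 * pi)) powr (real DIM('a) / 2) * exp (- n * (norm z)\<^sup>2 / 2))
      ((n / (2 * pi)) powr (real DIM('a) / 2) * (2 * pi / n) powr (real DIM('a) / 2))"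
    by (intro has_bochner_integral_mult_right gaussian_integral assms)
  moreover have "(n / (2 * pi)) powr (real DIM('a) / 2) * (2 * pi / n) powr (real DIM('a) / 2) = 1"
    using assms by (simp flip: powr_mult)
  ultimately show ?thesis by (simp add: heat_kernel_def[abs_def])
qed

lemma heat_kernel_scale:
  fixes z :: "'a::euclidean_space"
  assumes "n > 0"
  shows "(1 / sqrt n) ^ DIM('a) * heat_kernel n ((1 / sqrt n) *\<^sub>R z) = heat_kernel 1 z"
proof -
  have "(1 / sqrt n) ^ DIM('a) = (1 / n) powr (real DIM('a) / 2)"
    using assms by (simp add: powr_half_sqrt_powr powr_realpow real_sqrt_power real_sqrt_divide)
  then have "(1 / sqrt n) ^ DIM('a) * (n / (2 * pi)) powr (real DIM('a) / 2) = (1 / (2 * pi)) powr (real DIM('a) / 2)"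
    using assms by (simp flip: powr_mult)
  moreover have "n * (norm ((1 / sqrt n) *\<^sub>R z))\<^sup>2 = (norm z)\<^sup>2"
    using assms by (simp add: power_mult_distrib power_divide)
  ultimately show ?thesis
    unfolding heat_kernel_def by (simp add: mult.assoc[symmetric])
qed

definition heat_flow :: "real \<Rightarrow> ('a::euclidean_space \<Rightarrow> complex) \<Rightarrow> 'a \<Rightarrow> complex" where
  "heat_flow n \<psi> p = (LINT q|lborel. \<psi> q * complex_of_real (heat_kernel n (p - q)))"

lemma heat_flow_measurable [measurable]:
  fixes \<psi> :: "'a::euclidean_space \<Rightarrow> complex"
  assumes [measurable]: "\<psi> \<in> borel_measurable borel"
  shows "heat_flow n \<psi> \<in> borel_measurable borel"
proof -
  have "(\<lambda>p. LINT q|lborel. \<psi> q * complex_of_real (heat_kernel n (p - q))) \<in> borel_measurable borel"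
    by measurable
  then show ?thesis by (simp add: heat_flow_def[abs_def])
qed

lemma
  fixes \<psi> :: "'a::euclidean_space \<Rightarrow> complex"
  assumes [measurable]: "\<psi> \<in> borel_measurable borel" and bound: "\<And>q. cmod (\<psi> q) \<le> C" and "n > 0"
  shows integrable_heat_flow: "integrable lborel (\<lambda>q. \<psi> q * complex_of_real (heat_kernel n (p - q)))"
    and heat_flow_bounded: "cmod (heat_flow n \<psi> p) \<le> C"
proof -
  have hk: "has_bochner_integral lborel (\<lambda>q. C * heat_kernel n (p - q)) (C * 1)"
    by (intro has_bochner_integral_mult_right has_bochner_integral_lborel_reflect
        integral_heat_kernel \<open>n > 0\<close>)
  have le: "cmod (\<psi> q * complex_of_real (heat_kernel n (p - q))) \<le> C * heat_kernel n (p - q)" for q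
    using mult_right_mono[OF bound heat_kernel_nonneg] by (simp add: norm_mult heat_kernel_nonneg)
  show int: "integrable lborel (\<lambda>q. \<psi> q * complex_of_real (heat_kernel n (p - q)))"
  proof (rule Bochner_Integration.integrable_bound)
    show "integrable lborel (\<lambda>q. C * heat_kernel n (p - q))"
      using hk by (simp only: has_bochner_integral_iff)
    show "AE q in lborel. norm (\<psi> q * complex_of_real (heat_kernel n (p - q))) \<le> norm (C * heat_kernel n (p - q))"
      by (intro AE_I2 order_trans[OF le]) simp
  qed measurable
  have "cmod (heat_flow n \<psi> p) \<le> (LINT q|lborel. cmod (\<psi> q * complex_of_real (heat_kernel n (p - q))))"
    unfolding heat_flow_def by (rule integral_norm_bound)
  also have "\<dots> \<le> (LINT q|lborel. C * heat_kernel n (p - q))"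
    using hk by (intro integral_mono integrable_norm int le) (simp only: has_bochner_integral_iff)
  also have "\<dots> = C" using hk by (simp only: has_bochner_integral_iff mult_1_right)
  finally show "cmod (heat_flow n \<psi> p) \<le> C" .
qed

text \<open>
  Rescaling by \<open>1 / sqrt n\<close> moves the parameter from the kernel into the argument of
  \<open>\<psi>\<close>, where dominated convergence applies.
\<close>
lemma heat_flow_tendsto:
  fixes \<psi> :: "'a::euclidean_space \<Rightarrow> complex"
  assumes [measurable]: "\<psi> \<in> borel_measurable borel" and bound: "\<And>q. cmod (\<psi> q) \<le> C"
    and cont: "isCont \<psi> p"
  shows "(\<lambda>n. heat_flow (real (Suc n)) \<psi> p) \<longlonglongrightarrow> \<psi> p"
proof -
  define r where "r n = 1 / sqrt (real (Suc n))" for n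
  have r: "r n > 0" for n by (simp add: r_def)
  have eq: "heat_flow (real (Suc n)) \<psi> p =
      (LINT z|lborel. \<psi> (p + (- r n) *\<^sub>R z) * complex_of_real (heat_kernel 1 z))" for n
  proof -
    define I where "I = heat_flow (real (Suc n)) \<psi> p"
    have "has_bochner_integral lborel (\<lambda>q. \<psi> q * complex_of_real (heat_kernel (real (Suc n)) (p - q))) I"
      using integrable_heat_flow[OF assms(1) bound, of "real (Suc n)" p] by (simp add: I_def heat_flow_def has_bochner_integral_iff)
    from has_bochner_integral_lborel_affine[OF _ this, of "- r n" p]
    have "has_bochner_integral lborel (\<lambda>z. r n ^ DIM('a) *\<^sub>R (\<psi> (p + (- r n) *\<^sub>R z) *
        complex_of_real (heat_kernel (real (Suc n)) (r n *\<^sub>R z)))) I"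
      using r[of n] by (auto simp: abs_of_pos)
    moreover have "r n ^ DIM('a) *\<^sub>R (\<psi> (p + (- r n) *\<^sub>R z) * complex_of_real (heat_kernel (real (Suc n)) (r n *\<^sub>R z)))
        = \<psi> (p + (- r n) *\<^sub>R z) * complex_of_real (heat_kernel 1 z)" for z
      unfolding heat_kernel_scale[of "real (Suc n)" z, symmetric, folded r_def, simplified]
      by (simp add: scaleR_conv_of_real r_def)
    ultimately have "has_bochner_integral lborel (\<lambda>z. \<psi> (p + (- r n) *\<^sub>R z) * complex_of_real (heat_kernel 1 z)) I"
      by (simp only:)
    then show ?thesis by (simp add: I_def has_bochner_integral_iff)
  qed
  have int1: "integrable lborel (heat_kernel 1 :: 'a \<Rightarrow> real)" "integral\<^sup>L lborel (heat_kernel 1 :: 'a \<Rightarrow> real) = 1"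
    using integral_heat_kernel[of 1, where 'a = 'a] by (auto simp: has_bochner_integral_iff)
  have "(\<lambda>n. LINT z|lborel. \<psi> (p + (- r n) *\<^sub>R z) * complex_of_real (heat_kernel 1 z)) \<longlonglongrightarrow>
      (LINT z|lborel. \<psi> p * complex_of_real (heat_kernel 1 (z::'a)))"
  proof (rule integral_dominated_convergence[where w = "\<lambda>z. C * heat_kernel 1 z"])
    show "AE z in lborel. (\<lambda>n. \<psi> (p + (- r n) *\<^sub>R z) * complex_of_real (heat_kernel 1 z))
        \<longlonglongrightarrow> \<psi> p * complex_of_real (heat_kernel 1 (z::'a))"
    proof (rule AE_I2)
      fix z :: 'a
      have "r \<longlonglongrightarrow> 0" unfolding r_def by real_asymp
      then have "(\<lambda>n. p + (- r n) *\<^sub>R z) \<longlonglongrightarrow> p + (- 0) *\<^sub>R z" by (intro tendsto_intros)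
      then have "(\<lambda>n. \<psi> (p + (- r n) *\<^sub>R z)) \<longlonglongrightarrow> \<psi> p"
        using cont by (intro isCont_tendsto_compose[OF cont]) simp
      then show "(\<lambda>n. \<psi> (p + (- r n) *\<^sub>R z) * complex_of_real (heat_kernel 1 z))
        \<longlonglongrightarrow> \<psi> p * complex_of_real (heat_kernel 1 (z::'a))"
        by (intro tendsto_intros)
    qed
    show "AE z in lborel. norm (\<psi> (p + (- r n) *\<^sub>R z) * complex_of_real (heat_kernel 1 z)) \<le> C * heat_kernel 1 (z::'a)" for n
      using bound by (auto simp: norm_mult heat_kernel_nonneg intro!: mult_right_mono)
  qed (use int1 in auto)
  then show ?thesis
    unfolding eq using int1 by simp
qed

text \<open>
  The measures with densities \<open>v\<close> and \<open>- v\<close>, both truncated below at zero by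
  \<open>ennreal\<close>, agree on boxes. Boxes form an intersection-stable generator, so the measures
  and hence their densities coincide.
\<close>
lemma AE_zero_if_box_integrals_zero_real:
  fixes v :: "'a::euclidean_space \<Rightarrow> real"
  assumes v: "integrable lborel v"
    and zero: "\<And>a b. (LINT x|lborel. indicator (box a b) x * v x) = 0"
  shows "AE x in lborel. v x = 0"
proof -
  have [measurable]: "v \<in> borel_measurable borel"
    using v by (auto dest: borel_measurable_integrable)
  define \<mu> where "\<mu> w = density lborel (\<lambda>x. ennreal (w x))" for w :: "'a \<Rightarrow> real"
  have em: "emeasure (\<mu> w) A = (\<integral>\<^sup>+x. ennreal (indicator A x * w x) \<partial>lborel)"
    if [measurable]: "w \<in> borel_measurable borel" "A \<in> sets borel" for w A
    by (auto simp: \<mu>_def emeasure_density indicator_def intro!: nn_integral_cong)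
  have int: "integrable lborel (\<lambda>x. indicator (box a b) x * v x)" for a b
    using integrable_mult_indicator[OF _ v, of "box a b"] by simp
  have fin: "(\<integral>\<^sup>+x. ennreal (indicator (box a b) x * w x) \<partial>lborel) \<noteq> \<infinity>"
    if "w = v \<or> w = (\<lambda>x. - v x)" for a b w
    using int[of a b] that by (auto simp: real_integrable_def)
  have eq: "emeasure (\<mu> v) (box a b) = emeasure (\<mu> (\<lambda>x. - v x)) (box a b)" for a b
  proof -
    have "enn2real (\<integral>\<^sup>+x. ennreal (indicator (box a b) x * v x) \<partial>lborel) =
        enn2real (\<integral>\<^sup>+x. ennreal (indicator (box a b) x * - v x) \<partial>lborel)"
      using zero[of a b] real_lebesgue_integral_def[OF int[of a b]] by simp
    moreover have "(\<integral>\<^sup>+x. ennreal (indicator (box a b) x * v x) \<partial>lborel) < top"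
       "(\<integral>\<^sup>+x. ennreal (indicator (box a b) x * - v x) \<partial>lborel) < top"
      using fin[of v a b] fin[of "\<lambda>x. - v x" a b] by (auto simp: less_top)
    ultimately have "(\<integral>\<^sup>+x. ennreal (indicator (box a b) x * v x) \<partial>lborel) =
        (\<integral>\<^sup>+x. ennreal (indicator (box a b) x * - v x) \<partial>lborel)"
      by (metis ennreal_enn2real)
    then show ?thesis by (simp add: em)
  qed
  have "\<mu> v = \<mu> (\<lambda>x. - v x)"
  proof (rule measure_eqI_generator_eq)
    let ?E = "range (\<lambda>(a, b). box a b::'a set)"
    show "Int_stable ?E"
      by (auto simp: Int_stable_def box_Int_box)
    show "?E \<subseteq> Pow UNIV" "sets (\<mu> v) = sigma_sets UNIV ?E" "sets (\<mu> (\<lambda>x. - v x)) = sigma_sets UNIV ?E"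
      by (simp_all add: \<mu>_def borel_eq_box)
    let ?A = "\<lambda>n::nat. box (- (real n *\<^sub>R One)) (real n *\<^sub>R One) :: 'a set"
    show "range ?A \<subseteq> ?E" "(\<Union>i. ?A i) = UNIV"
      unfolding UN_box_eq_UNIV by auto
    show "emeasure (\<mu> v) (?A i) \<noteq> \<infinity>" for i using fin by (simp add: em)
    show "emeasure (\<mu> v) X = emeasure (\<mu> (\<lambda>x. - v x)) X" if "X \<in> ?E" for X
      using that eq by auto
  qed
  then have "AE x in lborel. ennreal (v x) = ennreal (- v x)"
    unfolding \<mu>_def by (intro sigma_finite_measure.density_unique[OF sigma_finite_lborel]) auto
  then show ?thesis
  proof eventually_elim
    case (elim x)
    then show ?case by (cases "v x \<ge> 0") (auto simp: ennreal_neg ennreal_eq_0_iff)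
  qed
qed

lemma AE_zero_if_box_integrals_zero:
  fixes v :: "'a::euclidean_space \<Rightarrow> complex"
  assumes v: "integrable lborel v"
    and box_zero: "\<And>a b. (LINT x|lborel. indicator (box a b) x * v x) = 0"
  shows "AE x in lborel. v x = 0"
proof -
  have int: "integrable lborel (\<lambda>x. indicator (box a b) x * v x)" for a b
    using integrable_mult_indicator[OF _ v, of "box a b"] by (simp add: scaleR_conv_of_real of_real_indicator)
  have part: "AE x in lborel. \<rho> (v x) = 0" if \<rho>: "bounded_linear \<rho>" for \<rho> :: "complex \<Rightarrow> real"
  proof (rule AE_zero_if_box_integrals_zero_real)
    interpret bounded_linear \<rho> by (rule \<rho>)
    show "integrable lborel (\<lambda>x. \<rho> (v x))" by (rule integrable_bounded_linear[OF \<rho> v])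
    fix a b
    have "indicator (box a b) x * \<rho> (v x) = \<rho> (indicator (box a b) x * v x)" for x
      by (simp add: indicator_def zero)
    then show "(LINT x|lborel. indicator (box a b) x * \<rho> (v x)) = 0"
      using integral_bounded_linear[OF \<rho> int[of a b]] box_zero[of a b] by (simp add: zero)
  qed
  show ?thesis
    using part[OF bounded_linear_Re] part[OF bounded_linear_Im] by eventually_elim (simp add: complex_eq_iff)
qed

text \<open>
  By Fubini's theorem \<open>v\<close> is orthogonal to the heat flow of the indicator of each box.
  That flow is bounded by one and tends to the indicator off the boundary of the box, which is a null
  set.
\<close>
lemma AE_zero_if_heat_flow_zero:
  fixes v :: "'a::euclidean_space \<Rightarrow> complex"
  assumes v: "integrable lborel v"
    and zero: "\<And>n y. n > 0 \<Longrightarrow> (LINT x|lborel. v x * complex_of_real (heat_kernel n (x - y))) = 0"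
  shows "AE x in lborel. v x = 0"
proof (rule AE_zero_if_box_integrals_zero[OF v])
  fix a b :: 'a
  have [measurable]: "v \<in> borel_measurable borel"
    using v by (auto dest: borel_measurable_integrable)
  define \<zeta> where "\<zeta> x = (indicator (box a b) x :: complex)" for x
  have [measurable]: "\<zeta> \<in> borel_measurable borel" unfolding \<zeta>_def by measurable
  have \<zeta>_int: "integrable lborel \<zeta>"
  proof -
    have "integrable lborel (\<lambda>x. complex_of_real (indicator (box a b) x))"
      by (intro integrable_of_real integrable_real_indicator) (auto simp: emeasure_lborel_box_eq)
    then show ?thesis by (simp add: \<zeta>_def[abs_def] of_real_indicator)
  qed
  have \<zeta>_le: "cmod (\<zeta> q) \<le> 1" for q by (simp add: \<zeta>_def indicator_def)
  define W where "W n = heat_flow (real (Suc n)) \<zeta>" for n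
  have [measurable]: "W n \<in> borel_measurable borel" for n unfolding W_def by measurable
  have W_le: "cmod (W n x) \<le> 1" for n x
    unfolding W_def by (rule heat_flow_bounded[OF _ \<zeta>_le]) simp_all
  have W0: "(LINT x|lborel. v x * W n x) = 0" for n
  proof -
    have "(LINT x|lborel. v x * W n x) = (LINT q|lborel. \<zeta> q * (LINT x|lborel. v x * complex_of_real (heat_kernel (real (Suc n)) (x - q))))"
      unfolding W_def heat_flow_def
      by (rule Fubini_bounded_kernel(1)[OF v \<zeta>_int, where C = "(real (Suc n) / (2 * pi)) powr (real DIM('a) / 2)"])
         (use heat_kernel_bound[of "real (Suc n)"] in \<open>auto simp: heat_kernel_nonneg\<close>)
    then show ?thesis using zero[of "real (Suc n)"] by simp
  qed
  have "(\<lambda>n. LINT x|lborel. v x * W n x) \<longlonglongrightarrow> (LINT x|lborel. v x * \<zeta> x)"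
  proof (rule integral_dominated_convergence[where w = "\<lambda>x. cmod (v x)"])
    have "AE x in lborel. x \<notin> cbox a b - box a b"
      by (rule AE_not_in[OF null_sets_cbox_Diff_box])
    then show "AE x in lborel. (\<lambda>n. v x * W n x) \<longlonglongrightarrow> v x * \<zeta> x"
    proof eventually_elim
      case (elim x)
      have "isCont \<zeta> x"
      proof (cases "x \<in> box a b")
        case True
        then have "\<forall>\<^sub>F y in nhds x. y \<in> box a b" by (intro eventually_nhds_in_open open_box)
        then have "\<forall>\<^sub>F y in nhds x. \<zeta> y = 1" by eventually_elim (simp add: \<zeta>_def)
        from isCont_cong[OF this] show ?thesis by simp
      next
        case False
        then have "x \<in> - cbox a b" using elim by auto
        then have "\<forall>\<^sub>F y in nhds x. y \<in> - cbox a b"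
          by (intro eventually_nhds_in_open) auto
        then have "\<forall>\<^sub>F y in nhds x. \<zeta> y = 0"
          by eventually_elim (use box_subset_cbox[of a b] in \<open>auto simp: \<zeta>_def indicator_def\<close>)
        from isCont_cong[OF this] show ?thesis by simp
      qed
      from heat_flow_tendsto[OF _ \<zeta>_le this] have "(\<lambda>n. W n x) \<longlonglongrightarrow> \<zeta> x"
        unfolding W_def by simp
      then show ?case by (intro tendsto_intros)
    qed
    show "AE x in lborel. norm (v x * W n x) \<le> cmod (v x)" for n
      using W_le by (intro AE_I2) (simp add: norm_mult mult_left_le)
  qed (use v in auto)
  then have "(LINT x|lborel. v x * \<zeta> x) = 0"
    unfolding W0 by (simp add: LIMSEQ_const_iff)
  then show "(LINT x|lborel. indicator (box a b) x * v x) = 0"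
    by (simp add: \<zeta>_def mult.commute)
qed

section \<open>Gaussians as Schwartz functions\<close>

lemma one_plus_norm_square_pos: "0 < 1 + (norm x)\<^sup>2"
  by (simp add: add_pos_nonneg)

text \<open>
  A class of functions that is closed under partial derivatives: differentiation of the basic function
  produces coordinate factors and lowers the exponent \<open>s\<close>, which may be any real number.
  The parameter \<open>p\<close> accounts for translated Gaussians and \<open>q\<close> for modulated
  ones.
\<close>
inductive_set gauss_poly :: "'a \<Rightarrow> 'a \<Rightarrow> real \<Rightarrow> ('a::euclidean_space \<Rightarrow> complex) set"
  for p q :: 'a and a :: real where
  base: "(\<lambda>x. complex_of_real ((1 + (norm x)\<^sup>2) powr s) *
      exp (complex_of_real (p \<bullet> x - a * (norm x)\<^sup>2 / 2) + \<i> * complex_of_real (q \<bullet> x))) \<in> gauss_poly p q a"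
| coord: "f \<in> gauss_poly p q a \<Longrightarrow> (\<lambda>x. complex_of_real (x \<bullet> b) * f x) \<in> gauss_poly p q a"
| scale: "f \<in> gauss_poly p q a \<Longrightarrow> (\<lambda>x. c * f x) \<in> gauss_poly p q a"
| sum: "f \<in> gauss_poly p q a \<Longrightarrow> g \<in> gauss_poly p q a \<Longrightarrow> (\<lambda>x. f x + g x) \<in> gauss_poly p q a"

lemma gauss_poly_has_derivative:
  assumes "f \<in> gauss_poly p q a"
  shows "\<exists>D. (\<forall>x. (f has_derivative D x) (at x)) \<and> (\<forall>b. (\<lambda>x. D x b) \<in> gauss_poly p q a)"
  using assms
proof induction
  case (base s)
  define E where "E s x = complex_of_real ((1 + (norm x)\<^sup>2) powr s) *
      exp (complex_of_real (p \<bullet> x - a * (norm x)\<^sup>2 / 2) + \<i> * complex_of_real (q \<bullet> x))" for s and x :: 'a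
  define D where "D x b = complex_of_real (2 * s) * (complex_of_real (x \<bullet> b) * E (s - 1) x) +
      ((complex_of_real (p \<bullet> b) + \<i> * complex_of_real (q \<bullet> b)) * E s x +
      complex_of_real (- a) * (complex_of_real (x \<bullet> b) * E s x))" for x b
  have E: "E s \<in> gauss_poly p q a" for s
    using gauss_poly.base[of s p a q] by (simp add: E_def[abs_def])
  have nrm: "(norm x)\<^sup>2 = x \<bullet> x" for x :: 'a by (rule power2_norm_eq_inner)
  have "(E s has_derivative D x) (at x)" for x
  proof -
    have pos: "1 + x \<bullet> x > 0" by (simp add: add_pos_nonneg)
    have "((\<lambda>x. (1 + x \<bullet> x) powr s) has_derivative (\<lambda>h. s * (1 + x \<bullet> x) powr (s - 1) * (2 * (x \<bullet> h)))) (at x)"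
    proof -
      have "((\<lambda>x. 1 + x \<bullet> x) has_derivative (\<lambda>h. 2 * (x \<bullet> h))) (at x)"
        by (auto intro!: derivative_eq_intros simp: inner_commute)
      from has_derivative_powr[OF this has_derivative_const[of s], OF pos]
      show ?thesis using pos by (simp add: powr_diff mult_ac)
    qed
    then have 1: "((\<lambda>x. complex_of_real ((1 + x \<bullet> x) powr s)) has_derivative
        (\<lambda>h. complex_of_real (s * (1 + x \<bullet> x) powr (s - 1) * (2 * (x \<bullet> h))))) (at x)"
      by (rule has_derivative_of_real)
    have 2: "((\<lambda>x. complex_of_real (p \<bullet> x - a * (x \<bullet> x) / 2) + \<i> * complex_of_real (q \<bullet> x)) has_derivative
        (\<lambda>h. complex_of_real (p \<bullet> h - a * (x \<bullet> h)) + \<i> * complex_of_real (q \<bullet> h))) (at x)"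
      by (auto intro!: derivative_eq_intros simp: inner_commute)
    have 3: "((\<lambda>x. exp (complex_of_real (p \<bullet> x - a * (x \<bullet> x) / 2) + \<i> * complex_of_real (q \<bullet> x))) has_derivative
        (\<lambda>h. exp (complex_of_real (p \<bullet> x - a * (x \<bullet> x) / 2) + \<i> * complex_of_real (q \<bullet> x)) *
          (complex_of_real (p \<bullet> h - a * (x \<bullet> h)) + \<i> * complex_of_real (q \<bullet> h)))) (at x)"
      by (rule has_derivative_compose[OF 2 DERIV_exp[unfolded has_field_derivative_def]])
    show ?thesis
      unfolding E_def[abs_def] nrm
      by (rule has_derivative_eq_rhs[OF has_derivative_mult[OF 1 3]])
         (auto simp: D_def E_def nrm algebra_simps)
  qed
  moreover have "(\<lambda>x. D x b) \<in> gauss_poly p q a" for b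
    unfolding D_def by (intro gauss_poly.sum gauss_poly.scale gauss_poly.coord E)
  ultimately show ?case unfolding E_def[abs_def] by blast
next
  case (coord f b0)
  then obtain D where D: "\<And>x. (f has_derivative D x) (at x)" "\<And>b. (\<lambda>x. D x b) \<in> gauss_poly p q a"
    by blast
  show ?case
  proof (intro exI conjI allI)
    fix x b
    have "((\<lambda>x. complex_of_real (x \<bullet> b0)) has_derivative (\<lambda>h. complex_of_real (h \<bullet> b0))) (at x)"
      by (auto intro!: derivative_eq_intros)
    from has_derivative_mult[OF this D(1)]
    show "((\<lambda>x. complex_of_real (x \<bullet> b0) * f x) has_derivative
        (\<lambda>h. complex_of_real (x \<bullet> b0) * D x h + complex_of_real (h \<bullet> b0) * f x)) (at x)" .
    show "(\<lambda>x. complex_of_real (x \<bullet> b0) * D x b + complex_of_real (b \<bullet> b0) * f x) \<in> gauss_poly p q a"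
      by (intro gauss_poly.sum gauss_poly.scale gauss_poly.coord D coord.hyps)
  qed
next
  case (scale f c)
  then obtain D where D: "\<And>x. (f has_derivative D x) (at x)" "\<And>b. (\<lambda>x. D x b) \<in> gauss_poly p q a"
    by blast
  show ?case
    by (intro exI[of _ "\<lambda>x h. c * D x h"] conjI allI has_derivative_mult_right D gauss_poly.scale)
next
  case (sum f g)
  then obtain D D' where D: "\<And>x. (f has_derivative D x) (at x)" "\<And>b. (\<lambda>x. D x b) \<in> gauss_poly p q a"
    and D': "\<And>x. (g has_derivative D' x) (at x)" "\<And>b. (\<lambda>x. D' x b) \<in> gauss_poly p q a"
    by blast
  show ?case
    by (intro exI[of _ "\<lambda>x h. D x h + D' x h"] conjI allI has_derivative_add D D' gauss_poly.sum)
qed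

text \<open>
  With \<open>r = |x|\<close> each of the factors except the Gaussian one is at most exponential in
  \<open>r\<close>, and \<open>c r - a r\<^sup>2 / 2\<close> is maximal at \<open>r = c / a\<close>.
\<close>
lemma gauss_poly_bounded:
  assumes "f \<in> gauss_poly p q a" "a > 0"
  shows "bounded (range (\<lambda>x. norm x ^ N *\<^sub>R f x))"
  using assms(1)
proof (induction arbitrary: N)
  case (base s)
  define c where "c = real N + 2 * \<bar>s\<bar> + norm p"
  have "norm (norm x ^ N *\<^sub>R (complex_of_real ((1 + (norm x)\<^sup>2) powr s) *
      exp (complex_of_real (p \<bullet> x - a * (norm x)\<^sup>2 / 2) + \<i> * complex_of_real (q \<bullet> x))))
      \<le> exp (c\<^sup>2 / (2 * a))" for x :: 'a
  proof -
    define r where "r = norm x"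
    have r: "0 \<le> r" by (simp add: r_def)
    have le: "1 + r \<le> exp r" by (rule exp_ge_add_one_self)
    have "r \<le> exp r" using le by linarith
    then have "r ^ N \<le> exp r ^ N" using r by (rule power_mono)
    then have 1: "r ^ N \<le> exp (real N * r)" by (simp add: exp_of_nat_mult)
    have "(1 + r\<^sup>2) powr s \<le> (1 + r\<^sup>2) powr \<bar>s\<bar>" by (intro powr_mono) auto
    also have "\<dots> \<le> ((exp r)\<^sup>2) powr \<bar>s\<bar>"
    proof (intro powr_mono2)
      have "1 + r\<^sup>2 \<le> (1 + r)\<^sup>2" using r by (simp add: power2_eq_square algebra_simps)
      also have "\<dots> \<le> (exp r)\<^sup>2" using le r by (intro power_mono) auto
      finally show "1 + r\<^sup>2 \<le> (exp r)\<^sup>2" .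
    qed auto
    also have "\<dots> = exp (2 * \<bar>s\<bar> * r)"
      by (simp add: powr_def flip: exp_double)
    finally have 2: "(1 + r\<^sup>2) powr s \<le> exp (2 * \<bar>s\<bar> * r)" .
    have 3: "p \<bullet> x \<le> norm p * r"
      unfolding r_def by (rule norm_cauchy_schwarz)
    have "norm (norm x ^ N *\<^sub>R (complex_of_real ((1 + (norm x)\<^sup>2) powr s) *
      exp (complex_of_real (p \<bullet> x - a * (norm x)\<^sup>2 / 2) + \<i> * complex_of_real (q \<bullet> x))))
      = r ^ N * ((1 + r\<^sup>2) powr s * exp (p \<bullet> x - a * r\<^sup>2 / 2))"
      by (simp add: norm_mult r_def norm_power)
    also have "\<dots> \<le> exp (real N * r) * (exp (2 * \<bar>s\<bar> * r) * exp (norm p * r - a * r\<^sup>2 / 2))"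
      using 1 2 3 r by (intro mult_mono) auto
    also have "\<dots> = exp (c * r - a * r\<^sup>2 / 2)"
      by (simp add: c_def exp_add[symmetric] algebra_simps)
    also have "\<dots> \<le> exp (c\<^sup>2 / (2 * a))"
    proof -
      have "0 \<le> (c - a * r)\<^sup>2 / (2 * a)" using \<open>a > 0\<close> by simp
      also have "(c - a * r)\<^sup>2 / (2 * a) = c\<^sup>2 / (2 * a) - (c * r - a * r\<^sup>2 / 2)"
        using \<open>a > 0\<close> by (simp add: power2_eq_square field_simps)
      finally show ?thesis by simp
    qed
    finally show ?thesis .
  qed
  then show ?case unfolding bounded_iff by blast
next
  case (coord f b)
  obtain B where B: "\<And>x. norm (norm x ^ Suc N *\<^sub>R f x) \<le> B"
    using coord.IH[of "Suc N"] unfolding bounded_iff by blast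
  have "norm (norm x ^ N *\<^sub>R (complex_of_real (x \<bullet> b) * f x)) \<le> norm b * B" for x
  proof -
    have "norm (norm x ^ N *\<^sub>R (complex_of_real (x \<bullet> b) * f x)) = norm x ^ N * (\<bar>x \<bullet> b\<bar> * cmod (f x))"
      by (simp add: norm_mult norm_power)
    also have "\<dots> \<le> norm x ^ N * ((norm x * norm b) * cmod (f x))"
      by (intro mult_left_mono mult_right_mono Cauchy_Schwarz_ineq2) auto
    also have "\<dots> = norm b * norm (norm x ^ Suc N *\<^sub>R f x)"
      by (simp add: norm_power norm_mult mult_ac)
    also have "\<dots> \<le> norm b * B" by (intro mult_left_mono B) auto
    finally show ?thesis .
  qed
  then show ?case unfolding bounded_iff by blast
next
  case (scale f c)
  have "range (\<lambda>x. norm x ^ N *\<^sub>R (c * f x)) = (*) c ` range (\<lambda>x. norm x ^ N *\<^sub>R f x)"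
    by (auto simp: image_iff scaleR_conv_of_real mult_ac)
  then show ?case using bounded_linear_image[OF scale.IH bounded_linear_mult_right] by simp
next
  case (sum f g)
  then show ?case
    by (simp add: scaleR_add_right bounded_plus_comp)
qed

lemma gauss_poly_subset_schwartz:
  assumes "f \<in> gauss_poly p q a" "a > 0"
  shows "f \<in> schwartz"
proof -
  have *: "iter_partial bs f \<in> gauss_poly p q a" for bs
  proof (induction bs)
    case (Cons b bs)
    obtain D where D: "\<And>x. (iter_partial bs f has_derivative D x) (at x)" "(\<lambda>x. D x b) \<in> gauss_poly p q a"
      using gauss_poly_has_derivative[OF Cons.IH] by blast
    have "frechet_derivative (iter_partial bs f) (at x) = D x" for x
      using frechet_derivative_at[OF D(1)] by simp
    then show ?case using D(2) by simp
  qed (use assms in simp)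
  have "iter_partial bs f differentiable (at x)" for bs x
    using gauss_poly_has_derivative[OF *[of bs]] unfolding differentiable_def by blast
  then show ?thesis
    unfolding schwartz_def using gauss_poly_bounded[OF * assms(2)] by simp
qed

lemma schwartz_gaussian:
  fixes y :: "'a::euclidean_space"
  assumes "a > 0"
  shows "(\<lambda>x. complex_of_real (exp (- a * (norm (x - y))\<^sup>2 / 2))) \<in> schwartz"
proof -
  have "(\<lambda>x. complex_of_real (exp (- a * (norm y)\<^sup>2 / 2)) * (complex_of_real ((1 + (norm x)\<^sup>2) powr 0) *
      exp (complex_of_real ((a *\<^sub>R y) \<bullet> x - a * (norm x)\<^sup>2 / 2) + \<i> * complex_of_real (0 \<bullet> x)))) \<in> gauss_poly (a *\<^sub>R y) 0 a"
    by (intro gauss_poly.scale gauss_poly.base)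
  also have "(\<lambda>x. complex_of_real (exp (- a * (norm y)\<^sup>2 / 2)) * (complex_of_real ((1 + (norm x)\<^sup>2) powr 0) *
      exp (complex_of_real ((a *\<^sub>R y) \<bullet> x - a * (norm x)\<^sup>2 / 2) + \<i> * complex_of_real (0 \<bullet> x)))) =
      (\<lambda>x. complex_of_real (exp (- a * (norm (x - y))\<^sup>2 / 2)))"
  proof
    fix x :: 'a
    have "1 + (norm x)\<^sup>2 \<noteq> 0" using one_plus_norm_square_pos[of x] by simp
    then have one: "complex_of_real ((1 + (norm x)\<^sup>2) powr 0) = 1" by simp
    have e: "exp (complex_of_real t + \<i> * complex_of_real (0 \<bullet> x)) = complex_of_real (exp t)" for t
      by (simp only: inner_zero_left of_real_0 mult_zero_right add_0_right exp_of_real)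
    have sum: "- a * (norm y)\<^sup>2 / 2 + ((a *\<^sub>R y) \<bullet> x - a * (norm x)\<^sup>2 / 2) = - a * (norm (x - y))\<^sup>2 / 2"
      by (simp add: power2_norm_eq_inner inner_diff inner_commute algebra_simps)
    show "complex_of_real (exp (- a * (norm y)\<^sup>2 / 2)) * (complex_of_real ((1 + (norm x)\<^sup>2) powr 0) *
      exp (complex_of_real ((a *\<^sub>R y) \<bullet> x - a * (norm x)\<^sup>2 / 2) + \<i> * complex_of_real (0 \<bullet> x))) =
      complex_of_real (exp (- a * (norm (x - y))\<^sup>2 / 2))"
      unfolding one e by (simp only: mult_1 of_real_mult[symmetric] exp_add[symmetric] sum)
  qed
  finally show ?thesis by (rule gauss_poly_subset_schwartz[OF _ assms])
qed

lemma schwartz_modulated_gaussian: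
  fixes q :: "'a::euclidean_space"
  assumes "a > 0"
  shows "(\<lambda>k. complex_of_real ((1 + (norm k)\<^sup>2) powr s) *
    (exp (\<i> * complex_of_real (q \<bullet> k)) * complex_of_real (exp (- a * (norm k)\<^sup>2 / 2)))) \<in> schwartz"
proof -
  have "(\<lambda>k. complex_of_real ((1 + (norm k)\<^sup>2) powr s) *
      exp (complex_of_real (0 \<bullet> k - a * (norm k)\<^sup>2 / 2) + \<i> * complex_of_real (q \<bullet> k))) \<in> gauss_poly 0 q a"
    by (rule gauss_poly.base)
  then have "(\<lambda>k. complex_of_real ((1 + (norm k)\<^sup>2) powr s) *
      exp (complex_of_real (0 \<bullet> k - a * (norm k)\<^sup>2 / 2) + \<i> * complex_of_real (q \<bullet> k))) \<in> schwartz"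
    by (rule gauss_poly_subset_schwartz[OF _ assms])
  also have "(\<lambda>k. complex_of_real ((1 + (norm k)\<^sup>2) powr s) *
      exp (complex_of_real (0 \<bullet> k - a * (norm k)\<^sup>2 / 2) + \<i> * complex_of_real (q \<bullet> k))) =
    (\<lambda>k. complex_of_real ((1 + (norm k)\<^sup>2) powr s) *
    (exp (\<i> * complex_of_real (q \<bullet> k)) * complex_of_real (exp (- a * (norm k)\<^sup>2 / 2))))"
  proof
    fix k :: 'a
    have "exp (complex_of_real (0 \<bullet> k - a * (norm k)\<^sup>2 / 2)) = complex_of_real (exp (- a * (norm k)\<^sup>2 / 2))"
      unfolding exp_of_real by simp
    then show "complex_of_real ((1 + (norm k)\<^sup>2) powr s) *
      exp (complex_of_real (0 \<bullet> k - a * (norm k)\<^sup>2 / 2) + \<i> * complex_of_real (q \<bullet> k)) =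
      complex_of_real ((1 + (norm k)\<^sup>2) powr s) *
      (exp (\<i> * complex_of_real (q \<bullet> k)) * complex_of_real (exp (- a * (norm k)\<^sup>2 / 2)))"
      unfolding exp_add by (simp only: mult.commute)
  qed
  finally show ?thesis .
qed

lemma schwartzD:
  assumes "\<phi> \<in> schwartz"
  shows schwartz_continuous: "continuous_on UNIV \<phi>"
    and schwartz_bounded: "bounded (range (\<lambda>x. norm x ^ N *\<^sub>R \<phi> x))"
proof -
  have *: "\<forall>x. iter_partial [] \<phi> differentiable (at x)" "\<forall>N. bounded (range (\<lambda>x. norm x ^ N *\<^sub>R iter_partial [] \<phi> x))"
    using assms unfolding schwartz_def by (auto dest!: spec[of _ "[]"])
  then show "bounded (range (\<lambda>x. norm x ^ N *\<^sub>R \<phi> x))" by simp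
  show "continuous_on UNIV \<phi>"
    using *(1) by (auto intro!: continuous_at_imp_continuous_on differentiable_imp_continuous_within)
qed

lemma schwartz_measurable: "\<phi> \<in> schwartz \<Longrightarrow> \<phi> \<in> borel_measurable borel"
  by (rule borel_measurable_continuous_onI[OF schwartz_continuous])

lemma schwartz_isCont: "\<phi> \<in> schwartz \<Longrightarrow> isCont \<phi> x"
  using schwartz_continuous[of \<phi>] by (simp add: continuous_on_eq_continuous_at)

lemma schwartz_decay:
  fixes \<phi> :: "'a::euclidean_space \<Rightarrow> complex"
  assumes "\<phi> \<in> schwartz"
  shows "\<exists>C\<ge>0. \<forall>x. cmod (\<phi> x) \<le> C * (1 + (norm x)\<^sup>2) powr (- s)"
proof -
  define M where "M = nat \<lceil>s\<rceil>"
  have M: "s \<le> real M" by (simp add: M_def) linarith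
  obtain B0 where B0: "\<And>x. cmod (norm x ^ 0 *\<^sub>R \<phi> x) \<le> B0"
    using schwartz_bounded[OF assms, of 0] unfolding bounded_iff by blast
  obtain B1 where B1: "\<And>x. cmod (norm x ^ (2 * M) *\<^sub>R \<phi> x) \<le> B1"
    using schwartz_bounded[OF assms, of "2 * M"] unfolding bounded_iff by blast
  have "0 \<le> B0" "0 \<le> B1" using B0[of 0] B1[of 0] norm_ge_zero order_trans by blast+
  show ?thesis
  proof (intro exI conjI allI)
    show "0 \<le> 2 ^ M * (B0 + B1)" using \<open>0 \<le> B0\<close> \<open>0 \<le> B1\<close> by simp
    fix x :: 'a
    define r where "r = norm x"
    have pos: "1 \<le> 1 + r\<^sup>2" by simp
    have "(1 + r\<^sup>2) powr s \<le> (1 + r\<^sup>2) powr real M" by (intro powr_mono M pos)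
    also have "\<dots> = (1 + r\<^sup>2) ^ M" using pos by (intro powr_realpow) linarith
    also have "\<dots> \<le> (2 * max 1 (r\<^sup>2)) ^ M" by (intro power_mono) auto
    also have "\<dots> \<le> 2 ^ M * (1 + r ^ (2 * M))"
    proof -
      have "max 1 (r\<^sup>2) ^ M \<le> 1 + (r\<^sup>2) ^ M" by (cases "1 \<le> r\<^sup>2") (auto simp: max_def)
      then show ?thesis by (simp add: power_mult_distrib power_mult)
    qed
    finally have "cmod (\<phi> x) * (1 + r\<^sup>2) powr s \<le> cmod (\<phi> x) * (2 ^ M * (1 + r ^ (2 * M)))"
      by (intro mult_left_mono) auto
    also have "\<dots> = 2 ^ M * (cmod (norm x ^ 0 *\<^sub>R \<phi> x) + cmod (norm x ^ (2 * M) *\<^sub>R \<phi> x))"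
      by (simp add: r_def norm_power norm_mult algebra_simps)
    also have "\<dots> \<le> 2 ^ M * (B0 + B1)" by (intro mult_left_mono add_mono B0 B1) auto
    finally have "cmod (\<phi> x) \<le> 2 ^ M * (B0 + B1) / (1 + r\<^sup>2) powr s"
      using one_plus_norm_square_pos[of x] by (simp add: pos_le_divide_eq r_def)
    then show "cmod (\<phi> x) \<le> 2 ^ M * (B0 + B1) * (1 + (norm x)\<^sup>2) powr (- s)"
      by (simp add: powr_minus divide_inverse r_def)
  qed
qed

lemma schwartz_bessel_integrable:
  fixes \<phi> :: "'a::euclidean_space \<Rightarrow> complex"
  assumes "\<phi> \<in> schwartz"
  shows "integrable lborel (\<lambda>x. complex_of_real (bessel_weight l x) * \<phi> x)"
    and "\<exists>C. \<forall>x. cmod (complex_of_real (bessel_weight l x) * \<phi> x) \<le> C"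
    and "isCont (\<lambda>x. complex_of_real (bessel_weight l x) * \<phi> x) p"
proof -
  have [measurable]: "\<phi> \<in> borel_measurable borel" by (rule schwartz_measurable[OF assms])
  define D where "D = real DIM('a)"
  have D: "D > 0" by (simp add: D_def)
  obtain C where C: "0 \<le> C" "\<And>x. cmod (\<phi> x) \<le> C * (1 + (norm x)\<^sup>2) powr (- (l / 2 + D))"
    using schwartz_decay[OF assms, of "l / 2 + D"] by blast
  have le: "cmod (complex_of_real (bessel_weight l x) * \<phi> x) \<le> C * (1 + (norm x)\<^sup>2) powr (- D)" for x
  proof -
    have "cmod (complex_of_real (bessel_weight l x) * \<phi> x) = (1 + (norm x)\<^sup>2) powr (l / 2) * cmod (\<phi> x)"
      by (simp add: bessel_weight_def norm_mult)
    also have "\<dots> \<le> (1 + (norm x)\<^sup>2) powr (l / 2) * (C * (1 + (norm x)\<^sup>2) powr (- (l / 2 + D)))"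
      by (intro mult_left_mono C) auto
    also have "\<dots> = C * ((1 + (norm x)\<^sup>2) powr (l / 2) * (1 + (norm x)\<^sup>2) powr (- (l / 2 + D)))" by simp
    also have "\<dots> = C * (1 + (norm x)\<^sup>2) powr (- D)"
      by (simp only: powr_add[symmetric]) simp
    finally show ?thesis .
  qed
  have "integrable lborel (\<lambda>x::'a. C * (1 + (norm x)\<^sup>2) powr (- D))"
    using integral_bessel_weight[of D, where 'a = 'a] D by (auto simp: has_bochner_integral_iff D_def)
  then show "integrable lborel (\<lambda>x. complex_of_real (bessel_weight l x) * \<phi> x)"
    by (rule Bochner_Integration.integrable_bound)
       (use le C in \<open>auto simp: bessel_weight_def[abs_def]\<close>)
  have "cmod (complex_of_real (bessel_weight l x) * \<phi> x) \<le> C" for x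
  proof -
    have "(1 + (norm x)\<^sup>2) powr (- D) \<le> 1"
      using D by (simp add: powr_le_one_le ge_one_powr_ge_zero powr_minus inverse_le_1_iff)
    then show ?thesis using le[of x] C(1) by (meson mult_left_le order_trans)
  qed
  then show "\<exists>C. \<forall>x. cmod (complex_of_real (bessel_weight l x) * \<phi> x) \<le> C" by blast
  have "1 + (norm x)\<^sup>2 \<noteq> 0" for x :: 'a using one_plus_norm_square_pos[of x] by simp
  then have "isCont (bessel_weight l) p"
    unfolding bessel_weight_def[abs_def] by (intro continuous_intros) auto
  then show "isCont (\<lambda>x. complex_of_real (bessel_weight l x) * \<phi> x) p"
    using schwartz_isCont[OF assms] by (intro continuous_intros)
qed

section \<open>The Fourier transform of integrable functions\<close>

definition fourier_const :: "'a::euclidean_space itself \<Rightarrow> real" where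
  "fourier_const _ = (2 * pi) powr (- real DIM('a) / 2)"

lemma fourier_const_pos: "fourier_const TYPE('a::euclidean_space) > 0"
  by (simp add: fourier_const_def)

lemma fourier_eq:
  fixes f :: "'a::euclidean_space \<Rightarrow> complex"
  shows "fourier f k = complex_of_real (fourier_const TYPE('a)) *
    (LINT x|lborel. f x * exp (- \<i> * complex_of_real (k \<bullet> x)))"
  by (simp add: fourier_def fourier_const_def mult.commute)

lemma norm_fourier_kernel: "cmod (exp (- \<i> * complex_of_real t)) = 1"
  by simp

lemma fourier_measurable [measurable]:
  fixes f :: "'a::euclidean_space \<Rightarrow> complex"
  assumes [measurable]: "f \<in> borel_measurable borel"
  shows "fourier f \<in> borel_measurable borel"
proof -
  have "(\<lambda>k. complex_of_real (fourier_const TYPE('a)) *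
    (LINT x|lborel. f x * exp (- \<i> * complex_of_real (k \<bullet> x)))) \<in> borel_measurable borel"
    by measurable
  then show ?thesis by (simp add: fourier_eq[abs_def])
qed

lemma fourier_bounded:
  fixes f :: "'a::euclidean_space \<Rightarrow> complex"
  assumes "integrable lborel f"
  shows "cmod (fourier f k) \<le> fourier_const TYPE('a) * (LINT x|lborel. cmod (f x))"
proof -
  have "cmod (LINT x|lborel. f x * exp (- \<i> * complex_of_real (k \<bullet> x)))
      \<le> (LINT x|lborel. cmod (f x * exp (- \<i> * complex_of_real (k \<bullet> x))))"
    by (rule integral_norm_bound)
  also have "\<dots> = (LINT x|lborel. cmod (f x))"
    by (simp only: norm_mult norm_fourier_kernel mult_1_right)
  finally show ?thesis
    using fourier_const_pos[where 'a = 'a]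
    by (simp add: fourier_eq norm_mult mult_left_mono)
qed

lemma fourier_mult_formula:
  fixes f g :: "'a::euclidean_space \<Rightarrow> complex"
  assumes f: "integrable lborel f" and g: "integrable lborel g"
  shows "(LINT x|lborel. f x * fourier g x) = (LINT k|lborel. fourier f k * g k)"
proof -
  define c where "c = complex_of_real (fourier_const TYPE('a))"
  define K where "K x y = exp (- \<i> * complex_of_real (x \<bullet> y))" for x y :: 'a
  have [measurable]: "case_prod K \<in> borel_measurable (borel \<Otimes>\<^sub>M borel)"
    unfolding K_def by measurable
  have "(LINT x|lborel. f x * (LINT y|lborel. g y * K x y)) = (LINT y|lborel. g y * (LINT x|lborel. f x * K x y))"
    by (rule Fubini_bounded_kernel(1)[OF f g, where C = 1]) (measurable, simp add: K_def)
  then have "c * (LINT x|lborel. f x * (LINT y|lborel. g y * K x y)) = c * (LINT y|lborel. g y * (LINT x|lborel. f x * K y x))"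
    by (simp add: K_def inner_commute)
  then show ?thesis
    by (simp add: fourier_eq c_def[symmetric] K_def mult_ac flip: integral_mult_right_zero)
qed

lemma fourier_translated_gaussian:
  fixes k :: "'a::euclidean_space"
  assumes "b > 0"
  shows "fourier (\<lambda>x. complex_of_real (exp (- b * (norm (x - y))\<^sup>2 / 2))) k =
    exp (- \<i> * complex_of_real (k \<bullet> y)) * complex_of_real (b powr (- real DIM('a) / 2) * exp (- (norm k)\<^sup>2 / (2 * b)))"
proof -
  define D where "D = real DIM('a) / 2"
  define I where "I = complex_of_real ((2 * pi / b) powr D * exp (- (norm k)\<^sup>2 / (2 * b)))"
  have "has_bochner_integral lborel (\<lambda>x. exp (- \<i> * complex_of_real (k \<bullet> (x - y))) *
      complex_of_real (exp (- b * (norm (x - y))\<^sup>2 / 2))) I"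
    using has_bochner_integral_lborel_affine[OF _ gaussian_fourier_integral[OF assms, of k], of 1 "- y"]
    by (simp add: I_def D_def)
  then have I: "(LINT x|lborel. exp (- \<i> * complex_of_real (k \<bullet> (x - y))) *
      complex_of_real (exp (- b * (norm (x - y))\<^sup>2 / 2))) = I"
    by (simp add: has_bochner_integral_iff)
  have shift: "exp (- \<i> * complex_of_real (k \<bullet> x)) * complex_of_real (exp (- b * (norm (x - y))\<^sup>2 / 2)) =
    exp (- \<i> * complex_of_real (k \<bullet> y)) * (exp (- \<i> * complex_of_real (k \<bullet> (x - y))) *
      complex_of_real (exp (- b * (norm (x - y))\<^sup>2 / 2)))" for x
    unfolding mult.assoc[symmetric] exp_add[symmetric] by (simp add: inner_diff_right algebra_simps)
  have "(LINT x|lborel. exp (- \<i> * complex_of_real (k \<bullet> x)) * complex_of_real (exp (- b * (norm (x - y))\<^sup>2 / 2)))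
      = exp (- \<i> * complex_of_real (k \<bullet> y)) * I"
    unfolding shift integral_mult_right_zero I ..
  moreover have "(2 * pi) powr (- real DIM('a) / 2) * (2 * pi / b) powr D = b powr (- real DIM('a) / 2)"
    using assms by (simp add: powr_divide D_def powr_minus field_simps)
  then have "complex_of_real ((2 * pi) powr (- real DIM('a) / 2)) * I = complex_of_real (b powr (- real DIM('a) / 2) * exp (- (norm k)\<^sup>2 / (2 * b)))"
    unfolding I_def of_real_mult[symmetric] mult.assoc[symmetric] by simp
  ultimately show ?thesis
    unfolding fourier_def by (simp only: mult.left_commute)
qed

lemma fourier_modulated_gaussian:
  fixes x :: "'a::euclidean_space"
  assumes "a > 0"
  shows "fourier (\<lambda>k. exp (\<i> * complex_of_real (q \<bullet> k)) * complex_of_real (exp (- a * (norm k)\<^sup>2 / 2))) x =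
    complex_of_real (a powr (- real DIM('a) / 2) * exp (- (norm (x - q))\<^sup>2 / (2 * a)))"
proof -
  define D where "D = real DIM('a) / 2"
  have "exp (- \<i> * complex_of_real (x \<bullet> k)) * (exp (\<i> * complex_of_real (q \<bullet> k)) * complex_of_real (exp (- a * (norm k)\<^sup>2 / 2)))
      = exp (- \<i> * complex_of_real ((x - q) \<bullet> k)) * complex_of_real (exp (- a * (norm k)\<^sup>2 / 2))" for k
  proof -
    have "exp (- \<i> * complex_of_real (x \<bullet> k)) * exp (\<i> * complex_of_real (q \<bullet> k)) = exp (- \<i> * complex_of_real ((x - q) \<bullet> k))"
      by (simp add: exp_add[symmetric] inner_diff_left algebra_simps)
    then show ?thesis by (simp only: mult.assoc[symmetric])
  qed
  moreover have "(LINT k|lborel. exp (- \<i> * complex_of_real ((x - q) \<bullet> k)) * complex_of_real (exp (- a * (norm k)\<^sup>2 / 2)))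
      = complex_of_real ((2 * pi / a) powr D * exp (- (norm (x - q))\<^sup>2 / (2 * a)))"
    using gaussian_fourier_integral[OF assms, of "x - q"] by (simp only: has_bochner_integral_iff D_def)
  moreover have "(2 * pi) powr (- real DIM('a) / 2) * (2 * pi / a) powr D = a powr (- real DIM('a) / 2)"
    using assms by (simp add: powr_divide D_def powr_minus field_simps)
  ultimately show ?thesis
    unfolding fourier_def by (simp only: of_real_mult[symmetric] mult.assoc[symmetric])
qed

lemma integrable_gaussian:
  fixes y :: "'a::euclidean_space"
  assumes "b > 0"
  shows "integrable lborel (\<lambda>x. complex_of_real (exp (- b * (norm (x - y))\<^sup>2 / 2)))"
proof -
  have "integrable lborel (\<lambda>x. exp (- b * (norm (x - y))\<^sup>2 / 2))"
    using has_bochner_integral_lborel_affine[OF _ gaussian_integral[OF assms], of 1 "- y"]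
    by (simp add: has_bochner_integral_iff)
  then show ?thesis by (rule integrable_of_real)
qed

text \<open>
  \<open>fourier H (- x)\<close> is the inverse transform of \<open>H\<close>. Without the Gaussian
  factor this would be Parseval's formula for integrable functions, where the left-hand side need not
  converge. The factor makes every interchange of integrals legitimate and turns up on the right as
  the heat flow, which disappears in the limit.
\<close>
lemma fourier_gaussian_regularised:
  fixes H \<psi> :: "'a::euclidean_space \<Rightarrow> complex"
  assumes H: "integrable lborel H" and \<psi>: "integrable lborel \<psi>" and "n > 0"
  shows "(LINT x|lborel. complex_of_real (exp (- (1 / n) * (norm x)\<^sup>2 / 2)) * fourier H (- x) * fourier \<psi> x) =
    (LINT p|lborel. H p * heat_flow n \<psi> p)"
proof -
  define c where "c = fourier_const TYPE('a)"
  define g where "g x = complex_of_real (exp (- (1 / n) * (norm x)\<^sup>2 / 2))" for x :: 'a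
  have n: "1 / n > 0" using \<open>n > 0\<close> by simp
  have g_int: "integrable lborel g"
    using integrable_gaussian[OF n, of "0::'a"] by (simp add: g_def[abs_def])
  have [measurable]: "H \<in> borel_measurable borel" "\<psi> \<in> borel_measurable borel" "g \<in> borel_measurable borel"
    using H \<psi> g_int by (auto dest: borel_measurable_integrable)
  define f where "f x = g x * fourier H (- x)" for x
  have f_int: "integrable lborel f"
  proof (rule Bochner_Integration.integrable_bound)
    define B where "B = c * (LINT x|lborel. cmod (H x))"
    show "integrable lborel (\<lambda>x. g x * complex_of_real B)"
      using g_int by simp
    have "cmod (fourier H (- x)) \<le> B" for x using fourier_bounded[OF H] by (simp add: B_def c_def)
    moreover have "0 \<le> B" using order_trans[OF norm_ge_zero calculation[of 0]] .
    then have "\<bar>B\<bar> = B" by simp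
    ultimately show "AE x in lborel. norm (f x) \<le> norm (g x * complex_of_real B)"
      by (intro AE_I2) (simp add: f_def norm_mult mult_left_mono)
  qed (simp add: f_def[abs_def])
  have ff: "fourier f q = (LINT p|lborel. H p * complex_of_real (heat_kernel n (p - q)))" for q
  proof -
    define e where "e x = g x * exp (- \<i> * complex_of_real (q \<bullet> x))" for x
    define K where "K x p = exp (- \<i> * complex_of_real ((- x) \<bullet> p))" for x p :: 'a
    have [measurable]: "case_prod K \<in> borel_measurable (borel \<Otimes>\<^sub>M borel)"
      unfolding K_def by measurable
    have e_int: "integrable lborel e"
    proof (rule Bochner_Integration.integrable_bound[OF g_int])
      show "e \<in> borel_measurable lborel" unfolding e_def by measurable
    qed (simp add: e_def norm_mult)
    have inner: "(LINT x|lborel. e x * K x p) = complex_of_real ((2 * pi * n) powr (real DIM('a) / 2) * exp (- n * (norm (p - q))\<^sup>2 / 2))" for p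
    proof -
      have "e x * K x p = exp (- \<i> * complex_of_real ((q - p) \<bullet> x)) * complex_of_real (exp (- (1 / n) * (norm x)\<^sup>2 / 2))" for x
        by (simp add: e_def K_def g_def exp_add[symmetric] inner_diff_left inner_commute algebra_simps)
      moreover have "2 * pi / (1 / n) = 2 * pi * n" "- (norm (q - p))\<^sup>2 / (2 * (1 / n)) = - n * (norm (p - q))\<^sup>2 / 2"
        by (simp_all add: norm_minus_commute)
      ultimately show ?thesis
        using gaussian_fourier_integral[OF n, of "q - p"] by (simp only: has_bochner_integral_iff)
    qed
    have "fourier f q = complex_of_real c * (LINT x|lborel. e x * (complex_of_real c * (LINT p|lborel. H p * K x p)))"
      unfolding fourier_eq[of f] fourier_eq[of H] f_def e_def K_def c_def by (simp only: mult_ac)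
    also have "\<dots> = complex_of_real (c * c) * (LINT x|lborel. e x * (LINT p|lborel. H p * K x p))"
      by (simp add: mult.left_commute[of "e _"] mult.assoc)
    also have "(LINT x|lborel. e x * (LINT p|lborel. H p * K x p)) = (LINT p|lborel. H p * (LINT x|lborel. e x * K x p))"
      by (rule Fubini_bounded_kernel(1)[OF e_int H, where C = 1]) (measurable, simp add: K_def)
    also have "complex_of_real (c * c) * (LINT p|lborel. H p * (LINT x|lborel. e x * K x p))
        = (LINT p|lborel. H p * complex_of_real (heat_kernel n (p - q)))"
    proof -
      have "c * c * (2 * pi * n) powr (real DIM('a) / 2) = (n / (2 * pi)) powr (real DIM('a) / 2)"
        using \<open>n > 0\<close> by (simp add: c_def fourier_const_def powr_divide powr_mult powr_minus field_simps)
      then have hk: "heat_kernel n (p - q) = c * c * ((2 * pi * n) powr (real DIM('a) / 2) * exp (- n * (norm (p - q))\<^sup>2 / 2))" for p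
        by (simp add: heat_kernel_def mult.assoc[symmetric])
      show ?thesis
        unfolding inner hk of_real_mult[of "c * c"] mult.left_commute[of "H _"] by simp
    qed
    finally show ?thesis .
  qed
  have "(LINT x|lborel. f x * fourier \<psi> x) = (LINT q|lborel. fourier f q * \<psi> q)"
    by (rule fourier_mult_formula[OF f_int \<psi>])
  also have "\<dots> = (LINT q|lborel. \<psi> q * (LINT p|lborel. H p * complex_of_real (heat_kernel n (p - q))))"
    unfolding ff by (simp only: mult.commute)
  also have "\<dots> = (LINT p|lborel. H p * heat_flow n \<psi> p)"
    unfolding heat_flow_def
    by (rule Fubini_bounded_kernel(1)[OF H \<psi>, symmetric, where C = "(n / (2 * pi)) powr (real DIM('a) / 2)"])
       (use heat_kernel_bound[of n] \<open>n > 0\<close> in \<open>auto simp: heat_kernel_nonneg\<close>)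
  finally show ?thesis by (simp add: f_def g_def)
qed

lemma fourier_cnj:
  fixes F :: "'a::euclidean_space \<Rightarrow> complex"
  shows "fourier (\<lambda>k. cnj (F k)) x = cnj (fourier F (- x))"
proof -
  have "cnj (LINT k|lborel. F k * exp (- \<i> * complex_of_real ((- x) \<bullet> k))) =
      (LINT k|lborel. cnj (F k * exp (- \<i> * complex_of_real ((- x) \<bullet> k))))"
    by (rule Bochner_Integration.integral_cnj[symmetric])
  also have "\<dots> = (LINT k|lborel. cnj (F k) * exp (- \<i> * complex_of_real (x \<bullet> k)))"
    by (simp add: exp_cnj)
  finally show ?thesis by (simp add: fourier_eq)
qed

text \<open>
  The product \<open>|F p| |F q|\<close> is at most the mean of the squares, and the kernel has
  integral one in each variable.
\<close>
lemma young_heat_kernel: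
  fixes F :: "'a::euclidean_space \<Rightarrow> complex"
  assumes [measurable]: "F \<in> borel_measurable borel" and "n > 0"
  shows "(\<integral>\<^sup>+p. (\<integral>\<^sup>+q. ennreal (cmod (F p) * cmod (F q) * heat_kernel n (p - q)) \<partial>lborel) \<partial>lborel)
    \<le> (\<integral>\<^sup>+p. ennreal ((cmod (F p))\<^sup>2) \<partial>lborel)"
proof -
  have one: "(\<integral>\<^sup>+q. ennreal (heat_kernel n (p - q)) \<partial>lborel) = 1" for p :: 'a
    using has_bochner_integral_lborel_reflect[OF integral_heat_kernel[OF \<open>n > 0\<close>], of p]
    by (subst nn_integral_eq_integral) (auto simp: has_bochner_integral_iff heat_kernel_nonneg)
  have sym: "heat_kernel n (p - q) = heat_kernel n (q - p)" for p q :: 'a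
    by (simp add: heat_kernel_def norm_minus_commute)
  define A where "A = (\<integral>\<^sup>+p. ennreal ((cmod (F p))\<^sup>2 / 2) \<partial>lborel)"
  have "(\<integral>\<^sup>+p. (\<integral>\<^sup>+q. ennreal (cmod (F p) * cmod (F q) * heat_kernel n (p - q)) \<partial>lborel) \<partial>lborel)
      \<le> (\<integral>\<^sup>+p. (\<integral>\<^sup>+q. (ennreal ((cmod (F p))\<^sup>2 / 2) * ennreal (heat_kernel n (p - q)) +
          ennreal ((cmod (F q))\<^sup>2 / 2) * ennreal (heat_kernel n (p - q))) \<partial>lborel) \<partial>lborel)"
  proof (intro nn_integral_mono)
    fix p q
    have "cmod (F p) * cmod (F q) \<le> (cmod (F p))\<^sup>2 / 2 + (cmod (F q))\<^sup>2 / 2"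
      using zero_le_power2[of "cmod (F p) - cmod (F q)"] by (simp add: power2_diff)
    then have "cmod (F p) * cmod (F q) * heat_kernel n (p - q) \<le>
        ((cmod (F p))\<^sup>2 / 2 + (cmod (F q))\<^sup>2 / 2) * heat_kernel n (p - q)"
      by (intro mult_right_mono heat_kernel_nonneg)
    also have "\<dots> = (cmod (F p))\<^sup>2 / 2 * heat_kernel n (p - q) + (cmod (F q))\<^sup>2 / 2 * heat_kernel n (p - q)"
      by (rule distrib_right)
    finally show "ennreal (cmod (F p) * cmod (F q) * heat_kernel n (p - q)) \<le>
        ennreal ((cmod (F p))\<^sup>2 / 2) * ennreal (heat_kernel n (p - q)) +
        ennreal ((cmod (F q))\<^sup>2 / 2) * ennreal (heat_kernel n (p - q))"
      by (simp add: heat_kernel_nonneg ennreal_leI flip: ennreal_mult ennreal_plus)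
  qed
  also have "\<dots> = (\<integral>\<^sup>+p. (\<integral>\<^sup>+q. ennreal ((cmod (F p))\<^sup>2 / 2) * ennreal (heat_kernel n (p - q)) \<partial>lborel) \<partial>lborel) +
      (\<integral>\<^sup>+p. (\<integral>\<^sup>+q. ennreal ((cmod (F q))\<^sup>2 / 2) * ennreal (heat_kernel n (p - q)) \<partial>lborel) \<partial>lborel)"
    by (simp add: nn_integral_add)
  also have "(\<integral>\<^sup>+p. (\<integral>\<^sup>+q. ennreal ((cmod (F p))\<^sup>2 / 2) * ennreal (heat_kernel n (p - q)) \<partial>lborel) \<partial>lborel) = A"
    by (simp add: nn_integral_cmult one A_def)
  also have "(\<integral>\<^sup>+p. (\<integral>\<^sup>+q. ennreal ((cmod (F q))\<^sup>2 / 2) * ennreal (heat_kernel n (p - q)) \<partial>lborel) \<partial>lborel) =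
      (\<integral>\<^sup>+q. (\<integral>\<^sup>+p. ennreal ((cmod (F q))\<^sup>2 / 2) * ennreal (heat_kernel n (p - q)) \<partial>lborel) \<partial>lborel)"
    by (rule lborel_pair.Fubini') measurable
  also have "\<dots> = A"
  proof -
    have "(\<integral>\<^sup>+p. ennreal (heat_kernel n (p - q)) \<partial>lborel) = 1" for q :: 'a
      using one[of q] by (simp only: sym[of q])
    then show ?thesis by (simp add: nn_integral_cmult A_def)
  qed
  also have "A + A = (\<integral>\<^sup>+p. ennreal ((cmod (F p))\<^sup>2 / 2) + ennreal ((cmod (F p))\<^sup>2 / 2) \<partial>lborel)"
    unfolding A_def by (rule nn_integral_add[symmetric]) measurable
  also have "\<dots> = (\<integral>\<^sup>+p. ennreal ((cmod (F p))\<^sup>2) \<partial>lborel)"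
    by (intro nn_integral_cong) (simp flip: ennreal_plus)
  finally show ?thesis .
qed

text \<open>
  The inequality of Plancherel's theorem: the regularised identity for \<open>H = F\<close> and
  \<open>\<psi> = cnj F\<close> bounds the integral of \<open>|fourier F|\<^sup>2\<close> against a
  Gaussian by that of \<open>|F|\<^sup>2\<close>, and Fatou's lemma removes the Gaussian.
\<close>
lemma fourier_square_int:
  fixes F :: "'a::euclidean_space \<Rightarrow> complex"
  assumes F: "integrable lborel F" and F2: "square_int F"
  shows "square_int (\<lambda>x. fourier F (- x))"
proof -
  have [measurable]: "F \<in> borel_measurable borel"
    using F by (auto dest: borel_measurable_integrable)
  define f where "f x = fourier F (- x)" for x
  have [measurable]: "f \<in> borel_measurable borel" unfolding f_def by measurable
  define N where "N = (\<integral>\<^sup>+p. ennreal ((cmod (F p))\<^sup>2) \<partial>lborel)"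
  have N: "N < \<infinity>"
    using F2 unfolding N_def square_int_def by (simp add: integrable_iff_bounded)
  define B where "B = fourier_const TYPE('a) * (LINT x|lborel. cmod (F x))"
  have fB: "cmod (f x) \<le> B" for x using fourier_bounded[OF F] by (simp add: f_def B_def)
  have B: "0 \<le> B" using fB[of 0] norm_ge_zero order_trans by blast
  define g where "g n x = exp (- (1 / real (Suc n)) * (norm x)\<^sup>2 / 2)" for n and x :: 'a
  have [measurable]: "g n \<in> borel_measurable borel" for n unfolding g_def by measurable
  have cF: "integrable lborel (\<lambda>k. cnj (F k))" using F by simp
  then have [measurable]: "(\<lambda>k. cnj (F k)) \<in> borel_measurable borel"
    using borel_measurable_integrable[OF cF] by (simp only: measurable_lborel2)
  have le: "(\<integral>\<^sup>+x. ennreal (g n x * (cmod (f x))\<^sup>2) \<partial>lborel) \<le> N" for n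
  proof -
    have int: "integrable lborel (\<lambda>x. g n x * (cmod (f x))\<^sup>2)"
    proof (rule Bochner_Integration.integrable_bound)
      have "integrable lborel (g n)"
        using gaussian_integral[of "1 / real (Suc n)", where 'a = 'a] by (simp add: has_bochner_integral_iff g_def[abs_def])
      then show "integrable lborel (\<lambda>x. g n x * B\<^sup>2)" by simp
      show "AE x in lborel. norm (g n x * (cmod (f x))\<^sup>2) \<le> norm (g n x * B\<^sup>2)"
        using fB B by (intro AE_I2) (simp add: abs_mult power_mono mult_left_mono)
    qed measurable
    have pt: "complex_of_real (exp (- (1 / real (Suc n)) * (norm x)\<^sup>2 / 2)) * fourier F (- x) * fourier (\<lambda>k. cnj (F k)) x
        = complex_of_real (g n x * (cmod (f x))\<^sup>2)" for x
      by (simp add: fourier_cnj g_def f_def mult.assoc complex_norm_square del: of_real_power)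
    have eq: "complex_of_real (LINT x|lborel. g n x * (cmod (f x))\<^sup>2) =
        (LINT p|lborel. F p * (heat_flow (real (Suc n)) (\<lambda>k. cnj (F k)) p))"
      by (rule fourier_gaussian_regularised[OF F cF, of "real (Suc n)", unfolded pt integral_complex_of_real]) simp
    have "(\<integral>\<^sup>+x. ennreal (g n x * (cmod (f x))\<^sup>2) \<partial>lborel) = ennreal (LINT x|lborel. g n x * (cmod (f x))\<^sup>2)"
      by (rule nn_integral_eq_integral[OF int]) (simp add: g_def)
    also have "\<dots> \<le> ennreal (cmod (complex_of_real (LINT x|lborel. g n x * (cmod (f x))\<^sup>2)))"
      by (intro ennreal_leI) simp
    also have "\<dots> \<le> (\<integral>\<^sup>+p. ennreal (cmod (F p * (heat_flow (real (Suc n)) (\<lambda>k. cnj (F k)) p))) \<partial>lborel)"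
      unfolding eq by (rule integral_norm_bound_ennreal, unfold heat_flow_def)
         (rule Fubini_bounded_kernel(2)[OF F cF, where C = "(real (Suc n) / (2 * pi)) powr (real DIM('a) / 2)"];
          use heat_kernel_bound[of "real (Suc n)"] in \<open>auto simp: heat_kernel_nonneg\<close>)
    also have "\<dots> \<le> (\<integral>\<^sup>+p. (\<integral>\<^sup>+q. ennreal (cmod (F p) * cmod (F q) * heat_kernel (real (Suc n)) (p - q)) \<partial>lborel) \<partial>lborel)"
    proof (rule nn_integral_mono)
      fix p
      have hint: "integrable lborel (\<lambda>q. cnj (F q) * complex_of_real (heat_kernel (real (Suc n)) (p - q)))"
      proof (rule Bochner_Integration.integrable_bound[of _ "\<lambda>q. (real (Suc n) / (2 * pi)) powr (real DIM('a) / 2) * cmod (F q)"])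
        show "AE q in lborel. norm (cnj (F q) * complex_of_real (heat_kernel (real (Suc n)) (p - q)))
            \<le> norm ((real (Suc n) / (2 * pi)) powr (real DIM('a) / 2) * cmod (F q))"
          using heat_kernel_bound[of "real (Suc n)"]
          by (intro AE_I2) (auto simp: norm_mult heat_kernel_nonneg mult.commute[of "cmod _"] intro!: mult_right_mono)
      qed (use F in auto)
      have "ennreal (cmod (F p * (heat_flow (real (Suc n)) (\<lambda>k. cnj (F k)) p)))
          = ennreal (cmod (F p)) * ennreal (cmod (heat_flow (real (Suc n)) (\<lambda>k. cnj (F k)) p))"
        by (simp add: norm_mult ennreal_mult)
      also have "\<dots> \<le> ennreal (cmod (F p)) * (\<integral>\<^sup>+q. ennreal (cmod (cnj (F q) * complex_of_real (heat_kernel (real (Suc n)) (p - q)))) \<partial>lborel)"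
        unfolding heat_flow_def by (intro mult_left_mono integral_norm_bound_ennreal hint) simp
      also have "\<dots> = (\<integral>\<^sup>+q. ennreal (cmod (F p)) * ennreal (cmod (cnj (F q) * complex_of_real (heat_kernel (real (Suc n)) (p - q)))) \<partial>lborel)"
        by (rule nn_integral_cmult[symmetric]) measurable
      also have "\<dots> = (\<integral>\<^sup>+q. ennreal (cmod (F p) * cmod (F q) * heat_kernel (real (Suc n)) (p - q)) \<partial>lborel)"
        by (simp add: norm_mult heat_kernel_nonneg mult.assoc flip: ennreal_mult)
      finally show "ennreal (cmod (F p * (heat_flow (real (Suc n)) (\<lambda>k. cnj (F k)) p)))
          \<le> (\<integral>\<^sup>+q. ennreal (cmod (F p) * cmod (F q) * heat_kernel (real (Suc n)) (p - q)) \<partial>lborel)" .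
    qed
    also have "\<dots> \<le> N" unfolding N_def by (rule young_heat_kernel) auto
    finally show ?thesis .
  qed
  have lim: "(\<lambda>n. ennreal (g n x * (cmod (f x))\<^sup>2)) \<longlonglongrightarrow> ennreal ((cmod (f x))\<^sup>2)" for x
  proof (intro tendsto_ennrealI)
    have "(\<lambda>n. g n x) \<longlonglongrightarrow> 1" unfolding g_def by real_asymp
    from tendsto_mult[OF this tendsto_const[of "(cmod (f x))\<^sup>2"]]
    show "(\<lambda>n. g n x * (cmod (f x))\<^sup>2) \<longlonglongrightarrow> (cmod (f x))\<^sup>2" by simp
  qed
  have "(\<integral>\<^sup>+x. ennreal ((cmod (f x))\<^sup>2) \<partial>lborel) = (\<integral>\<^sup>+x. liminf (\<lambda>n. ennreal (g n x * (cmod (f x))\<^sup>2)) \<partial>lborel)"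
    by (intro nn_integral_cong) (simp add: lim_imp_Liminf[OF _ lim])
  also have "\<dots> \<le> liminf (\<lambda>n. \<integral>\<^sup>+x. ennreal (g n x * (cmod (f x))\<^sup>2) \<partial>lborel)"
    by (rule nn_integral_liminf) measurable
  also have "\<dots> \<le> N"
    using le by (intro Liminf_le) (auto simp: eventually_sequentially)
  finally have "(\<integral>\<^sup>+x. ennreal ((cmod (f x))\<^sup>2) \<partial>lborel) < \<infinity>" using N by (rule le_less_trans)
  then show ?thesis
    unfolding square_int_def f_def[symmetric] by (simp add: integrable_iff_bounded)
qed

text \<open>
  Fourier inversion in weak form, obtained from the regularised identity by dominated convergence on
  both sides. On the left the integrable majorant is a multiple of the inverse transform of
  \<open>H\<close>, on the right a multiple of \<open>H\<close>.
\<close>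
lemma fourier_duality:
  fixes H \<psi> :: "'a::euclidean_space \<Rightarrow> complex"
  assumes H: "integrable lborel H" and \<psi>: "integrable lborel \<psi>"
    and bound: "\<And>q. cmod (\<psi> q) \<le> C" and cont: "\<And>q. isCont \<psi> q"
    and u: "integrable lborel (\<lambda>x. fourier H (- x))"
  shows "(LINT x|lborel. fourier H (- x) * fourier \<psi> x) = (LINT p|lborel. H p * \<psi> p)"
proof -
  have [measurable]: "H \<in> borel_measurable borel" "\<psi> \<in> borel_measurable borel"
    using H \<psi> by (auto dest: borel_measurable_integrable)
  define g where "g n x = complex_of_real (exp (- (1 / real (Suc n)) * (norm x)\<^sup>2 / 2))" for n and x :: 'a
  have [measurable]: "g n \<in> borel_measurable borel" for n unfolding g_def by measurable
  define W where "W n = heat_flow (real (Suc n)) \<psi>" for n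
  have [measurable]: "W n \<in> borel_measurable borel" for n unfolding W_def by measurable
  define B where "B = fourier_const TYPE('a) * (LINT x|lborel. cmod (\<psi> x))"
  have B: "cmod (fourier \<psi> x) \<le> B" for x using fourier_bounded[OF \<psi>] by (simp add: B_def)
  have "(\<lambda>n. LINT x|lborel. g n x * fourier H (- x) * fourier \<psi> x) \<longlonglongrightarrow> (LINT x|lborel. fourier H (- x) * fourier \<psi> x)"
  proof (rule integral_dominated_convergence[where w = "\<lambda>x. cmod (fourier H (- x)) * B"])
    show "AE x in lborel. (\<lambda>n. g n x * fourier H (- x) * fourier \<psi> x) \<longlonglongrightarrow> fourier H (- x) * fourier \<psi> x"
    proof (rule AE_I2)
      fix x :: 'a
      have "(\<lambda>n. exp (- (1 / real (Suc n)) * (norm x)\<^sup>2 / 2)) \<longlonglongrightarrow> 1" by real_asymp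
      then have "(\<lambda>n. g n x) \<longlonglongrightarrow> complex_of_real 1" unfolding g_def by (rule tendsto_of_real)
      from tendsto_mult[OF tendsto_mult[OF this tendsto_const[of "fourier H (- x)"]] tendsto_const[of "fourier \<psi> x"]]
      show "(\<lambda>n. g n x * fourier H (- x) * fourier \<psi> x) \<longlonglongrightarrow> fourier H (- x) * fourier \<psi> x" by simp
    qed
    show "AE x in lborel. norm (g n x * fourier H (- x) * fourier \<psi> x) \<le> cmod (fourier H (- x)) * B" for n
    proof (rule AE_I2)
      fix x :: 'a
      have "cmod (g n x) \<le> 1" by (simp add: g_def)
      then have "cmod (g n x) * cmod (fourier H (- x)) * cmod (fourier \<psi> x) \<le> 1 * cmod (fourier H (- x)) * B"
        using B[of x] by (intro mult_mono) auto
      then show "norm (g n x * fourier H (- x) * fourier \<psi> x) \<le> cmod (fourier H (- x)) * B"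
        by (simp add: norm_mult)
    qed
  qed (use u in auto)
  moreover have "(LINT x|lborel. g n x * fourier H (- x) * fourier \<psi> x) = (LINT p|lborel. H p * W n p)" for n
    using fourier_gaussian_regularised[OF H \<psi>, of "real (Suc n)"] by (simp add: g_def W_def)
  moreover have "(\<lambda>n. LINT p|lborel. H p * W n p) \<longlonglongrightarrow> (LINT p|lborel. H p * \<psi> p)"
  proof (rule integral_dominated_convergence[where w = "\<lambda>p. cmod (H p) * C"])
    show "AE p in lborel. (\<lambda>n. H p * W n p) \<longlonglongrightarrow> H p * \<psi> p"
      unfolding W_def by (intro AE_I2 tendsto_intros heat_flow_tendsto[OF _ bound cont]) simp
    have "cmod (W n p) \<le> C" for n p
      unfolding W_def by (rule heat_flow_bounded[OF _ bound]) simp_all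
    then show "AE p in lborel. norm (H p * W n p) \<le> cmod (H p) * C" for n
      by (intro AE_I2) (simp add: norm_mult mult_left_mono)
  qed (use H in auto)
  ultimately show ?thesis using LIMSEQ_unique by simp
qed

text \<open>
  Multiplication by a fixed Gaussian makes \<open>u\<close> integrable, and the product of this
  Gaussian with a heat kernel is again a translated Gaussian. So the preceding uniqueness lemma
  applies to the product.
\<close>
lemma AE_zero_if_gaussian_tests_zero:
  fixes u :: "'a::euclidean_space \<Rightarrow> complex"
  assumes int: "\<And>b y. b > 0 \<Longrightarrow> integrable lborel (\<lambda>x. u x * complex_of_real (exp (- b * (norm (x - y))\<^sup>2 / 2)))"
    and zero: "\<And>b y. b > 0 \<Longrightarrow> (LINT x|lborel. u x * complex_of_real (exp (- b * (norm (x - y))\<^sup>2 / 2))) = 0"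
  shows "AE x in lborel. u x = 0"
proof -
  define v where "v x = u x * complex_of_real (exp (- 1 * (norm (x - 0))\<^sup>2 / 2))" for x
  have "AE x in lborel. v x = 0"
  proof (rule AE_zero_if_heat_flow_zero)
    show "integrable lborel v" unfolding v_def by (rule int) simp
    fix n :: real and y :: 'a
    assume n: "n > 0"
    \<comment> \<open>completing the square: the exponents \<open>|x|\<^sup>2\<close> and
      \<open>n |x - y|\<^sup>2\<close> combine to \<open>n + 1\<close> times the squared distance
      from \<open>q\<close>\<close>
    define q where "q = (n / (n + 1)) *\<^sub>R y"
    define C where "C = (n / (2 * pi)) powr (real DIM('a) / 2) * exp (- (n / (n + 1)) * (norm y)\<^sup>2 / 2)"
    have sq: "(norm x)\<^sup>2 + n * (norm (x - y))\<^sup>2 = (n + 1) * (norm (x - q))\<^sup>2 + n / (n + 1) * (norm y)\<^sup>2" for x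
    proof -
      define m where "m = n / (n + 1)"
      have m: "(n + 1) * m = n" using n by (simp add: m_def)
      have "(n + 1) * (X - 2 * m * S + m * m * Y) + m * Y =
          (n + 1) * X - 2 * ((n + 1) * m) * S + ((n + 1) * m) * (m * Y) + m * Y" for X Y S
        by (simp add: algebra_simps)
      moreover have "n * (m * Y) + m * Y = ((n + 1) * m) * Y" for Y
        by (simp add: algebra_simps)
      ultimately have "(n + 1) * (X - 2 * m * S + m * m * Y) + m * Y = (n + 1) * X - 2 * n * S + n * Y" for X Y S
        unfolding m by (simp only: add.assoc)
      from this[of "x \<bullet> x" "x \<bullet> y" "y \<bullet> y"]
      show ?thesis
        unfolding m_def[symmetric] q_def
        by (simp add: power2_norm_eq_inner inner_diff inner_commute algebra_simps)
    qed
    have "v x * complex_of_real (heat_kernel n (x - y)) =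
        complex_of_real C * (u x * complex_of_real (exp (- (n + 1) * (norm (x - q))\<^sup>2 / 2)))" for x
    proof -
      have "- ((norm x)\<^sup>2 / 2) + - (n * (norm (x - y))\<^sup>2 / 2) =
          - (n / (n + 1)) * (norm y)\<^sup>2 / 2 + - (n + 1) * (norm (x - q))\<^sup>2 / 2"
      proof -
        define m where "m = n / (n + 1)"
        have "(norm x)\<^sup>2 + n * (norm (x - y))\<^sup>2 = (n + 1) * (norm (x - q))\<^sup>2 + m * (norm y)\<^sup>2"
          using sq[of x] by (simp only: m_def)
        then show ?thesis unfolding m_def[symmetric] by (simp add: algebra_simps)
      qed
      then have "exp (- ((norm x)\<^sup>2 / 2)) * exp (- (n * (norm (x - y))\<^sup>2 / 2)) =
          exp (- (n / (n + 1)) * (norm y)\<^sup>2 / 2) * exp (- (n + 1) * (norm (x - q))\<^sup>2 / 2)"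
        by (simp only: exp_add[symmetric])
      then have "exp (- 1 * (norm (x - 0))\<^sup>2 / 2) * heat_kernel n (x - y) = C * exp (- (n + 1) * (norm (x - q))\<^sup>2 / 2)"
        by (simp add: heat_kernel_def C_def mult_ac)
      then have "complex_of_real (exp (- 1 * (norm (x - 0))\<^sup>2 / 2)) * complex_of_real (heat_kernel n (x - y)) =
          complex_of_real C * complex_of_real (exp (- (n + 1) * (norm (x - q))\<^sup>2 / 2))"
        by (simp only: of_real_mult[symmetric])
      then show ?thesis unfolding v_def mult.assoc by (simp only: mult.left_commute)
    qed
    then show "(LINT x|lborel. v x * complex_of_real (heat_kernel n (x - y))) = 0"
      using zero[of "n + 1" q] n by simp
  qed
  then show ?thesis by eventually_elim (simp add: v_def)
qed

section \<open>Sobolev spaces of functions\<close>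

lemma bessel_weight_pos: "0 < bessel_weight l (k :: 'a::euclidean_space)"
  using one_plus_norm_square_pos[of k] by (simp add: bessel_weight_def)

lemma bessel_weight_measurable [measurable]: "bessel_weight l \<in> borel_measurable borel"
  unfolding bessel_weight_def[abs_def] by measurable

lemma bessel_weight_square: "(bessel_weight l k)\<^sup>2 = (1 + (norm k)\<^sup>2) powr l"
  by (simp add: bessel_weight_def power2_eq_square flip: powr_add)

lemma square_int_integrable_mult:
  fixes f g :: "'a::euclidean_space \<Rightarrow> complex"
  assumes f: "square_int f" and g: "square_int g"
  shows "integrable lborel (\<lambda>x. f x * g x)"
proof -
  have [measurable]: "f \<in> borel_measurable borel" "g \<in> borel_measurable borel"
    using f g by (auto simp: square_int_def)
  show ?thesis
  proof (rule Bochner_Integration.integrable_bound)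
    show "integrable lborel (\<lambda>x. (cmod (f x))\<^sup>2 + (cmod (g x))\<^sup>2)"
      using f g by (intro Bochner_Integration.integrable_add) (auto simp: square_int_def)
    have "cmod (f x * g x) \<le> (cmod (f x))\<^sup>2 + (cmod (g x))\<^sup>2" for x
    proof -
      have "0 \<le> (cmod (f x) - cmod (g x))\<^sup>2 + (cmod (f x))\<^sup>2 + (cmod (g x))\<^sup>2" by simp
      then show ?thesis by (simp add: power2_diff norm_mult)
    qed
    then show "AE x in lborel. norm (f x * g x) \<le> norm ((cmod (f x))\<^sup>2 + (cmod (g x))\<^sup>2)"
      by (intro AE_I2) simp
  qed measurable
qed

lemma schwartz_square_int:
  fixes \<phi> :: "'a::euclidean_space \<Rightarrow> complex"
  assumes "\<phi> \<in> schwartz"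
  shows "square_int \<phi>"
proof -
  have [measurable]: "\<phi> \<in> borel_measurable borel" by (rule schwartz_measurable[OF assms])
  define D where "D = real DIM('a)"
  have D: "D > 0" by (simp add: D_def)
  obtain C where C: "0 \<le> C" "\<And>x. cmod (\<phi> x) \<le> C * (1 + (norm x)\<^sup>2) powr (- (D / 2))"
    using schwartz_decay[OF assms, of "D / 2"] by blast
  have "integrable lborel (\<lambda>x. (cmod (\<phi> x))\<^sup>2)"
  proof (rule Bochner_Integration.integrable_bound)
    show "integrable lborel (\<lambda>x::'a. C\<^sup>2 * (1 + (norm x)\<^sup>2) powr (- D))"
      using integral_bessel_weight[of D, where 'a = 'a] D by (auto simp: has_bochner_integral_iff D_def)
    have "(cmod (\<phi> x))\<^sup>2 \<le> C\<^sup>2 * (1 + (norm x)\<^sup>2) powr (- D)" for x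
    proof -
      have "(cmod (\<phi> x))\<^sup>2 \<le> (C * (1 + (norm x)\<^sup>2) powr (- (D / 2)))\<^sup>2"
        by (intro power_mono C) simp
      also have "\<dots> = C\<^sup>2 * ((1 + (norm x)\<^sup>2) powr (- (D / 2)) * (1 + (norm x)\<^sup>2) powr (- (D / 2)))"
        by (simp add: power2_eq_square)
      also have "\<dots> = C\<^sup>2 * (1 + (norm x)\<^sup>2) powr (- D)"
        by (simp only: powr_add[symmetric]) simp
      finally show ?thesis .
    qed
    then show "AE x in lborel. norm ((cmod (\<phi> x))\<^sup>2) \<le> norm (C\<^sup>2 * (1 + (norm x)\<^sup>2) powr (- D))"
      by (intro AE_I2) simp
  qed measurable
  then show ?thesis by (simp add: square_int_def)
qed

lemma integrable_mult_schwartz: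
  fixes f :: "'a::euclidean_space \<Rightarrow> complex"
  assumes f: "integrable lborel f" and "\<phi> \<in> schwartz"
  shows "integrable lborel (\<lambda>x. f x * \<phi> x)"
proof -
  have [measurable]: "\<phi> \<in> borel_measurable borel" by (rule schwartz_measurable[OF assms(2)])
  have [measurable]: "f \<in> borel_measurable borel" using f by (auto dest: borel_measurable_integrable)
  obtain B where B: "\<And>x. cmod (norm x ^ 0 *\<^sub>R \<phi> x) \<le> B"
    using schwartz_bounded[OF assms(2), of 0] unfolding bounded_iff by blast
  show ?thesis
  proof (rule Bochner_Integration.integrable_bound)
    show "integrable lborel (\<lambda>x. f x * complex_of_real B)" using f by simp
    have "0 \<le> B" using order_trans[OF norm_ge_zero B[of undefined]] .
    then show "AE x in lborel. norm (f x * \<phi> x) \<le> norm (f x * complex_of_real B)"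
      using B by (intro AE_I2) (simp add: norm_mult mult_left_mono)
  qed measurable
qed

lemma integrable_represents:
  fixes f :: "'a::euclidean_space \<Rightarrow> complex"
  assumes "integrable lborel f"
  shows "represents f (distr_of f)"
  using assms integrable_mult_schwartz[OF assms] borel_measurable_integrable[OF assms]
  by (simp add: represents_def distr_of_def)

text \<open>
  For an integrable function the uniform convergence contained in \<open>schwartz_null_seq\<close> is
  enough.
\<close>
lemma integrable_tempered:
  fixes f :: "'a::euclidean_space \<Rightarrow> complex"
  assumes f: "integrable lborel f"
  shows "tempered (distr_of f)"
  unfolding tempered_def
proof (intro conjI ballI allI impI)
  fix \<phi> \<psi> :: "'a \<Rightarrow> complex" assume "\<phi> \<in> schwartz" "\<psi> \<in> schwartz"
  then show "distr_of f (\<lambda>x. \<phi> x + \<psi> x) = distr_of f \<phi> + distr_of f \<psi>"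
    using integrable_mult_schwartz[OF f] by (simp add: distr_of_def distrib_left)
next
  fix \<phi> :: "'a \<Rightarrow> complex" and c
  have "f x * (c * \<phi> x) = c * (f x * \<phi> x)" for x by simp
  then show "distr_of f (\<lambda>x. c * \<phi> x) = c * distr_of f \<phi>"
    unfolding distr_of_def by (simp only: integral_mult_right_zero)
next
  fix \<phi> :: "nat \<Rightarrow> 'a \<Rightarrow> complex"
  assume \<phi>: "schwartz_null_seq \<phi>"
  then have S: "\<phi> j \<in> schwartz" for j by (simp add: schwartz_null_seq_def)
  have "\<forall>bs N. set bs \<subseteq> Basis \<longrightarrow>
        uniform_limit UNIV (\<lambda>j x. norm x ^ N *\<^sub>R iter_partial bs (\<phi> j) x) (\<lambda>x. 0) sequentially"
    using \<phi> by (simp add: schwartz_null_seq_def)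
  from this[rule_format, of "[]" 0] have ul: "uniform_limit UNIV \<phi> (\<lambda>x. 0) sequentially" by simp
  define A where "A = (LINT x|lborel. cmod (f x)) + 1"
  have A: "A > 0" unfolding A_def by (intro add_nonneg_pos Bochner_Integration.integral_nonneg) auto
  show "(\<lambda>j. distr_of f (\<phi> j)) \<longlonglongrightarrow> 0"
  proof (rule tendstoI)
    fix e :: real assume "e > 0"
    then have "e / A > 0" using A by simp
    from uniform_limitD[OF ul this]
    have "\<forall>\<^sub>F j in sequentially. \<forall>x. cmod (\<phi> j x) < e / A" by simp
    then show "\<forall>\<^sub>F j in sequentially. dist (distr_of f (\<phi> j)) 0 < e"
    proof eventually_elim
      case (elim j)
      have "cmod (distr_of f (\<phi> j)) \<le> (LINT x|lborel. cmod (f x * \<phi> j x))"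
        unfolding distr_of_def by (rule integral_norm_bound)
      also have "\<dots> \<le> (LINT x|lborel. cmod (f x) * (e / A))"
      proof (rule integral_mono)
        show "integrable lborel (\<lambda>x. cmod (f x * \<phi> j x))"
          by (rule integrable_norm[OF integrable_mult_schwartz[OF f S]])
        show "integrable lborel (\<lambda>x. cmod (f x) * (e / A))" using f by simp
        show "cmod (f x * \<phi> j x) \<le> cmod (f x) * (e / A)" for x
          unfolding norm_mult using elim by (intro mult_left_mono) (auto intro: less_imp_le)
      qed
      also have "\<dots> = (A - 1) * (e / A)" by (simp add: A_def)
      also have "\<dots> < A * (e / A)" using \<open>e / A > 0\<close> by (intro mult_strict_right_mono) auto
      also have "\<dots> = e" using A by simp
      finally show ?case by simp
    qed
  qed
qed

lemma represents_unique:
  fixes h h' :: "'a::euclidean_space \<Rightarrow> complex"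
  assumes h: "represents h T" and h': "represents h' T"
  shows "AE x in lborel. h x = h' x"
proof -
  have "AE x in lborel. h x - h' x = 0"
  proof (rule AE_zero_if_gaussian_tests_zero)
    fix b :: real and y :: 'a assume "b > 0"
    define \<phi> where "\<phi> x = complex_of_real (exp (- b * (norm (x - y))\<^sup>2 / 2))" for x
    have \<phi>: "\<phi> \<in> schwartz" using schwartz_gaussian[OF \<open>b > 0\<close>, of y] by (simp add: \<phi>_def[abs_def])
    have *: "integrable lborel (\<lambda>x. h x * \<phi> x)" "integrable lborel (\<lambda>x. h' x * \<phi> x)"
      "(LINT x|lborel. h x * \<phi> x) = (LINT x|lborel. h' x * \<phi> x)"
      using h h' \<phi> by (auto simp: represents_def)
    then show "integrable lborel (\<lambda>x. (h x - h' x) * complex_of_real (exp (- b * (norm (x - y))\<^sup>2 / 2)))"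
      "(LINT x|lborel. (h x - h' x) * complex_of_real (exp (- b * (norm (x - y))\<^sup>2 / 2))) = 0"
      unfolding \<phi>_def[symmetric] left_diff_distrib by simp_all
  qed
  then show ?thesis by eventually_elim simp
qed

lemma sobolev_distr_norm_eq:
  assumes "square_int h" "represents h (mult_distr (bessel_weight l) (fourier_distr T))"
  shows "sobolev_distr_norm l T = norm_L2 h"
  unfolding sobolev_distr_norm_def
proof (rule the_equality)
  show "\<exists>h'. square_int h' \<and> represents h' (mult_distr (bessel_weight l) (fourier_distr T)) \<and> norm_L2 h = norm_L2 h'"
    using assms by blast
next
  fix r assume "\<exists>h'. square_int h' \<and> represents h' (mult_distr (bessel_weight l) (fourier_distr T)) \<and> r = norm_L2 h'"
  then obtain h' where h': "square_int h'" "represents h' (mult_distr (bessel_weight l) (fourier_distr T))" "r = norm_L2 h'"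
    by blast
  have [measurable]: "h \<in> borel_measurable borel" "h' \<in> borel_measurable borel"
    using assms h' by (auto simp: square_int_def)
  have "AE x in lborel. h' x = h x" by (rule represents_unique[OF h'(2) assms(2)])
  then have "(LINT x|lborel. (cmod (h' x))\<^sup>2) = (LINT x|lborel. (cmod (h x))\<^sup>2)"
    by (intro integral_cong_AE) (auto elim: eventually_mono)
  then show "r = norm_L2 h" by (simp add: h' norm_L2_def)
qed

text \<open>
  The form in which membership is established below: for integrable \<open>f\<close> all conditions of
  tempered distributions hold, and only the representation of the weighted transform is left to check.
\<close>
lemma sobolevI:
  fixes f h :: "'a::euclidean_space \<Rightarrow> complex"
  assumes f: "integrable lborel f" and h: "square_int h"
    and eq: "\<And>\<phi>. \<phi> \<in> schwartz \<Longrightarrow>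
      (LINT x|lborel. f x * fourier (\<lambda>k. complex_of_real (bessel_weight l k) * \<phi> k) x) = (LINT k|lborel. h k * \<phi> k)"
  shows "f \<in> sobolev l" and "sobolev_norm l f = norm_L2 h"
proof -
  have r: "represents h (mult_distr (bessel_weight l) (fourier_distr (distr_of f)))"
    unfolding represents_def
  proof (intro conjI ballI)
    show "h \<in> borel_measurable lborel" using h by (simp add: square_int_def)
    fix \<phi> :: "'a \<Rightarrow> complex" assume \<phi>: "\<phi> \<in> schwartz"
    show "integrable lborel (\<lambda>x. h x * \<phi> x)"
      by (rule square_int_integrable_mult[OF h schwartz_square_int[OF \<phi>]])
    show "mult_distr (bessel_weight l) (fourier_distr (distr_of f)) \<phi> = (LINT x|lborel. h x * \<phi> x)"
      using eq[OF \<phi>] by (simp add: mult_distr_def fourier_distr_def distr_of_def)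
  qed
  show "f \<in> sobolev l"
    using r h integrable_represents[OF f] integrable_tempered[OF f] by (auto simp: sobolev_def sobolev_distr_def)
  show "sobolev_norm l f = norm_L2 h"
    unfolding sobolev_norm_def by (rule sobolev_distr_norm_eq[OF h r])
qed

text \<open>
  The multiplication formula moves the transform to the Gaussian, whose weighted transform is itself a
  Schwartz function.
\<close>
lemma
  assumes "\<sigma> > 0"
  shows gaussian_in_sobolev: "(gaussian \<sigma> :: 'a::euclidean_space \<Rightarrow> complex) \<in> sobolev l"
    and sobolev_norm_gaussian: "sobolev_norm l (gaussian \<sigma> :: 'a \<Rightarrow> complex) =
      sqrt (LINT k|lborel. (1 + (norm (k :: 'a))\<^sup>2) powr l * (\<sigma> powr (- real DIM('a)) * exp (- (norm k)\<^sup>2 / \<sigma>)))"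
proof -
  define g where "g = (gaussian \<sigma> :: 'a \<Rightarrow> complex)"
  have g: "g = (\<lambda>x. complex_of_real (exp (- \<sigma> * (norm (x - 0))\<^sup>2 / 2)))"
    by (simp add: g_def gaussian_def[abs_def])
  have g_int: "integrable lborel g" unfolding g by (rule integrable_gaussian[OF assms])
  have fg: "fourier g k = complex_of_real (\<sigma> powr (- real DIM('a) / 2) * exp (- (norm k)\<^sup>2 / (2 * \<sigma>)))" for k
    unfolding g fourier_translated_gaussian[OF assms] by simp
  define h where "h k = complex_of_real (bessel_weight l k) * fourier g k" for k
  have hS: "h \<in> schwartz"
  proof -
    have "h = (\<lambda>k. complex_of_real (\<sigma> powr (- real DIM('a) / 2)) * (complex_of_real ((1 + (norm k)\<^sup>2) powr (l / 2)) *
      exp (complex_of_real (0 \<bullet> k - (1 / \<sigma>) * (norm k)\<^sup>2 / 2) + \<i> * complex_of_real (0 \<bullet> k))))"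
    proof
      fix k :: 'a
      have e: "exp (complex_of_real t + \<i> * complex_of_real (0 \<bullet> k)) = complex_of_real (exp t)" for t
        by (simp only: inner_zero_left of_real_0 mult_zero_right add_0_right exp_of_real)
      have "0 \<bullet> k - (1 / \<sigma>) * (norm k)\<^sup>2 / 2 = - (norm k)\<^sup>2 / (2 * \<sigma>)" by simp
      then show "h k = complex_of_real (\<sigma> powr (- real DIM('a) / 2)) * (complex_of_real ((1 + (norm k)\<^sup>2) powr (l / 2)) *
        exp (complex_of_real (0 \<bullet> k - (1 / \<sigma>) * (norm k)\<^sup>2 / 2) + \<i> * complex_of_real (0 \<bullet> k)))"
        unfolding e by (simp only: h_def fg bessel_weight_def of_real_mult mult_ac)
    qed
    also have "\<dots> \<in> gauss_poly 0 0 (1 / \<sigma>)"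
      by (intro gauss_poly.scale gauss_poly.base)
    finally show ?thesis by (rule gauss_poly_subset_schwartz) (use assms in simp)
  qed
  have hsq: "square_int h" by (rule schwartz_square_int[OF hS])
  have "(LINT x|lborel. g x * fourier (\<lambda>k. complex_of_real (bessel_weight l k) * \<phi> k) x) = (LINT k|lborel. h k * \<phi> k)"
    if \<phi>: "\<phi> \<in> schwartz" for \<phi>
  proof -
    have "(LINT x|lborel. g x * fourier (\<lambda>k. complex_of_real (bessel_weight l k) * \<phi> k) x) =
        (LINT k|lborel. fourier g k * (complex_of_real (bessel_weight l k) * \<phi> k))"
      by (rule fourier_mult_formula[OF g_int schwartz_bessel_integrable(1)[OF \<phi>]])
    then show ?thesis by (simp add: h_def mult_ac)
  qed
  from sobolevI[OF g_int hsq this]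
  have *: "g \<in> sobolev l" "sobolev_norm l g = norm_L2 h" by blast+
  show "(gaussian \<sigma> :: 'a \<Rightarrow> complex) \<in> sobolev l" using *(1) by (simp add: g_def)
  have "(cmod (h k))\<^sup>2 = (1 + (norm k)\<^sup>2) powr l * (\<sigma> powr (- real DIM('a)) * exp (- (norm k)\<^sup>2 / \<sigma>))" for k
  proof -
    have "(\<sigma> powr (- real DIM('a) / 2))\<^sup>2 = \<sigma> powr (- real DIM('a))"
      unfolding power2_eq_square powr_add[symmetric] by simp
    moreover have "(exp (- (norm k)\<^sup>2 / (2 * \<sigma>)))\<^sup>2 = exp (- (norm k)\<^sup>2 / \<sigma>)"
      unfolding exp_double[symmetric] using assms by (simp add: field_simps)
    moreover have "(cmod (h k))\<^sup>2 = (bessel_weight l k)\<^sup>2 * ((\<sigma> powr (- real DIM('a) / 2))\<^sup>2 * (exp (- (norm k)\<^sup>2 / (2 * \<sigma>)))\<^sup>2)"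
      using bessel_weight_pos[of l k] unfolding h_def fg norm_mult norm_of_real power_mult_distrib abs_mult power2_abs by simp
    ultimately show ?thesis by (simp only: bessel_weight_square)
  qed
  then show "sobolev_norm l (gaussian \<sigma> :: 'a \<Rightarrow> complex) =
      sqrt (LINT k|lborel. (1 + (norm (k :: 'a))\<^sup>2) powr l * (\<sigma> powr (- real DIM('a)) * exp (- (norm k)\<^sup>2 / \<sigma>)))"
    using *(2) by (simp add: g_def norm_L2_def)
qed

text \<open>
  \<open>F\<close> is the representing function of the transform without its weight. It is integrable
  as a product of two square integrable functions, one of them the inverse weight, for which
  \<open>m > d / 2\<close> is required. The function \<open>f\<close> and the inverse transform of
  \<open>F\<close> have equal integrals against all translated Gaussians. For \<open>f\<close> this is
  the defining property of \<open>F\<close> with a modulated Gaussian over the weight as test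
  function; for the inverse transform it is the multiplication formula.
\<close>
lemma sobolev_fourier_representation:
  fixes f :: "'a::euclidean_space \<Rightarrow> complex"
  assumes f: "f \<in> sobolev m" and m: "m > real DIM('a) / 2"
  obtains F where "integrable lborel F" "square_int F"
    "square_int (\<lambda>k. complex_of_real (bessel_weight m k) * F k)"
    "sobolev_norm m f = norm_L2 (\<lambda>k. complex_of_real (bessel_weight m k) * F k)"
    "AE x in lborel. f x = fourier F (- x)"
proof -
  obtain h where h: "square_int h" "represents h (mult_distr (bessel_weight m) (fourier_distr (distr_of f)))"
    using f by (auto simp: sobolev_def sobolev_distr_def)
  have rf: "represents f (distr_of f)" using f by (simp add: sobolev_def)
  have [measurable]: "h \<in> borel_measurable borel" "f \<in> borel_measurable borel"
    using h rf by (auto simp: square_int_def represents_def)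
  define F where "F k = h k / complex_of_real (bessel_weight m k)" for k
  have [measurable]: "F \<in> borel_measurable borel" unfolding F_def by measurable
  have wF: "complex_of_real (bessel_weight m k) * F k = h k" for k
    using bessel_weight_pos[of m k] by (simp add: F_def)
  have m0: "m > 0" using m by (meson divide_nonneg_pos of_nat_0_le_iff le_less_trans zero_less_numeral)
  have winv: "square_int (\<lambda>k::'a. complex_of_real (1 / bessel_weight m k))"
  proof -
    have "(cmod (complex_of_real (1 / bessel_weight m k)))\<^sup>2 = (1 + (norm k)\<^sup>2) powr (- m)" for k :: 'a
      unfolding norm_of_real power2_abs power_divide bessel_weight_square by (simp add: powr_minus divide_inverse)
    moreover have "integrable lborel (\<lambda>x::'a. (1 + (norm x)\<^sup>2) powr (- m))"
      using integral_bessel_weight[OF m] by (simp add: has_bochner_integral_iff)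
    ultimately show ?thesis by (simp add: square_int_def)
  qed
  have F_int: "integrable lborel F"
    using square_int_integrable_mult[OF h(1) winv] by (simp add: F_def[abs_def])
  have F_sq: "square_int F"
  proof -
    have "integrable lborel (\<lambda>k. (cmod (F k))\<^sup>2)"
    proof (rule Bochner_Integration.integrable_bound)
      show "integrable lborel (\<lambda>k. (cmod (h k))\<^sup>2)" using h by (simp add: square_int_def)
      have "cmod (F k) \<le> cmod (h k)" for k
      proof -
        have "1 \<le> bessel_weight m k" using m0 by (simp add: bessel_weight_def ge_one_powr_ge_zero)
        then have "cmod (F k) * 1 \<le> cmod (F k) * bessel_weight m k" by (intro mult_left_mono) auto
        also have "\<dots> = cmod (h k)"
          using bessel_weight_pos[of m k] by (simp add: F_def norm_divide)
        finally show ?thesis by simp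
      qed
      then show "AE k in lborel. norm ((cmod (F k))\<^sup>2) \<le> norm ((cmod (h k))\<^sup>2)"
        by (intro AE_I2) (simp add: power_mono)
    qed measurable
    then show ?thesis by (simp add: square_int_def)
  qed
  have "AE x in lborel. f x - fourier F (- x) = 0"
  proof (rule AE_zero_if_gaussian_tests_zero)
    fix b :: real and y :: 'a assume b: "b > 0"
    define G where "G x = complex_of_real (exp (- b * (norm (x - y))\<^sup>2 / 2))" for x
    have G_S: "G \<in> schwartz" using schwartz_gaussian[OF b, of y] by (simp add: G_def[abs_def])
    have G_int: "integrable lborel G" using integrable_gaussian[OF b, of y] by (simp add: G_def[abs_def])
    \<comment> \<open>up to a constant the Fourier transform of \<open>\<psi>\<close> is \<open>G\<close>\<close>
    define \<psi> where "\<psi> k = exp (\<i> * complex_of_real (y \<bullet> k)) * complex_of_real (exp (- (1 / b) * (norm k)\<^sup>2 / 2))" for k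
    have b1: "1 / b > 0" using b by simp
    have F\<psi>: "fourier \<psi> x = complex_of_real ((1 / b) powr (- real DIM('a) / 2)) * G x" for x
      unfolding \<psi>_def fourier_modulated_gaussian[OF b1] G_def of_real_mult[symmetric] using b by (simp add: mult.commute)
    define \<phi> where "\<phi> k = complex_of_real ((1 + (norm k)\<^sup>2) powr (- m / 2)) * \<psi> k" for k
    have \<phi>_S: "\<phi> \<in> schwartz"
      unfolding \<phi>_def \<psi>_def by (rule schwartz_modulated_gaussian[OF b1])
    have w\<phi>: "complex_of_real (bessel_weight m k) * \<phi> k = \<psi> k" for k
    proof -
      have "bessel_weight m k * (1 + (norm k)\<^sup>2) powr (- m / 2) = 1"
        using one_plus_norm_square_pos[of k] unfolding bessel_weight_def powr_add[symmetric] by simp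
      then show ?thesis unfolding \<phi>_def mult.assoc[symmetric] of_real_mult[symmetric] by simp
    qed
    have h\<phi>: "h k * \<phi> k = F k * \<psi> k" for k
      by (simp only: wF[symmetric] w\<phi>[symmetric] mult_ac)
    have "(LINT x|lborel. f x * fourier \<psi> x) = (LINT k|lborel. F k * \<psi> k)"
      using h(2) \<phi>_S unfolding represents_def mult_distr_def fourier_distr_def distr_of_def
      by (auto simp: w\<phi> h\<phi>)
    then have f_eq: "complex_of_real ((1 / b) powr (- real DIM('a) / 2)) * (LINT x|lborel. f x * G x) = (LINT k|lborel. F k * \<psi> k)"
      unfolding F\<psi> mult.left_commute[of "f _"] by simp
    have tilde_int: "integrable lborel (\<lambda>x. fourier F (- x) * G x)"
    proof (rule Bochner_Integration.integrable_bound)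
      define B where "B = fourier_const TYPE('a) * (LINT x|lborel. cmod (F x))"
      show "integrable lborel (\<lambda>x. complex_of_real B * G x)" using G_int by simp
      have le: "cmod (fourier F x) \<le> B" for x using fourier_bounded[OF F_int] by (simp add: B_def)
      have "0 \<le> B" using order_trans[OF norm_ge_zero le[of 0]] .
      then show "AE x in lborel. norm (fourier F (- x) * G x) \<le> norm (complex_of_real B * G x)"
        using le by (intro AE_I2) (simp add: norm_mult mult_right_mono)
    qed (unfold G_def, measurable)
    have tilde_eq: "complex_of_real ((1 / b) powr (- real DIM('a) / 2)) * (LINT x|lborel. fourier F (- x) * G x) = (LINT k|lborel. F k * \<psi> k)"
    proof -
      define G' where "G' x = complex_of_real (exp (- b * (norm (x - (- y)))\<^sup>2 / 2))" for x
      have G'_int: "integrable lborel G'" using integrable_gaussian[OF b, of "- y"] by (simp add: G'_def[abs_def])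
      have GG': "G x = G' (- x)" for x
        unfolding G_def G'_def using norm_minus_commute[of x y] by (simp add: add.commute)
      have FG': "fourier G' k = exp (- \<i> * complex_of_real (k \<bullet> (- y))) * complex_of_real (b powr (- real DIM('a) / 2) * exp (- (norm k)\<^sup>2 / (2 * b)))" for k
        unfolding G'_def by (rule fourier_translated_gaussian[OF b])
      have "has_bochner_integral lborel (\<lambda>x. fourier F (0 - x) * G' (0 - x)) (LINT x|lborel. fourier F (- x) * G' (- x))"
        using tilde_int by (simp add: has_bochner_integral_iff GG')
      from has_bochner_integral_lborel_reflect[OF this, of 0]
      have "(LINT x|lborel. fourier F (- x) * G' (- x)) = (LINT x|lborel. G' x * fourier F x)"
        by (simp add: has_bochner_integral_iff mult.commute)
      also have "\<dots> = (LINT k|lborel. fourier G' k * F k)"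
        by (rule fourier_mult_formula[OF G'_int F_int])
      finally have 1: "(LINT x|lborel. fourier F (- x) * G x) = (LINT k|lborel. fourier G' k * F k)"
        by (simp only: GG')
      have "(1 / b) powr (- real DIM('a) / 2) * b powr (- real DIM('a) / 2) = 1"
        using b by (simp flip: powr_mult)
      then have 2: "complex_of_real ((1 / b) powr (- real DIM('a) / 2)) * (fourier G' k * F k) = F k * \<psi> k" for k
      proof -
        assume one: "(1 / b) powr (- real DIM('a) / 2) * b powr (- real DIM('a) / 2) = 1"
        have "complex_of_real ((1 / b) powr (- real DIM('a) / 2)) * complex_of_real (b powr (- real DIM('a) / 2)) = 1"
          unfolding of_real_mult[symmetric] one by simp
        moreover have "exp (- \<i> * complex_of_real (k \<bullet> (- y))) = exp (\<i> * complex_of_real (y \<bullet> k))"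
          by (simp add: inner_commute)
        moreover have "- (norm k)\<^sup>2 / (2 * b) = - (1 / b) * (norm k)\<^sup>2 / 2" by simp
        ultimately show ?thesis
          unfolding FG' \<psi>_def of_real_mult by (simp add: mult_ac)
      qed
      show ?thesis
        unfolding 1 integral_mult_right_zero[symmetric] 2 ..
    qed
    have f_int: "integrable lborel (\<lambda>x. f x * G x)"
      using rf G_S by (simp add: represents_def)
    show "integrable lborel (\<lambda>x. (f x - fourier F (- x)) * complex_of_real (exp (- b * (norm (x - y))\<^sup>2 / 2)))"
      unfolding G_def[symmetric] left_diff_distrib using f_int tilde_int by simp
    have nz: "complex_of_real ((1 / b) powr (- real DIM('a) / 2)) \<noteq> 0" using b by simp
    have "(LINT x|lborel. f x * G x) = (LINT x|lborel. fourier F (- x) * G x)"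
      by (rule iffD1[OF mult_left_cancel[OF nz] trans[OF f_eq tilde_eq[symmetric]]])
    then show "(LINT x|lborel. (f x - fourier F (- x)) * complex_of_real (exp (- b * (norm (x - y))\<^sup>2 / 2))) = 0"
      unfolding G_def[symmetric] left_diff_distrib using f_int tilde_int by simp
  qed
  then have "AE x in lborel. f x = fourier F (- x)" by eventually_elim simp
  moreover have "square_int (\<lambda>k. complex_of_real (bessel_weight m k) * F k)" "sobolev_norm m f = norm_L2 (\<lambda>k. complex_of_real (bessel_weight m k) * F k)"
    unfolding wF using h(1) sobolev_distr_norm_eq[OF h] by (simp_all add: sobolev_norm_def)
  ultimately show ?thesis using F_int F_sq by (intro that)
qed

section \<open>The product inequality\<close>

text \<open>
  With \<open>h = p - q\<close> the left-hand side is
  \<open>(1 + |h + q|\<^sup>2) (1 + |h - q|\<^sup>2)\<close>. The two squared norms are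
  \<open>A + B\<close> and \<open>A - B\<close> with \<open>A = |h|\<^sup>2 + |q|\<^sup>2\<close>, and
  the product is at most \<open>(1 + A)\<^sup>2\<close>.
\<close>
lemma weight_product_inequality:
  fixes p q :: "'a::euclidean_space"
  shows "(1 + (norm p)\<^sup>2) * (1 + (norm (p - 2 *\<^sub>R q))\<^sup>2) \<le> ((1 + (norm (p - q))\<^sup>2) * (1 + (norm q)\<^sup>2))\<^sup>2"
proof -
  define h where "h = p - q"
  define A where "A = (norm h)\<^sup>2 + (norm q)\<^sup>2"
  define B where "B = 2 * (h \<bullet> q)"
  have "p = h + q" "p - 2 *\<^sub>R q = h - q" by (simp_all add: h_def scaleR_2)
  then have n: "(norm p)\<^sup>2 = A + B" "(norm (p - 2 *\<^sub>R q))\<^sup>2 = A - B"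
    by (simp_all add: A_def B_def power2_norm_eq_inner inner_add inner_diff inner_commute)
  have "(1 + (norm p)\<^sup>2) * (1 + (norm (p - 2 *\<^sub>R q))\<^sup>2) = (1 + A)\<^sup>2 - B\<^sup>2"
    unfolding n by (simp add: power2_eq_square algebra_simps)
  also have "\<dots> \<le> (1 + A)\<^sup>2" by simp
  also have "\<dots> \<le> ((1 + (norm h)\<^sup>2) * (1 + (norm q)\<^sup>2))\<^sup>2"
  proof (rule power_mono)
    have "(1 + (norm h)\<^sup>2) * (1 + (norm q)\<^sup>2) = 1 + A + (norm h)\<^sup>2 * (norm q)\<^sup>2"
      by (simp add: A_def algebra_simps)
    then show "1 + A \<le> (1 + (norm h)\<^sup>2) * (1 + (norm q)\<^sup>2)" by simp
  qed (simp add: A_def)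
  finally show ?thesis by (simp add: h_def)
qed

lemma integrable_convolution_kernel:
  fixes F G :: "'a::euclidean_space \<Rightarrow> complex"
  assumes F: "integrable lborel F" and G: "integrable lborel G"
  shows "integrable (lborel \<Otimes>\<^sub>M lborel) (\<lambda>(q, p). G q * F (p - q))"
proof (rule lborel_pair.Fubini_integrable)
  have [measurable]: "F \<in> borel_measurable borel" "G \<in> borel_measurable borel"
    using F G by (auto dest: borel_measurable_integrable)
  have tr: "has_bochner_integral lborel (\<lambda>p. F (p - q)) (integral\<^sup>L lborel F)"
      "has_bochner_integral lborel (\<lambda>p. cmod (F (p - q))) (LINT p|lborel. cmod (F p))" for q
    using has_bochner_integral_lborel_affine[of 1 F "integral\<^sup>L lborel F" "- q"]
      has_bochner_integral_lborel_affine[of 1 "\<lambda>p. cmod (F p)" "LINT p|lborel. cmod (F p)" "- q"] F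
    by (simp_all add: has_bochner_integral_iff)
  show "(\<lambda>(q, p). G q * F (p - q)) \<in> borel_measurable (lborel \<Otimes>\<^sub>M lborel)"
    by measurable
  have "(LINT p|lborel. norm (case (q, p) of (q, p) \<Rightarrow> G q * F (p - q))) = cmod (G q) * (LINT p|lborel. cmod (F p))" for q
    using tr(2)[of q] by (simp add: norm_mult has_bochner_integral_iff)
  then show "integrable lborel (\<lambda>q. LINT p|lborel. norm (case (q, p) of (q, p) \<Rightarrow> G q * F (p - q)))"
    using G by simp
  show "AE q in lborel. integrable lborel (\<lambda>p. case (q, p) of (q, p) \<Rightarrow> G q * F (p - q))"
    using tr(1) by (intro AE_I2) (auto simp: has_bochner_integral_iff)
qed

lemma fourier_convolution:
  fixes F G :: "'a::euclidean_space \<Rightarrow> complex"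
  assumes F: "integrable lborel F" and G: "integrable lborel G"
  defines "H \<equiv> \<lambda>p. complex_of_real (fourier_const TYPE('a)) * (LINT q|lborel. G q * F (p - q))"
  shows "integrable lborel H" and "fourier H k = fourier F k * fourier G k"
proof -
  have [measurable]: "F \<in> borel_measurable borel" "G \<in> borel_measurable borel"
    using F G by (auto dest: borel_measurable_integrable)
  note int = integrable_convolution_kernel[OF F G]
  show "integrable lborel H"
    unfolding H_def using lborel_pair.integrable_snd[OF int] by simp
  define c where "c = complex_of_real (fourier_const TYPE('a))"
  define e where "e p = exp (- \<i> * complex_of_real (k \<bullet> p))" for p :: 'a
  have [measurable]: "e \<in> borel_measurable borel" unfolding e_def by measurable
  have e1: "cmod (e p) = 1" for p by (simp add: e_def)
  have e_add: "e p = e q * e (p - q)" for p q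
    unfolding e_def exp_add[symmetric] by (simp add: inner_diff_right algebra_simps)
  have int': "integrable (lborel \<Otimes>\<^sub>M lborel) (\<lambda>(q, p). G q * F (p - q) * e p)"
  proof (rule Bochner_Integration.integrable_bound[OF int])
    show "(\<lambda>(q, p). G q * F (p - q) * e p) \<in> borel_measurable (lborel \<Otimes>\<^sub>M lborel)"
      by measurable
  qed (auto simp: norm_mult e1)
  have inner: "(LINT p|lborel. G q * F (p - q) * e p) = (G q * e q) * (LINT p|lborel. F p * e p)" for q
  proof -
    have Fe: "integrable lborel (\<lambda>p. F p * e p)"
    proof (rule Bochner_Integration.integrable_bound[OF F])
      show "(\<lambda>p. F p * e p) \<in> borel_measurable lborel" by measurable
    qed (simp add: norm_mult e1)
    then have "has_bochner_integral lborel (\<lambda>p. F p * e p) (LINT p|lborel. F p * e p)"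
      by (simp add: has_bochner_integral_iff)
    from has_bochner_integral_lborel_affine[OF _ this, of 1 "- q"]
    have "(LINT p|lborel. F (p - q) * e (p - q)) = (LINT p|lborel. F p * e p)"
      by (simp add: has_bochner_integral_iff)
    moreover have "G q * F (p - q) * e p = (G q * e q) * (F (p - q) * e (p - q))" for p
      by (subst e_add[of p q]) (simp only: mult_ac)
    ultimately show ?thesis by (simp only: integral_mult_right_zero)
  qed
  have He: "H p * e p = c * (LINT q|lborel. G q * F (p - q) * e p)" for p
    unfolding integral_mult_left_zero H_def c_def[symmetric] by (rule mult.assoc)
  have "(LINT p|lborel. H p * e p) = c * (LINT p|lborel. (LINT q|lborel. G q * F (p - q) * e p))"
    unfolding He by (rule integral_mult_right_zero)
  also have "(LINT p|lborel. (LINT q|lborel. G q * F (p - q) * e p)) = (LINT q|lborel. (LINT p|lborel. G q * F (p - q) * e p))"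
    by (rule lborel_pair.Fubini_integral[OF int'])
  also have "\<dots> = (LINT q|lborel. G q * e q) * (LINT p|lborel. F p * e p)"
    unfolding inner by simp
  finally show "fourier H k = fourier F k * fourier G k"
    unfolding fourier_eq c_def[symmetric] e_def[symmetric] by (simp add: mult_ac)
qed

text \<open>
  The square root of \<open>(2 \<pi>) powr (- d)\<close> times the integral of
  \<open>(1 + |2 q|\<^sup>2) powr (- l)\<close> over \<open>q\<close>.
\<close>
definition product_const :: "'a::euclidean_space itself \<Rightarrow> real \<Rightarrow> real" where
  "product_const _ l = sqrt ((16 * pi) powr (- real DIM('a) / 2) * Gamma (l - real DIM('a) / 2) / Gamma l)"

lemma convolution_weight_integral:
  fixes p :: "'a::euclidean_space"
  assumes l: "l > real DIM('a) / 2"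
  shows "(\<integral>\<^sup>+q. ennreal ((1 + (norm p)\<^sup>2) powr l * (1 / (bessel_weight (2 * l) (p - q) * bessel_weight (2 * l) q))\<^sup>2) \<partial>lborel)
    \<le> ennreal ((4 * pi) powr (real DIM('a) / 2) * (16 :: real) powr (- real DIM('a) / 2) * Gamma (l - real DIM('a) / 2) / Gamma l)"
proof -
  define D where "D = real DIM('a) / 2"
  have l0: "l > 0" using l by (meson divide_nonneg_pos of_nat_0_le_iff le_less_trans zero_less_numeral)
  have "(1 + (norm p)\<^sup>2) powr l * (1 / (bessel_weight (2 * l) (p - q) * bessel_weight (2 * l) q))\<^sup>2
      \<le> (1 + (norm (p + (- 2) *\<^sub>R q))\<^sup>2) powr (- l)" for q
  proof -
    define a where "a = 1 + (norm p)\<^sup>2"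
    define b where "b = 1 + (norm (p - 2 *\<^sub>R q))\<^sup>2"
    define r where "r = (1 + (norm (p - q))\<^sup>2) * (1 + (norm q)\<^sup>2)"
    have pos: "0 < a" "0 < b" "0 < r" unfolding a_def b_def r_def by (simp_all add: one_plus_norm_square_pos)
    have "(bessel_weight (2 * l) (p - q) * bessel_weight (2 * l) q)\<^sup>2 = r powr (2 * l)"
      unfolding power_mult_distrib bessel_weight_square r_def by (simp add: powr_mult)
    also have "\<dots> = (r\<^sup>2) powr l"
      using pos by (simp add: powr_powr flip: powr_numeral)
    finally have w: "(bessel_weight (2 * l) (p - q) * bessel_weight (2 * l) q)\<^sup>2 = (r\<^sup>2) powr l" .
    have "(a * b) powr l \<le> (r\<^sup>2) powr l"
      using weight_product_inequality[of p q] l0 pos unfolding a_def b_def r_def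
      by (intro powr_mono2) auto
    then have "a powr l * b powr l \<le> (r\<^sup>2) powr l" using pos by (simp add: powr_mult)
    then have "a powr l / (r\<^sup>2) powr l \<le> 1 / b powr l"
      using pos by (simp add: field_simps)
    then show ?thesis
      unfolding power_divide w a_def[symmetric] using pos by (simp add: b_def powr_minus divide_inverse)
  qed
  then have "(\<integral>\<^sup>+q. ennreal ((1 + (norm p)\<^sup>2) powr l * (1 / (bessel_weight (2 * l) (p - q) * bessel_weight (2 * l) q))\<^sup>2) \<partial>lborel)
      \<le> (\<integral>\<^sup>+q. ennreal ((1 + (norm (p + (- 2) *\<^sub>R q))\<^sup>2) powr (- l)) \<partial>lborel)"
    by (intro nn_integral_mono ennreal_leI)
  also have "\<dots> = ennreal (1 / 2 ^ DIM('a)) * (ennreal (2 ^ DIM('a)) * (\<integral>\<^sup>+q. ennreal ((1 + (norm (p + (- 2) *\<^sub>R q))\<^sup>2) powr (- l)) \<partial>lborel))"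
    unfolding mult.assoc[symmetric] by (simp flip: ennreal_mult)
  also have "ennreal (2 ^ DIM('a)) * (\<integral>\<^sup>+q. ennreal ((1 + (norm (p + (- 2) *\<^sub>R q))\<^sup>2) powr (- l)) \<partial>lborel) =
      (\<integral>\<^sup>+x. ennreal ((1 + (norm (x::'a))\<^sup>2) powr (- l)) \<partial>lborel)"
    using nn_integral_lborel_affine[of "- 2" "\<lambda>x::'a. ennreal ((1 + (norm x)\<^sup>2) powr (- l))" p] by simp
  also have "\<dots> = ennreal (pi powr D * Gamma (l - D) / Gamma l)"
    unfolding D_def by (rule nn_integral_bessel_weight[OF l])
  also have "ennreal (1 / 2 ^ DIM('a)) * ennreal (pi powr D * Gamma (l - D) / Gamma l) =
      ennreal ((4 * pi) powr D * 16 powr (- D) * Gamma (l - D) / Gamma l)"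
  proof -
    have "(4::real) powr D * 16 powr (- D) = 1 / 2 ^ DIM('a)"
    proof -
      have "(4::real) powr D = 2 ^ DIM('a)"
        using powr_powr[of 2 2 D] by (simp add: D_def powr_realpow)
      moreover have "(16::real) powr D = 4 ^ DIM('a)"
        using powr_powr[of 4 2 D] by (simp add: D_def powr_realpow)
      moreover have "(4::real) ^ DIM('a) = 2 ^ DIM('a) * 2 ^ DIM('a)" by (simp flip: power_mult_distrib)
      ultimately show ?thesis by (simp add: powr_minus divide_inverse)
    qed
    moreover have "(4 * pi) powr D * 16 powr (- D) = (4 powr D * 16 powr (- D)) * pi powr D"
      by (simp add: powr_mult)
    ultimately have "(4 * pi) powr D * 16 powr (- D) = 1 / 2 ^ DIM('a) * pi powr D"
      by (simp only:)
    then show ?thesis using l l0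
      by (simp add: D_def ennreal_mult[symmetric])
  qed
  finally show ?thesis by (simp add: D_def)
qed

text \<open>
  The Cauchy-Schwarz inequality separates the weighted transforms from the weights. The weights
  contribute a factor that is bounded uniformly in \<open>p\<close>, and the integral of the
  convolution of the squares is the product of their integrals.
\<close>
lemma weighted_convolution_bound:
  fixes F G :: "'a::euclidean_space \<Rightarrow> complex"
  assumes l: "l > real DIM('a) / 2" and F: "integrable lborel F" and G: "integrable lborel G"
    and hF: "square_int (\<lambda>k. complex_of_real (bessel_weight (2 * l) k) * F k)"
    and hG: "square_int (\<lambda>k. complex_of_real (bessel_weight (2 * l) k) * G k)"
  defines "H \<equiv> \<lambda>p. complex_of_real (fourier_const TYPE('a)) * (LINT q|lborel. G q * F (p - q))"
  shows "square_int (\<lambda>p. complex_of_real (bessel_weight l p) * H p)"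
    and "norm_L2 (\<lambda>p. complex_of_real (bessel_weight l p) * H p) \<le> product_const TYPE('a) l *
      norm_L2 (\<lambda>k. complex_of_real (bessel_weight (2 * l) k) * F k) *
      norm_L2 (\<lambda>k. complex_of_real (bessel_weight (2 * l) k) * G k)"
proof -
  define D where "D = real DIM('a) / 2"
  have l0: "l > 0" using l by (meson divide_nonneg_pos of_nat_0_le_iff le_less_trans zero_less_numeral)
  define c where "c = fourier_const TYPE('a)"
  have c: "c > 0" unfolding c_def by (rule fourier_const_pos)
  define w where "w = (bessel_weight (2 * l) :: 'a \<Rightarrow> real)"
  have w: "0 < w k" for k unfolding w_def by (rule bessel_weight_pos)
  define f where "f k = w k * cmod (F k)" for k
  define g where "g k = w k * cmod (G k)" for k
  have [measurable]: "F \<in> borel_measurable borel" "G \<in> borel_measurable borel"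
    using F G by (auto dest: borel_measurable_integrable)
  have [measurable]: "w \<in> borel_measurable borel" unfolding w_def by measurable
  have [measurable]: "f \<in> borel_measurable borel" "g \<in> borel_measurable borel"
    unfolding f_def g_def by measurable
  have fg0: "0 \<le> f k" "0 \<le> g k" for k using w[of k] by (auto simp: f_def g_def)
  have H_int: "integrable lborel H"
    unfolding H_def by (rule fourier_convolution(1)[OF F G])
  then have [measurable]: "H \<in> borel_measurable borel" by (auto dest: borel_measurable_integrable)
  define h where "h p = complex_of_real (bessel_weight l p) * H p" for p
  have [measurable]: "h \<in> borel_measurable borel" unfolding h_def by measurable
  define J where "J = (4 * pi) powr D * 16 powr (- D) * Gamma (l - D) / Gamma l"
  have J: "0 \<le> J" using l l0 by (simp add: J_def D_def)
  define f2 where "f2 = (LINT k|lborel. (f k)\<^sup>2)"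
  define g2 where "g2 = (LINT k|lborel. (g k)\<^sup>2)"
  have f2_eq: "(cmod (complex_of_real (bessel_weight (2 * l) k) * F k))\<^sup>2 = (f k)\<^sup>2" for k
    using w[of k] by (simp add: f_def w_def norm_mult)
  have g2_eq: "(cmod (complex_of_real (bessel_weight (2 * l) k) * G k))\<^sup>2 = (g k)\<^sup>2" for k
    using w[of k] by (simp add: g_def w_def norm_mult)
  have f2: "integrable lborel (\<lambda>k. (f k)\<^sup>2)" using hF unfolding square_int_def f2_eq by simp
  have g2: "integrable lborel (\<lambda>k. (g k)\<^sup>2)" using hG unfolding square_int_def g2_eq by simp
  have f2n: "(\<integral>\<^sup>+k. ennreal ((f k)\<^sup>2) \<partial>lborel) = ennreal f2" unfolding f2_def by (rule nn_integral_eq_integral[OF f2]) simp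
  have g2n: "(\<integral>\<^sup>+k. ennreal ((g k)\<^sup>2) \<partial>lborel) = ennreal g2" unfolding g2_def by (rule nn_integral_eq_integral[OF g2]) simp
  have fg2: "0 \<le> f2" "0 \<le> g2" unfolding f2_def g2_def by (auto intro: Bochner_Integration.integral_nonneg)
  have pt: "ennreal ((cmod (h p))\<^sup>2) \<le> ennreal (c\<^sup>2 * J) * (\<integral>\<^sup>+q. ennreal ((f (p - q))\<^sup>2 * (g q)\<^sup>2) \<partial>lborel)" for p
  proof -
    define a where "a q = ennreal (f (p - q) * g q)" for q
    define b where "b q = ennreal (1 / (w (p - q) * w q))" for q
    have [measurable]: "a \<in> borel_measurable borel" "b \<in> borel_measurable borel"
      unfolding a_def b_def by measurable
    have Hle: "ennreal (cmod (H p)) \<le> ennreal c * (\<integral>\<^sup>+q. a q * b q \<partial>lborel)"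
    proof (cases "integrable lborel (\<lambda>q. G q * F (p - q))")
      case True
      have ab: "ennreal (cmod (G q * F (p - q))) = a q * b q" for q
      proof -
        have "cmod (G q * F (p - q)) = (f (p - q) * g q) * (1 / (w (p - q) * w q))"
          using w[of "p - q"] w[of q] by (simp add: f_def g_def norm_mult)
        moreover have "0 \<le> 1 / (w (p - q) * w q)" using w[of "p - q"] w[of q] by simp
        ultimately show ?thesis
          unfolding a_def b_def by (simp only: ennreal_mult[symmetric] fg0 mult_nonneg_nonneg)
      qed
      have "ennreal (cmod (H p)) = ennreal c * ennreal (cmod (LINT q|lborel. G q * F (p - q)))"
        using c by (simp add: H_def c_def[symmetric] norm_mult ennreal_mult)
      also have "\<dots> \<le> ennreal c * (\<integral>\<^sup>+q. ennreal (cmod (G q * F (p - q))) \<partial>lborel)"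
        by (intro mult_left_mono integral_norm_bound_ennreal True) simp
      finally show ?thesis unfolding ab .
    next
      case False
      then show ?thesis by (simp add: H_def not_integrable_integral_eq)
    qed
    have "ennreal ((cmod (h p))\<^sup>2) = ennreal ((1 + (norm p)\<^sup>2) powr l) * (ennreal (cmod (H p)))\<^sup>2"
      by (simp add: h_def norm_mult power_mult_distrib bessel_weight_square ennreal_mult ennreal_power)
    also have "\<dots> \<le> ennreal ((1 + (norm p)\<^sup>2) powr l) * (ennreal c * (\<integral>\<^sup>+q. a q * b q \<partial>lborel))\<^sup>2"
      by (intro mult_left_mono power_mono Hle) auto
    also have "\<dots> = ennreal ((1 + (norm p)\<^sup>2) powr l) * (ennreal (c\<^sup>2) * (\<integral>\<^sup>+q. a q * b q \<partial>lborel)\<^sup>2)"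
      using c by (simp add: power_mult_distrib ennreal_power)
    also have "\<dots> \<le> ennreal ((1 + (norm p)\<^sup>2) powr l) * (ennreal (c\<^sup>2) * ((\<integral>\<^sup>+q. (a q)\<^sup>2 \<partial>lborel) * (\<integral>\<^sup>+q. (b q)\<^sup>2 \<partial>lborel)))"
      by (intro mult_left_mono Cauchy_Schwarz_nn_integral) auto
    also have "\<dots> = ennreal (c\<^sup>2) * (\<integral>\<^sup>+q. (a q)\<^sup>2 \<partial>lborel) * (ennreal ((1 + (norm p)\<^sup>2) powr l) * (\<integral>\<^sup>+q. (b q)\<^sup>2 \<partial>lborel))"
      by (simp only: mult_ac)
    also have "ennreal ((1 + (norm p)\<^sup>2) powr l) * (\<integral>\<^sup>+q. (b q)\<^sup>2 \<partial>lborel) =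
        (\<integral>\<^sup>+q. ennreal ((1 + (norm p)\<^sup>2) powr l * (1 / (bessel_weight (2 * l) (p - q) * bessel_weight (2 * l) q))\<^sup>2) \<partial>lborel)"
    proof -
      have b2: "ennreal ((1 + (norm p)\<^sup>2) powr l) * (b q)\<^sup>2 =
          ennreal ((1 + (norm p)\<^sup>2) powr l * (1 / (bessel_weight (2 * l) (p - q) * bessel_weight (2 * l) q))\<^sup>2)" for q
      proof -
        have "0 \<le> 1 / (w (p - q) * w q)" using w[of "p - q"] w[of q] by simp
        then have "(b q)\<^sup>2 = ennreal ((1 / (w (p - q) * w q))\<^sup>2)" unfolding b_def by (rule ennreal_power)
        then show ?thesis by (simp add: w_def ennreal_mult)
      qed
      have "(\<integral>\<^sup>+q. ennreal ((1 + (norm p)\<^sup>2) powr l) * (b q)\<^sup>2 \<partial>lborel) =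
          ennreal ((1 + (norm p)\<^sup>2) powr l) * (\<integral>\<^sup>+q. (b q)\<^sup>2 \<partial>lborel)"
        by (rule nn_integral_cmult) measurable
      then show ?thesis unfolding b2 by (rule sym)
    qed
    also have "ennreal (c\<^sup>2) * (\<integral>\<^sup>+q. (a q)\<^sup>2 \<partial>lborel) * \<dots> \<le> ennreal (c\<^sup>2) * (\<integral>\<^sup>+q. (a q)\<^sup>2 \<partial>lborel) * ennreal J"
      using convolution_weight_integral[OF l, of p] by (intro mult_left_mono) (auto simp: J_def D_def)
    also have "\<dots> = ennreal (c\<^sup>2 * J) * (\<integral>\<^sup>+q. (a q)\<^sup>2 \<partial>lborel)"
      using J by (simp add: ennreal_mult mult_ac)
    also have "(\<integral>\<^sup>+q. (a q)\<^sup>2 \<partial>lborel) = (\<integral>\<^sup>+q. ennreal ((f (p - q))\<^sup>2 * (g q)\<^sup>2) \<partial>lborel)"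
      using fg0 by (simp add: a_def ennreal_power power_mult_distrib)
    finally show ?thesis .
  qed
  have tot: "(\<integral>\<^sup>+p. ennreal ((cmod (h p))\<^sup>2) \<partial>lborel) \<le> ennreal (c\<^sup>2 * J * f2 * g2)"
  proof -
    have "(\<integral>\<^sup>+p. ennreal ((cmod (h p))\<^sup>2) \<partial>lborel) \<le>
        (\<integral>\<^sup>+p. ennreal (c\<^sup>2 * J) * (\<integral>\<^sup>+q. ennreal ((f (p - q))\<^sup>2 * (g q)\<^sup>2) \<partial>lborel) \<partial>lborel)"
      by (intro nn_integral_mono pt)
    also have "\<dots> = ennreal (c\<^sup>2 * J) * (\<integral>\<^sup>+p. (\<integral>\<^sup>+q. ennreal ((f (p - q))\<^sup>2 * (g q)\<^sup>2) \<partial>lborel) \<partial>lborel)"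
      by (rule nn_integral_cmult) measurable
    also have "(\<integral>\<^sup>+p. (\<integral>\<^sup>+q. ennreal ((f (p - q))\<^sup>2 * (g q)\<^sup>2) \<partial>lborel) \<partial>lborel) =
        (\<integral>\<^sup>+q. (\<integral>\<^sup>+p. ennreal ((f (p - q))\<^sup>2 * (g q)\<^sup>2) \<partial>lborel) \<partial>lborel)"
      by (rule lborel_pair.Fubini') measurable
    also have "\<dots> = (\<integral>\<^sup>+q. ennreal f2 * ennreal ((g q)\<^sup>2) \<partial>lborel)"
    proof (rule nn_integral_cong)
      fix q
      have "(\<integral>\<^sup>+p. ennreal ((f (p - q))\<^sup>2 * (g q)\<^sup>2) \<partial>lborel) = (\<integral>\<^sup>+p. ennreal ((f (p - q))\<^sup>2) \<partial>lborel) * ennreal ((g q)\<^sup>2)"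
        by (subst nn_integral_multc[symmetric]) (auto simp: ennreal_mult)
      also have "(\<integral>\<^sup>+p. ennreal ((f (p - q))\<^sup>2) \<partial>lborel) = ennreal f2"
        using nn_integral_lborel_affine[of 1 "\<lambda>p. ennreal ((f p)\<^sup>2)" "- q"] f2n by simp
      finally show "(\<integral>\<^sup>+p. ennreal ((f (p - q))\<^sup>2 * (g q)\<^sup>2) \<partial>lborel) = ennreal f2 * ennreal ((g q)\<^sup>2)" .
    qed
    also have "\<dots> = ennreal f2 * ennreal g2"
      by (subst nn_integral_cmult) (auto simp: g2n)
    finally show ?thesis using J fg2 by (simp add: ennreal_mult mult.assoc)
  qed
  then have "(\<integral>\<^sup>+p. ennreal ((cmod (h p))\<^sup>2) \<partial>lborel) < \<infinity>"
    by (rule le_less_trans) simp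
  then have h2: "integrable lborel (\<lambda>p. (cmod (h p))\<^sup>2)"
    by (simp add: integrable_iff_bounded)
  then show "square_int (\<lambda>p. complex_of_real (bessel_weight l p) * H p)"
    by (simp add: square_int_def h_def[abs_def, symmetric])
  have "ennreal (LINT p|lborel. (cmod (h p))\<^sup>2) \<le> ennreal (c\<^sup>2 * J * f2 * g2)"
    using tot nn_integral_eq_integral[OF h2] by simp
  then have "(LINT p|lborel. (cmod (h p))\<^sup>2) \<le> c\<^sup>2 * J * f2 * g2"
    using J fg2 by (subst (asm) ennreal_le_iff) auto
  then have "norm_L2 h \<le> sqrt (c\<^sup>2 * J * f2 * g2)"
    unfolding norm_L2_def by (rule real_sqrt_le_mono)
  also have "\<dots> = sqrt (c\<^sup>2 * J) * sqrt f2 * sqrt g2" by (simp add: real_sqrt_mult)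
  also have "c\<^sup>2 * J = (16 * pi) powr (- D) * Gamma (l - D) / Gamma l"
  proof -
    have "c\<^sup>2 = (2 * pi) powr (- D) * (2 * pi) powr (- D)"
      by (simp add: c_def fourier_const_def D_def power2_eq_square)
    also have "\<dots> = (4 * pi * pi) powr (- D)" by (simp flip: powr_mult) (simp add: mult_ac)
    finally have "c\<^sup>2 * (4 * pi) powr D = pi powr (- D) * ((4 * pi) powr (- D) * (4 * pi) powr D)"
      by (simp add: powr_mult)
    also have "(4 * pi) powr (- D) * (4 * pi) powr D = 1" by (simp flip: powr_add)
    finally have "c\<^sup>2 * (4 * pi) powr D = pi powr (- D)" by simp
    then have "c\<^sup>2 * J = pi powr (- D) * 16 powr (- D) * Gamma (l - D) / Gamma l"
      by (simp add: J_def mult.assoc[symmetric])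
    also have "pi powr (- D) * 16 powr (- D) = (16 * pi) powr (- D)" by (simp add: powr_mult mult.commute)
    finally show ?thesis .
  qed
  finally have "norm_L2 h \<le> product_const TYPE('a) l * sqrt f2 * sqrt g2"
    by (simp add: product_const_def D_def)
  then show "norm_L2 (\<lambda>p. complex_of_real (bessel_weight l p) * H p) \<le> product_const TYPE('a) l *
      norm_L2 (\<lambda>k. complex_of_real (bessel_weight (2 * l) k) * F k) *
      norm_L2 (\<lambda>k. complex_of_real (bessel_weight (2 * l) k) * G k)"
    unfolding norm_L2_def f2_eq g2_eq f2_def g2_def h_def .
qed

text \<open>
  Both factors are inverse transforms of integrable, square integrable functions, so their product is
  integrable and equals the inverse transform of the convolution. The weak form of Fourier inversion
  identifies the convolution as the transform of the product.
\<close>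
theorem sobolev_product:
  fixes f g :: "'a::euclidean_space \<Rightarrow> complex"
  assumes l: "l > real DIM('a) / 2" and f: "f \<in> sobolev (2 * l)" and g: "g \<in> sobolev (2 * l)"
  shows "(\<lambda>x. f x * g x) \<in> sobolev l"
    and "sobolev_norm l (\<lambda>x. f x * g x) \<le> product_const TYPE('a) l * sobolev_norm (2 * l) f * sobolev_norm (2 * l) g"
proof -
  have "real DIM('a) / 2 \<ge> 0" by simp
  then have l2: "2 * l > real DIM('a) / 2" using l by linarith
  obtain F where F: "integrable lborel F" "square_int F"
    "square_int (\<lambda>k. complex_of_real (bessel_weight (2 * l) k) * F k)"
    "sobolev_norm (2 * l) f = norm_L2 (\<lambda>k. complex_of_real (bessel_weight (2 * l) k) * F k)"
    "AE x in lborel. f x = fourier F (- x)"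
    by (rule sobolev_fourier_representation[OF f l2])
  obtain G where G: "integrable lborel G" "square_int G"
    "square_int (\<lambda>k. complex_of_real (bessel_weight (2 * l) k) * G k)"
    "sobolev_norm (2 * l) g = norm_L2 (\<lambda>k. complex_of_real (bessel_weight (2 * l) k) * G k)"
    "AE x in lborel. g x = fourier G (- x)"
    by (rule sobolev_fourier_representation[OF g l2])
  have [measurable]: "f \<in> borel_measurable borel" "g \<in> borel_measurable borel"
    using f g by (auto simp: sobolev_def represents_def)
  define H where "H p = complex_of_real (fourier_const TYPE('a)) * (LINT q|lborel. G q * F (p - q))" for p
  have H_int: "integrable lborel H" and H_f: "fourier H k = fourier F k * fourier G k" for k
    unfolding H_def[abs_def] by (rule fourier_convolution[OF F(1) G(1)])+
  have u_int: "integrable lborel (\<lambda>x. fourier H (- x))"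
    unfolding H_f by (rule square_int_integrable_mult[OF fourier_square_int[OF F(1,2)] fourier_square_int[OF G(1,2)]])
  then have [measurable]: "(\<lambda>x. fourier H (- x)) \<in> borel_measurable borel" by (auto dest: borel_measurable_integrable)
  have ae: "AE x in lborel. f x * g x = fourier H (- x)"
    using F(5) G(5) by eventually_elim (simp add: H_f)
  have fg_int: "integrable lborel (\<lambda>x. f x * g x)"
    using u_int ae by (subst integrable_cong_AE[of _ _ "\<lambda>x. fourier H (- x)"]) auto
  have hsq: "square_int (\<lambda>p. complex_of_real (bessel_weight l p) * H p)"
    and hle: "norm_L2 (\<lambda>p. complex_of_real (bessel_weight l p) * H p) \<le> product_const TYPE('a) l *
      norm_L2 (\<lambda>k. complex_of_real (bessel_weight (2 * l) k) * F k) *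
      norm_L2 (\<lambda>k. complex_of_real (bessel_weight (2 * l) k) * G k)"
    unfolding H_def by (rule weighted_convolution_bound[OF l F(1) G(1) F(3) G(3)])+
  have eq: "(LINT x|lborel. (f x * g x) * fourier (\<lambda>k. complex_of_real (bessel_weight l k) * \<phi> k) x) =
      (LINT k|lborel. (complex_of_real (bessel_weight l k) * H k) * \<phi> k)" if \<phi>: "\<phi> \<in> schwartz" for \<phi>
  proof -
    define \<psi> where "\<psi> k = complex_of_real (bessel_weight l k) * \<phi> k" for k
    have \<psi>: "integrable lborel \<psi>" unfolding \<psi>_def by (rule schwartz_bessel_integrable(1)[OF \<phi>])
    then have [measurable]: "\<psi> \<in> borel_measurable borel" by (auto dest: borel_measurable_integrable)
    obtain C where C: "\<And>x. cmod (\<psi> x) \<le> C" using schwartz_bessel_integrable(2)[OF \<phi>, of l] unfolding \<psi>_def by blast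
    have cont: "isCont \<psi> p" for p unfolding \<psi>_def by (rule schwartz_bessel_integrable(3)[OF \<phi>])
    have "(LINT x|lborel. (f x * g x) * fourier \<psi> x) = (LINT x|lborel. fourier H (- x) * fourier \<psi> x)"
      using ae by (intro integral_cong_AE) (auto elim: eventually_mono)
    also have "\<dots> = (LINT p|lborel. H p * \<psi> p)"
      by (rule fourier_duality[OF H_int \<psi> C cont u_int])
    finally show ?thesis unfolding \<psi>_def by (simp add: mult_ac)
  qed
  show "(\<lambda>x. f x * g x) \<in> sobolev l"
    by (rule sobolevI(1)[OF fg_int hsq eq])
  show "sobolev_norm l (\<lambda>x. f x * g x) \<le> product_const TYPE('a) l * sobolev_norm (2 * l) f * sobolev_norm (2 * l) g"
    using hle sobolevI(2)[OF fg_int hsq eq] by (simp only: F(4) G(4))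
qed

section \<open>Gaussians and the sharp constant\<close>

text \<open>
  The admissible constants form a closed set, being defined by inequalities that are not strict, and
  it is not empty by the product inequality. So the least one exists and lies in the set.
\<close>
lemma sharp_const_bounds:
  assumes l: "l > real DIM('a::euclidean_space) / 2"
  shows "sharp_const TYPE('a) l (2 * l) (2 * l) \<le> product_const TYPE('a) l"
    and "\<sigma> > 0 \<Longrightarrow> \<tau> > 0 \<Longrightarrow> K_gauss TYPE('a) l (2 * l) (2 * l) \<sigma> \<tau> \<le> sharp_const TYPE('a) l (2 * l) (2 * l)"
proof -
  define S where "S = {K. 0 \<le> K \<and> (\<forall>(f :: 'a \<Rightarrow> complex) \<in> sobolev (2 * l). \<forall>g \<in> sobolev (2 * l).
        (\<lambda>x. f x * g x) \<in> sobolev l \<and>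
        sobolev_norm l (\<lambda>x. f x * g x) \<le> K * sobolev_norm (2 * l) f * sobolev_norm (2 * l) g)}"
  have l0: "l > 0" using l by (meson divide_nonneg_pos of_nat_0_le_iff le_less_trans zero_less_numeral)
  have pS: "product_const TYPE('a) l \<in> S"
  proof -
    have "0 \<le> product_const TYPE('a) l" using l l0 by (simp add: product_const_def)
    then show ?thesis using sobolev_product[OF l] by (auto simp: S_def)
  qed
  have "S = {0..} \<inter> (\<Inter>f\<in>sobolev (2 * l). \<Inter>g\<in>sobolev (2 * l).
      {K. sobolev_norm l (\<lambda>x. f x * g x :: complex) \<le> K * sobolev_norm (2 * l) f * sobolev_norm (2 * l) (g :: 'a \<Rightarrow> complex)})"
    using sobolev_product(1)[OF l] by (auto simp: S_def)
  also have "closed \<dots>"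
    by (intro closed_Int closed_INT ballI closed_Collect_le continuous_intros)
  finally have "closed S" .
  moreover have bdd: "bdd_below S" by (auto simp: S_def intro!: bdd_belowI[of _ 0])
  ultimately have inf: "Inf S \<in> S" using pS by (intro closed_contains_Inf) auto
  have "sharp_const TYPE('a) l (2 * l) (2 * l) = (LEAST K. K \<in> S)"
    by (simp add: sharp_const_def S_def)
  also have "\<dots> = Inf S"
  proof (rule Least_equality)
    show "Inf S \<in> S" by (rule inf)
    show "Inf S \<le> K" if "K \<in> S" for K using that bdd by (rule cInf_lower)
  qed
  finally have eq: "sharp_const TYPE('a) l (2 * l) (2 * l) = Inf S" .
  show "sharp_const TYPE('a) l (2 * l) (2 * l) \<le> product_const TYPE('a) l"
    unfolding eq by (rule cInf_lower[OF pS bdd])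
  assume st: "\<sigma> > 0" "\<tau> > 0"
  have prod: "(\<lambda>x::'a. gaussian \<sigma> x * gaussian \<tau> x) = gaussian (\<sigma> + \<tau>)"
    by (simp add: fun_eq_iff gaussian_def algebra_simps add_divide_distrib flip: of_real_mult exp_add)
  have nn: "0 \<le> sobolev_norm (2 * l) (gaussian s :: 'a \<Rightarrow> complex)" if "s > 0" for s
    unfolding sobolev_norm_gaussian[OF that]
    by (intro real_sqrt_ge_zero Bochner_Integration.integral_nonneg) auto
  have "sobolev_norm l (\<lambda>x::'a. gaussian \<sigma> x * gaussian \<tau> x) \<le>
      Inf S * sobolev_norm (2 * l) (gaussian \<sigma> :: 'a \<Rightarrow> complex) * sobolev_norm (2 * l) (gaussian \<tau> :: 'a \<Rightarrow> complex)"
    using inf gaussian_in_sobolev[OF st(1), of "2 * l", where 'a = 'a] gaussian_in_sobolev[OF st(2), of "2 * l", where 'a = 'a]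
    unfolding S_def by blast
  then have le: "sobolev_norm l (gaussian (\<sigma> + \<tau>) :: 'a \<Rightarrow> complex) \<le>
      Inf S * (sobolev_norm (2 * l) (gaussian \<sigma> :: 'a \<Rightarrow> complex) * sobolev_norm (2 * l) (gaussian \<tau> :: 'a \<Rightarrow> complex))"
    unfolding prod by (simp add: mult.assoc)
  have S0: "0 \<le> K" if "K \<in> S" for K using that by (simp add: S_def)
  have "0 \<le> Inf S" by (rule S0[OF inf])
  then show "K_gauss TYPE('a) l (2 * l) (2 * l) \<sigma> \<tau> \<le> sharp_const TYPE('a) l (2 * l) (2 * l)"
    unfolding eq K_gauss_def using le nn[OF st(1)] nn[OF st(2)]
    by (cases "sobolev_norm (2 * l) (gaussian \<sigma> :: 'a \<Rightarrow> complex) * sobolev_norm (2 * l) (gaussian \<tau> :: 'a \<Rightarrow> complex) = 0")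
       (auto simp: pos_divide_le_eq less_le)
qed

lemma asymp_form_product_const: "asymp_form DIM('a::euclidean_space) (product_const TYPE('a))"
proof -
  define D where "D = real DIM('a) / 2"
  have "near_one (\<lambda>l. Gamma (l + - D) / Gamma (l + 0) * l powr (0 - - D))"
    by (rule near_one_Gamma_ratio)
  from near_one_powr[OF this, of "1 / 2"] show ?thesis
    unfolding asymp_form_iff_near_one
  proof (rule near_one_cong[rotated])
    show "\<forall>\<^sub>F l in at_top. product_const TYPE('a) l * (16 * pi * l) powr (real DIM('a) / 4) =
      (Gamma (l + - D) / Gamma (l + 0) * l powr (0 - - D)) powr (1 / 2)"
      using eventually_gt_at_top[of 0] eventually_gt_at_top[of D]
    proof eventually_elim
      case (elim l)
      define R where "R = Gamma (l - D) / Gamma l"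
      have R: "0 \<le> R" using elim by (simp add: R_def)
      have "product_const TYPE('a) l = ((16 * pi) powr (- D) * R) powr (1 / 2)"
        unfolding product_const_def D_def[symmetric] R_def
        using elim by (subst powr_half_sqrt) (auto simp: D_def)
      moreover have "(16 * pi * l) powr (real DIM('a) / 4) = ((16 * pi) powr D * l powr D) powr (1 / 2)"
        using elim by (simp add: powr_mult powr_powr D_def)
      ultimately have "product_const TYPE('a) l * (16 * pi * l) powr (real DIM('a) / 4) =
          (((16 * pi) powr (- D) * R) * ((16 * pi) powr D * l powr D)) powr (1 / 2)"
        by (simp only: powr_mult)
      also have "((16 * pi) powr (- D) * R) * ((16 * pi) powr D * l powr D) =
          ((16 * pi) powr (- D) * (16 * pi) powr D) * (R * l powr D)" by (simp only: mult_ac)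
      also have "(16 * pi) powr (- D) * (16 * pi) powr D = 1" by (simp flip: powr_add)
      finally show ?case by (simp add: R_def)
    qed
  qed
qed

text \<open>
  This is the squared norm of order \<open>L\<close> of the Gaussian with parameter
  \<open>1 / (2 * L)\<close>, divided by its leading term \<open>(4 * pi * L) powr (d / 2)\<close>.
\<close>
definition gaussian_moment :: "'a::euclidean_space itself \<Rightarrow> real \<Rightarrow> real" where
  "gaussian_moment _ L = (LINT q|lborel. (1 + (norm (q :: 'a))\<^sup>2 / (2 * L)) powr L * exp (- (norm q)\<^sup>2)) /
    (2 * pi) powr (real DIM('a) / 2)"

text \<open>
  The lower bound combines \<open>z - z\<^sup>2 \<le> ln (1 + z)\<close> for \<open>z = y / L\<close>
  with \<open>1 - x \<le> exp (- x)\<close>. The factor \<open>y\<^sup>2\<close> that arises is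
  absorbed by half of the exponential decay, at the price of the constant eight.
\<close>
lemma powr_exp_bounds:
  fixes y L :: real
  assumes "0 \<le> y" "0 < L"
  shows "(1 + y / L) powr L * exp (- 2 * y) \<le> exp (- y)"
    and "exp (- y) - 8 / L * exp (- y / 2) \<le> (1 + y / L) powr L * exp (- 2 * y)"
proof -
  define z where "z = y / L"
  have z: "0 \<le> z" "L * z = y" using assms by (auto simp: z_def)
  have pw: "(1 + z) powr L = exp (L * ln (1 + z))" using z by (simp add: powr_def)
  have "L * ln (1 + z) \<le> y"
    using mult_left_mono[OF ln_add_one_self_le_self[OF z(1)], of L] assms z(2) by simp
  then have "exp (L * ln (1 + z)) * exp (- 2 * y) \<le> exp y * exp (- 2 * y)"
    by (intro mult_right_mono) auto
  then show "(1 + y / L) powr L * exp (- 2 * y) \<le> exp (- y)"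
    unfolding z_def[symmetric] pw by (simp flip: exp_add)
  have ln: "z - z\<^sup>2 \<le> ln (1 + z)"
  proof (cases "z \<le> 1")
    case True
    then show ?thesis using ln_one_plus_pos_lower_bound z by blast
  next
    case False
    then have "z \<le> z\<^sup>2" by (simp add: power2_eq_square)
    moreover have "0 \<le> ln (1 + z)" using z by simp
    ultimately show ?thesis by linarith
  qed
  have up: "exp (y - y\<^sup>2 / L) \<le> exp (L * ln (1 + z))"
  proof -
    have "y - y\<^sup>2 / L = L * (z - z\<^sup>2)" using assms by (simp add: z_def power2_eq_square field_simps)
    then show ?thesis using ln assms by (simp add: mult_left_mono)
  qed
  have lin: "exp y * (1 - y\<^sup>2 / L) \<le> exp (y - y\<^sup>2 / L)"
    using exp_ge_add_one_self[of "- y\<^sup>2 / L"] by (simp add: exp_diff exp_minus divide_inverse mult_left_mono)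
  have "exp y * (1 - y\<^sup>2 / L) * exp (- 2 * y) \<le> exp (L * ln (1 + z)) * exp (- 2 * y)"
    by (intro mult_right_mono order_trans[OF lin up]) simp
  moreover have "exp y * (1 - y\<^sup>2 / L) * exp (- 2 * y) = exp (- y) - y\<^sup>2 * exp (- y) / L"
    by (simp add: algebra_simps flip: exp_add)
  moreover have "y\<^sup>2 * exp (- y) \<le> 8 * exp (- y / 2)"
  proof -
    have "1 + y / 2 + (y / 2)\<^sup>2 / 2 \<le> exp (y / 2)"
      using assms by (intro exp_lower_Taylor_quadratic) simp
    then have "y\<^sup>2 \<le> 8 * exp (y / 2)" using assms by (simp add: power_divide)
    then have "y\<^sup>2 * exp (- y) \<le> 8 * exp (y / 2) * exp (- y)" by (intro mult_right_mono) auto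
    also have "\<dots> = 8 * exp (- y / 2)" by (simp flip: exp_add)
    finally show ?thesis .
  qed
  then have "y\<^sup>2 * exp (- y) / L \<le> 8 / L * exp (- y / 2)"
    using assms by (simp add: divide_right_mono)
  ultimately show "exp (- y) - 8 / L * exp (- y / 2) \<le> (1 + y / L) powr L * exp (- 2 * y)"
    unfolding z_def[symmetric] pw by linarith
qed

lemma near_one_gaussian_moment: "near_one (gaussian_moment TYPE('a::euclidean_space))"
proof -
  define D where "D = real DIM('a) / 2"
  define P where "P = (2 * pi) powr D"
  define C where "C = 8 * (4 * pi) powr D / P"
  have P: "P > 0" by (simp add: P_def)
  have g1: "has_bochner_integral lborel (\<lambda>q::'a. exp (- ((norm q)\<^sup>2 / 2))) P"
    using gaussian_integral[of 1, where 'a = 'a] by (simp add: P_def D_def)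
  have g2: "has_bochner_integral lborel (\<lambda>q::'a. exp (- ((norm q)\<^sup>2 / 2) / 2)) ((4 * pi) powr D)"
    using gaussian_integral[of "1 / 2", where 'a = 'a] by (simp add: D_def)
  have bounds: "1 - C / L \<le> gaussian_moment TYPE('a) L \<and> gaussian_moment TYPE('a) L \<le> 1" if L: "L > 0" for L
  proof -
    define f where "f q = (1 + (norm (q :: 'a))\<^sup>2 / (2 * L)) powr L * exp (- (norm q)\<^sup>2)" for q
    have [measurable]: "f \<in> borel_measurable borel" unfolding f_def by measurable
    have up: "f q \<le> exp (- ((norm q)\<^sup>2 / 2))" and lo: "exp (- ((norm q)\<^sup>2 / 2)) - 8 / L * exp (- ((norm q)\<^sup>2 / 2) / 2) \<le> f q" for q
      using powr_exp_bounds[of "(norm q)\<^sup>2 / 2" L] L by (simp_all add: f_def)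
    have f_int: "integrable lborel f"
    proof (rule Bochner_Integration.integrable_bound)
      show "integrable lborel (\<lambda>q::'a. exp (- ((norm q)\<^sup>2 / 2)))" using g1 by (simp add: has_bochner_integral_iff)
      show "AE q in lborel. norm (f q) \<le> norm (exp (- ((norm q)\<^sup>2 / 2)))"
        using up by (intro AE_I2) (simp add: f_def)
    qed measurable
    have "integral\<^sup>L lborel f \<le> (LINT q|lborel. exp (- ((norm (q::'a))\<^sup>2 / 2)))"
      using g1 by (intro integral_mono f_int up) (simp add: has_bochner_integral_iff)
    then have 1: "integral\<^sup>L lborel f \<le> P" using g1 by (simp add: has_bochner_integral_iff)
    have "has_bochner_integral lborel (\<lambda>q::'a. exp (- ((norm q)\<^sup>2 / 2)) - 8 / L * exp (- ((norm q)\<^sup>2 / 2) / 2)) (P - 8 / L * (4 * pi) powr D)"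
      by (intro has_bochner_integral_diff g1 has_bochner_integral_mult_right g2)
    then have "P - 8 / L * (4 * pi) powr D \<le> integral\<^sup>L lborel f"
      using integral_mono[OF _ f_int lo] by (simp add: has_bochner_integral_iff)
    then have "(P - 8 / L * (4 * pi) powr D) / P \<le> integral\<^sup>L lborel f / P"
      using P by (intro divide_right_mono) auto
    moreover have "(P - 8 / L * (4 * pi) powr D) / P = 1 - C / L"
      using P L by (simp add: C_def field_simps)
    moreover have "integral\<^sup>L lborel f / P \<le> 1" using 1 P by simp
    moreover have "gaussian_moment TYPE('a) L = integral\<^sup>L lborel f / P"
      by (simp add: gaussian_moment_def f_def[abs_def] P_def D_def)
    ultimately show ?thesis by simp
  qed
  show ?thesis
  proof (rule near_one_squeeze)
    show "near_one (\<lambda>L. 1 - C / L)"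
    proof -
      have "(\<lambda>L. 1 - C / L - 1) \<in> O[at_top](\<lambda>L. 1 / L)" by real_asymp
      then show ?thesis by (simp add: near_one_def)
    qed
    show "near_one (\<lambda>_. 1)" by (simp add: near_one_def)
    show "\<forall>\<^sub>F L in at_top. 1 - C / L \<le> gaussian_moment TYPE('a) L"
      by (rule eventually_mono[OF eventually_gt_at_top[of 0]]) (use bounds in blast)
    show "\<forall>\<^sub>F L in at_top. gaussian_moment TYPE('a) L \<le> 1"
      by (rule eventually_mono[OF eventually_gt_at_top[of 0]]) (use bounds in blast)
  qed
qed

lemma sobolev_norm_gaussian_moment:
  assumes "L > 0"
  shows "sobolev_norm L (gaussian (1 / (2 * L)) :: 'a::euclidean_space \<Rightarrow> complex) =
    sqrt ((4 * pi * L) powr (real DIM('a) / 2) * gaussian_moment TYPE('a) L)"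
proof -
  define D where "D = real DIM('a) / 2"
  define \<sigma> where "\<sigma> = 1 / (2 * L)"
  have s: "\<sigma> > 0" using assms by (simp add: \<sigma>_def)
  define f where "f k = (1 + (norm (k :: 'a))\<^sup>2) powr L * (\<sigma> powr (- real DIM('a)) * exp (- (norm k)\<^sup>2 / \<sigma>))" for k
  define g where "g q = (1 + (norm (q :: 'a))\<^sup>2 / (2 * L)) powr L * exp (- (norm q)\<^sup>2)" for q
  have [measurable]: "f \<in> borel_measurable borel" "g \<in> borel_measurable borel"
    unfolding f_def g_def by measurable
  have sc: "sqrt \<sigma> ^ DIM('a) * f (sqrt \<sigma> *\<^sub>R q) = (2 * L) powr D * g q" for q
  proof -
    have n: "(norm (sqrt \<sigma> *\<^sub>R q))\<^sup>2 = \<sigma> * (norm q)\<^sup>2"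
      using s by (simp add: power_mult_distrib)
    have "sqrt \<sigma> ^ DIM('a) = \<sigma> powr D"
      using s by (simp add: D_def powr_half_sqrt_powr powr_realpow real_sqrt_power)
    moreover have "\<sigma> powr D * \<sigma> powr (- real DIM('a)) = (2 * L) powr D"
    proof -
      have "\<sigma> powr D * \<sigma> powr (- real DIM('a)) = \<sigma> powr (- D)"
        by (simp add: D_def flip: powr_add)
      also have "\<dots> = (2 * L) powr D"
        using assms by (simp add: \<sigma>_def powr_minus powr_divide)
      finally show ?thesis .
    qed
    moreover have "- (\<sigma> * (norm q)\<^sup>2) / \<sigma> = - (norm q)\<^sup>2" "\<sigma> * (norm q)\<^sup>2 = (norm q)\<^sup>2 / (2 * L)"
      using s by (simp_all add: \<sigma>_def)
    ultimately show ?thesis unfolding f_def g_def n by (simp add: mult_ac)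
  qed
  have eqn: "(\<integral>\<^sup>+k. ennreal (f k) \<partial>lborel) = (\<integral>\<^sup>+q. ennreal ((2 * L) powr D * g q) \<partial>lborel)"
  proof -
    have "(\<integral>\<^sup>+k. ennreal (f k) \<partial>lborel) = ennreal (\<bar>sqrt \<sigma>\<bar> ^ DIM('a)) * (\<integral>\<^sup>+q. ennreal (f (0 + sqrt \<sigma> *\<^sub>R q)) \<partial>lborel)"
      using s by (intro nn_integral_lborel_affine) auto
    also have "\<dots> = (\<integral>\<^sup>+q. ennreal (\<bar>sqrt \<sigma>\<bar> ^ DIM('a)) * ennreal (f (0 + sqrt \<sigma> *\<^sub>R q)) \<partial>lborel)"
      by (rule nn_integral_cmult[symmetric]) measurable
    also have "\<dots> = (\<integral>\<^sup>+q. ennreal ((2 * L) powr D * g q) \<partial>lborel)"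
      unfolding sc[symmetric] using s by (simp add: f_def ennreal_mult)
    finally show ?thesis .
  qed
  have "integral\<^sup>L lborel f = (LINT q|lborel. (2 * L) powr D * g q)"
  proof -
    have "integral\<^sup>L lborel f = enn2real (\<integral>\<^sup>+k. ennreal (f k) \<partial>lborel)"
      by (rule integral_eq_nn_integral) (auto simp: f_def)
    moreover have "(LINT q|lborel. (2 * L) powr D * g q) = enn2real (\<integral>\<^sup>+q. ennreal ((2 * L) powr D * g q) \<partial>lborel)"
      by (rule integral_eq_nn_integral) (auto simp: g_def)
    ultimately show ?thesis using eqn by simp
  qed
  also have "\<dots> = (2 * L) powr D * ((2 * pi) powr D * gaussian_moment TYPE('a) L)"
    by (simp add: g_def gaussian_moment_def D_def)
  also have "\<dots> = (4 * pi * L) powr D * gaussian_moment TYPE('a) L"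
  proof -
    have "(4 * pi * L) powr D = ((2 * L) * (2 * pi)) powr D" by (simp add: mult_ac)
    also have "\<dots> = (2 * L) powr D * (2 * pi) powr D" by (rule powr_mult)
    finally show ?thesis by simp
  qed
  finally show ?thesis
    unfolding sobolev_norm_gaussian[OF s, unfolded \<sigma>_def] by (simp add: f_def[abs_def] \<sigma>_def D_def)
qed

text \<open>
  The numerator has order \<open>l\<close> and parameter \<open>1 / (2 l)\<close>, the denominators
  order \<open>2 l\<close> and parameter \<open>1 / (4 l)\<close>. In both cases order times parameter
  is one half, and all three norms are given by \<open>gaussian_moment\<close>.
\<close>
lemma asymp_form_K_gauss:
  "asymp_form DIM('a::euclidean_space) (\<lambda>l. K_gauss TYPE('a) l (2 * l) (2 * l) (1 / (4 * l)) (1 / (4 * l)))"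
proof -
  define \<Psi> where "\<Psi> = gaussian_moment TYPE('a)"
  have \<Psi>: "near_one \<Psi>" unfolding \<Psi>_def by (rule near_one_gaussian_moment)
  have \<Psi>2: "near_one (\<lambda>l. \<Psi> (2 * l + 0))" by (rule near_one_affine[OF \<Psi>]) simp
  have "near_one (\<lambda>l. \<Psi> l powr (1 / 2) / \<Psi> (2 * l + 0))"
    by (rule near_one_divide[OF near_one_powr[OF \<Psi>] \<Psi>2])
  then show ?thesis
    unfolding asymp_form_iff_near_one
  proof (rule near_one_cong[rotated])
    show "\<forall>\<^sub>F l in at_top. K_gauss TYPE('a) l (2 * l) (2 * l) (1 / (4 * l)) (1 / (4 * l)) * (16 * pi * l) powr (real DIM('a) / 4) =
      \<Psi> l powr (1 / 2) / \<Psi> (2 * l + 0)"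
      using eventually_gt_at_top[of 0] near_one_eventually_pos[OF \<Psi>] near_one_eventually_pos[OF \<Psi>2]
    proof eventually_elim
      case (elim l)
      define E where "E = real DIM('a) / 4"
      define A where "A = (4 * pi * l) powr (2 * E)"
      define B where "B = (8 * pi * l) powr (2 * E)"
      have E: "real DIM('a) / 2 = 2 * E" by (simp add: E_def)
      have num: "sobolev_norm l (gaussian (1 / (4 * l) + 1 / (4 * l)) :: 'a \<Rightarrow> complex) = sqrt (A * \<Psi> l)"
        using sobolev_norm_gaussian_moment[of l, where 'a = 'a] elim by (simp add: A_def \<Psi>_def E)
      have "sobolev_norm (2 * l) (gaussian (1 / (2 * (2 * l))) :: 'a \<Rightarrow> complex) = sqrt ((4 * pi * (2 * l)) powr (real DIM('a) / 2) * \<Psi> (2 * l))"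
        unfolding \<Psi>_def by (rule sobolev_norm_gaussian_moment) (use elim in simp)
      then have den: "sobolev_norm (2 * l) (gaussian (1 / (4 * l)) :: 'a \<Rightarrow> complex) = sqrt (B * \<Psi> (2 * l))"
        by (simp add: B_def E mult.assoc[symmetric])
      have B: "0 < B" "0 < A" using elim by (auto simp: B_def A_def)
      have sA: "sqrt A * (16 * pi * l) powr E = B"
      proof -
        have "sqrt A = (4 * pi * l) powr E"
          unfolding A_def using elim by (subst powr_half_sqrt[symmetric]) (auto simp: powr_powr)
        then have "sqrt A * (16 * pi * l) powr E = ((4 * pi * l) * (16 * pi * l)) powr E"
          by (simp only: powr_mult)
        also have "(4 * pi * l) * (16 * pi * l) = (8 * pi * l) powr 2"
          using elim by (simp add: power2_eq_square)
        also have "\<dots> powr E = B" by (simp only: B_def powr_powr)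
        finally show ?thesis .
      qed
      have K: "K_gauss TYPE('a) l (2 * l) (2 * l) (1 / (4 * l)) (1 / (4 * l)) = sqrt A * sqrt (\<Psi> l) / (B * \<Psi> (2 * l))"
      proof -
        have "sqrt (B * \<Psi> (2 * l)) * sqrt (B * \<Psi> (2 * l)) = B * \<Psi> (2 * l)" using B elim by simp
        then show ?thesis unfolding K_gauss_def num den real_sqrt_mult[of A] by (simp only:)
      qed
      have "K_gauss TYPE('a) l (2 * l) (2 * l) (1 / (4 * l)) (1 / (4 * l)) * (16 * pi * l) powr E = B * sqrt (\<Psi> l) / (B * \<Psi> (2 * l))"
      proof -
        have "sqrt A * sqrt (\<Psi> l) * (16 * pi * l) powr E = B * sqrt (\<Psi> l)"
          unfolding sA[symmetric] by (simp only: mult_ac)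
        then show ?thesis unfolding K times_divide_eq_left by (simp only:)
      qed
      then show ?case using B elim by (simp add: E_def powr_half_sqrt)
    qed
  qed
qed

lemma asymp_form_sharp_const:
  "asymp_form DIM('a::euclidean_space) (\<lambda>l. sharp_const TYPE('a) l (2 * l) (2 * l))"
  unfolding asymp_form_iff_near_one
proof (rule near_one_squeeze)
  show "near_one (\<lambda>l. K_gauss TYPE('a) l (2 * l) (2 * l) (1 / (4 * l)) (1 / (4 * l)) * (16 * pi * l) powr (real DIM('a) / 4))"
    using asymp_form_K_gauss[where 'a = 'a] by (simp only: asymp_form_iff_near_one)
  show "near_one (\<lambda>l. product_const TYPE('a) l * (16 * pi * l) powr (real DIM('a) / 4))"
    using asymp_form_product_const[where 'a = 'a] by (simp only: asymp_form_iff_near_one)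
  show "\<forall>\<^sub>F l in at_top. K_gauss TYPE('a) l (2 * l) (2 * l) (1 / (4 * l)) (1 / (4 * l)) * (16 * pi * l) powr (real DIM('a) / 4)
      \<le> sharp_const TYPE('a) l (2 * l) (2 * l) * (16 * pi * l) powr (real DIM('a) / 4)"
    using eventually_gt_at_top[of 0] eventually_gt_at_top[of "real DIM('a) / 2"]
    by eventually_elim (intro mult_right_mono sharp_const_bounds(2), auto)
  show "\<forall>\<^sub>F l in at_top. sharp_const TYPE('a) l (2 * l) (2 * l) * (16 * pi * l) powr (real DIM('a) / 4)
      \<le> product_const TYPE('a) l * (16 * pi * l) powr (real DIM('a) / 4)"
    using eventually_gt_at_top[of "real DIM('a) / 2"]
    by eventually_elim (intro mult_right_mono sharp_const_bounds(1), auto)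
qed

section \<open>The minimum of D22 and the asymptotic constants\<close>

text \<open>
  The inequality of the means bounds \<open>\<xi> \<eta>\<close> and
  \<open>(1 - 2 \<xi>) (1 - 2 \<eta>)\<close> in terms of \<open>S = \<xi> + \<eta>\<close> and
  \<open>1 - S\<close>, and once more \<open>S (1 - S) \<le> 1 / 4\<close>.
\<close>
lemma D22_minimum:
  assumes "(\<xi>, \<eta>) \<in> Delta22"
  shows "16 \<le> D22 \<xi> \<eta>"
proof -
  have pos: "0 < \<xi>" "0 < \<eta>" "2 * \<xi> < 1" "2 * \<eta> < 1"
    using assms by (auto simp: Delta22_def)
  define S where "S = \<xi> + \<eta>"
  have amgm: "4 * (a * b) \<le> (a + b)\<^sup>2" for a b :: real
    using zero_le_power2[of "a - b"] by (simp add: power2_eq_square algebra_simps)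
  have "(4 * (\<xi> * \<eta>)) * (4 * ((1 - 2 * \<xi>) * (1 - 2 * \<eta>))) \<le> S\<^sup>2 * (2 - 2 * S)\<^sup>2"
  proof (intro mult_mono)
    show "4 * (\<xi> * \<eta>) \<le> S\<^sup>2" using amgm[of \<xi> \<eta>] by (simp add: S_def)
    have "1 - 2 * \<xi> + (1 - 2 * \<eta>) = 2 - 2 * S" by (simp add: S_def)
    then show "4 * ((1 - 2 * \<xi>) * (1 - 2 * \<eta>)) \<le> (2 - 2 * S)\<^sup>2"
      using amgm[of "1 - 2 * \<xi>" "1 - 2 * \<eta>"] by simp
  qed (use pos in auto)
  also have "\<dots> = (4 * (S * (1 - S))) * (S * (1 - S))"
    by (simp add: power2_eq_square algebra_simps)
  also have "\<dots> \<le> 1 * (S * (1 - S))"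
    using amgm[of S "1 - S"] pos by (intro mult_right_mono) (auto simp: S_def)
  finally have "16 * (\<xi> * \<eta> * (1 - 2 * \<xi>) * (1 - 2 * \<eta>)) \<le> (1 - \<xi> - \<eta>) * (\<xi> + \<eta>)"
    by (simp add: S_def algebra_simps)
  then show ?thesis
    using pos by (simp add: D22_def pos_le_divide_eq)
qed

theorem corollary4p8:
  shows
    "asymp_form CARD('d::finite) (\<lambda>l. K_upper l (2 * l) (2 * l) CARD('d)) \<and>
     ((\<forall>(\<xi>, \<eta>) \<in> Delta22. 0 < D22 \<xi> \<eta>) \<and>
      (1/4, 1/4) \<in> Delta22 \<and>
      (\<forall>(\<xi>, \<eta>) \<in> Delta22. D22 (1/4) (1/4) \<le> D22 \<xi> \<eta>) \<and>
      D22 (1/4) (1/4) = 16 \<and>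
      asymp_form CARD('d)
        (\<lambda>l. K_gauss TYPE(real ^ 'd) l (2 * l) (2 * l) (1 / (4 * l)) (1 / (4 * l)))) \<and>
     asymp_form CARD('d) (\<lambda>l. sharp_const TYPE(real ^ 'd) l (2 * l) (2 * l))"
proof -
  have dim: "DIM(real ^ 'd) = CARD('d)" by simp
  have val: "D22 (1/4) (1/4) = 16" by (simp add: D22_def)
  have "asymp_form CARD('d) (\<lambda>l. K_gauss TYPE(real ^ 'd) l (2 * l) (2 * l) (1 / (4 * l)) (1 / (4 * l)))"
    using asymp_form_K_gauss[where 'a = "real ^ 'd"] unfolding dim .
  moreover have "asymp_form CARD('d) (\<lambda>l. sharp_const TYPE(real ^ 'd) l (2 * l) (2 * l))"
    using asymp_form_sharp_const[where 'a = "real ^ 'd"] unfolding dim .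
  moreover have "(1/4, 1/4) \<in> Delta22" by (simp add: Delta22_def)
  moreover have "\<forall>(\<xi>, \<eta>) \<in> Delta22. 16 \<le> D22 \<xi> \<eta>" using D22_minimum by blast
  moreover from this have "\<forall>(\<xi>, \<eta>) \<in> Delta22. 0 < D22 \<xi> \<eta>" by fastforce
  ultimately show ?thesis using asymp_form_K_upper[of "CARD('d)"] val by simp
qed

end
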